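(* Let $|q|<1$, $k\ge2$ an integer and $i\in\{1,\dots,k\}$. Then \[ \sum_{r^{(1)},\dots,r^{(k-1)}\in\mathbb Z^2} \frac{q^{\frac12\sum_{j=1}^{k-1}r^{(j)}Cr^{(j)}+\sum_{j=i}^{k-1}|r^{(j)}|}\,(1-q^{|r^{(i-1)}|+1})\,(q^3;q^3)_{|r^{(k-1)}|}} {(q)_{r^{(1)}-r^{(2)}}\cdots(q)_{r^{(k-2)}-r^{(k-1)}}(q^3;q^3)_{r^{(k-1)}}(q)_{|r^{(k-1)}|+1}(q)_{|r^{(k-1)}|}} =\frac{(q^i,q^i,q^{2i},q^{3k-2i},q^{3k-i},q^{3k-i},q^{3k},q^{3k};q^{3k})_\infty}{(q)_\infty^3}, \] where for $i=1$ the factor $(1-q^{|r^{(0)}|+1})$ is interpreted as $1$.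
   Context: $(x;p)_n=\prod_{j=0}^{n-1}(1-xp^j)$ for $n\ge0$, $(x;p)_\infty=\prod_{j\ge0}(1-xp^j)$, $(x_1,\dots,x_m;p)_\infty=\prod_l(x_l;p)_\infty$; $(q)_n=(q;q)_n$, with the convention $1/(q;q)_n=0$ and $1/(q^3;q^3)_n=0$ for $n<0$. For $v=(v_1,v_2)\in\mathbb Z^2$: $|v|=v_1+v_2$, $(q)_v=(q)_{v_1}(q)_{v_2}$, $(q^3;q^3)_v=(q^3;q^3)_{v_1}(q^3;q^3)_{v_2}$, and $vCv=\sum_{i,j=1}^2v_iC_{ij}v_j$ with $C=\begin{pmatrix}2&-1\\-1&2\end{pmatrix}$, so $\frac12vCv=v_1^2-v_1v_2+v_2^2$. Differences $r^{(j)}-r^{(j+1)}$ are componentwise. When $k=2$ the chain $(q)_{r^{(1)}-r^{(2)}}\cdots(q)_{r^{(k-2)}-r^{(k-1)}}$ is empty. *)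

theory Defs
  imports "HOL-Analysis.Analysis"
begin

definition qpoch :: "complex \<Rightarrow> complex \<Rightarrow> nat \<Rightarrow> complex" where
  "qpoch x p n = (\<Prod>j<n. 1 - x * p ^ j)"

definition inv_qpoch :: "complex \<Rightarrow> complex \<Rightarrow> int \<Rightarrow> complex" where
  "inv_qpoch x p n = (if n < 0 then 0 else 1 / qpoch x p (nat n))"

definition qpoch_inf :: "complex \<Rightarrow> complex \<Rightarrow> complex" where
  "qpoch_inf x p = (\<Prod>j. 1 - x * p ^ j)"

definition vabs :: "int \<times> int \<Rightarrow> int" where
  "vabs v = fst v + snd v"

definition halfCform :: "int \<times> int \<Rightarrow> int" where
  "halfCform v = fst v ^ 2 - fst v * snd v + snd v ^ 2"

definition inv_qpoch2 :: "complex \<Rightarrow> complex \<Rightarrow> int \<times> int \<Rightarrow> complex" where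
  "inv_qpoch2 x p v = inv_qpoch x p (fst v) * inv_qpoch x p (snd v)"

text \<open>The summand, for r = (r^(1),...,r^(k-1)) given as a function on {1..k-1}.
  The numerator factor (q^3;q^3)_{|r^(k-1)|} is only relevant when |r^(k-1)| >= 0
  (otherwise 1/(q^3;q^3)_{r^(k-1)} vanishes), so nat truncation is harmless.\<close>
definition summand :: "complex \<Rightarrow> nat \<Rightarrow> nat \<Rightarrow> (nat \<Rightarrow> int \<times> int) \<Rightarrow> complex" where
  "summand q k i r =
     q powi ((\<Sum>j=1..k-1. halfCform (r j)) + (\<Sum>j=i..k-1. vabs (r j)))
     * (if i = 1 then 1 else 1 - q powi (vabs (r (i-1)) + 1))
     * qpoch (q^3) (q^3) (nat (vabs (r (k-1))))
     * (\<Prod>j=1..k-2. inv_qpoch2 q q (r j - r (j+1)))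
     * inv_qpoch2 (q^3) (q^3) (r (k-1))
     * inv_qpoch q q (vabs (r (k-1)) + 1)
     * inv_qpoch q q (vabs (r (k-1)))"

end

theory Submission
  imports Defs "HOL-Computational_Algebra.Polynomial"
begin

text \<open>
  Write \<open>Q(a, b) = a\<^sup>2 + a b + b\<^sup>2\<close> for half the squared length of the vector
  \<open>(a, b, - a - b)\<close> of the A2 root lattice. The products \<open>kernel L M a b\<close> of q-factorials are
  eigenfunctions, with eigenvalue \<open>q\<close> to the power \<open>Q(a, b)\<close>, of one step \<open>r \<mapsto> L\<close> of the
  multisum: expand the kernel by q-Vandermonde, after which the two sums over \<open>r\<close> separate.
  Multiplying the kernel at \<open>L + (1, 1)\<close> by the Weyl alternant gives eigenfunctions for the steps with a
  linear exponent, and the factor \<open>1 - q^(|r| + 1)\<close> turns them into alternating sums of kernels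
  at shifted lattice points. The innermost factor of the summand expands into these eigenfunctions with
  coefficients involving a cube root of unity \<open>\<omega>\<close>, as one sees by comparing coefficients in a 3x3 determinant
  of products \<open>(\<omega>^i q^m z; q)\<^sub>N\<close>. Summing all levels leaves a theta series over the root lattice, which
  the Jacobi triple product and the pentagonal number theorem evaluate.
\<close>

section \<open>The A2 Bailey lemma\<close>

text \<open>The modulus \<open>3 * k\<close> comes from counting eigenvalues. The expansion of the
  innermost factor carries \<open>q\<close> to the power \<open>Q(a, b)\<close>, and each of the
  \<open>k - 1\<close> levels adds another \<open>Q(a, b)\<close> up to lower terms; so the final
  theta series has nome \<open>q^k\<close>. A kernel at the lattice point shifted by a root has
  eigenvalue exponent \<open>Q(a, b) + 1\<close> plus the inner product with that root. Each of the
  \<open>i - 1\<close> levels from the factor \<open>1 - q^(|r| + 1)\<close> outwards therefore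
  raises the argument of the alternant by one power of \<open>q\<close>, from \<open>q\<close> to
  \<open>q^i\<close>. Hence a Macdonald identity at nome \<open>q^k\<close> and argument
  \<open>q^i\<close> is what remains. The outermost sum has no denominator
  \<open>(q)_(L - r)\<close>. It is supplied with \<open>L = (N, N)\<close>, which makes all level
  sums finite, and is removed by \<open>N \<rightarrow> \<infinity>\<close>. Both this limit and the
  limit of the lattice series need majorants independent of \<open>N\<close>; they come from
  quadratic exponents and from the boundedness of \<open>(q)_n\<close> and its reciprocal. The value
  \<open>q = 0\<close> is treated separately, because the argument divides by powers of
  \<open>q\<close>.\<close>

locale nome =
  fixes q :: complex
  assumes q_nonzero: "q \<noteq> 0" and norm_q: "norm q < 1"
begin

section \<open>q-factorials and their reciprocals at integer arguments\<close>

abbreviation h :: "int \<Rightarrow> complex" where "h n \<equiv> inv_qpoch q q n"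
text \<open>Truncation gives the value 1 at negative arguments. In the identities below a factor
  \<open>h\<close> vanishes whenever the argument of \<open>qfac\<close> is negative.\<close>

abbreviation qfac :: "int \<Rightarrow> complex" where "qfac n \<equiv> qpoch q q (nat n)"

lemma one_minus_power_nonzero: "n \<ge> 1 \<Longrightarrow> 1 - q ^ n \<noteq> 0"
proof
  assume "n \<ge> 1" "1 - q ^ n = 0"
  then have "norm q ^ n = 1" by (metis eq_iff_diff_eq_0 norm_one norm_power)
  moreover have "norm q ^ n < 1"
    using norm_q \<open>n \<ge> 1\<close> by (simp add: power_less_one_iff)
  ultimately show False by simp
qed

lemma one_minus_powi_nonzero: "n \<ge> 1 \<Longrightarrow> 1 - q powi n \<noteq> 0"
  using one_minus_power_nonzero[of "nat n"] by (simp add: power_int_def)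

lemma qpoch_Suc: "qpoch q q (Suc n) = (1 - q ^ Suc n) * qpoch q q n"
  by (simp add: qpoch_def)

lemma qpoch_nonzero: "qpoch q q n \<noteq> 0"
  using one_minus_power_nonzero by (auto simp: qpoch_def simp flip: power_Suc)

lemma h_neg [simp]: "n < 0 \<Longrightarrow> h n = 0"
  by (simp add: inv_qpoch_def)

lemma h_0 [simp]: "h 0 = 1"
  by (simp add: inv_qpoch_def qpoch_def)

lemma qfac_h: "n \<ge> 0 \<Longrightarrow> qfac n * h n = 1"
  by (simp add: inv_qpoch_def qpoch_nonzero)

lemma qfac_pred: "n \<ge> 1 \<Longrightarrow> qfac n = (1 - q powi n) * qfac (n - 1)"
  using qpoch_Suc[of "nat (n - 1)"]
  by (simp add: nat_diff_distrib power_int_def flip: Suc_nat_eq_nat_zadd1 Suc_diff_le)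

text \<open>Valid for every integer: at \<open>n = 0\<close> the factor \<open>1 - q powi n\<close>
  is zero, which agrees with the convention for \<open>h (- 1)\<close>. Recurrences may thus lower
  arguments without sign conditions.\<close>

lemma h_pred: "h (n - 1) = (1 - q powi n) * h n"
proof (cases "n \<ge> 1")
  case True
  have "qfac n * h (n - 1) = (1 - q powi n) * (qfac (n - 1) * h (n - 1))"
    using qfac_pred[OF True] by simp
  also have "\<dots> = (1 - q powi n) * (qfac n * h n)"
    using True by (simp add: qfac_h)
  finally show ?thesis using qpoch_nonzero[of "nat n"] by (simp add: mult_ac)
qed (cases "n = 0"; simp)

lemma powi_add: "q powi (m + n) = q powi m * q powi n"
  using q_nonzero by (simp add: power_int_add)


section \<open>q-Vandermonde sums\<close>

text \<open>Induction on \<open>a + d\<close>. The recurrence \<open>R_rec\<close> comes from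
  \<open>1 - q^(a + d) = (1 - q^(a - s)) + q^(a - s) * (1 - q^(d + s))\<close>, whose two parts
  lower \<open>h (a - s)\<close> and \<open>h (d + s)\<close>. Any finite superset of
  \<open>{0..a}\<close> serves as index set, so that it can stay fixed while \<open>a\<close>
  decreases.\<close>

lemma q_vandermonde:
  assumes "finite I" "{0..a} \<subseteq> I"
  shows "(\<Sum>s\<in>I. q powi (s * (d + s)) * h s * h (d + s) * h (a - s) * h (b - s))
       = qfac (a + b + d) * h a * h b * h (a + d) * h (b + d)"
proof -
  define R where
    "R a d = (\<Sum>s\<in>I. q powi (s * (d + s)) * h s * h (d + s) * h (a - s) * h (b - s))" for a d
  have R_neg: "R a d = 0" if "a + d < 0" for a d
    unfolding R_def
  proof (intro sum.neutral ballI)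
    fix s
    have "d + s < 0 \<or> a - s < 0" using that by linarith
    then show "q powi (s * (d + s)) * h s * h (d + s) * h (a - s) * h (b - s) = 0" by auto
  qed
  \<comment> \<open>The supports of \<open>h (d + s)\<close> and \<open>h (a - s)\<close> now meet
    only in \<open>s = a\<close>.\<close>
  have R_0: "R a d = qfac b * h a * h b * h (b - a)" if I: "{0..a} \<subseteq> I" and ad: "a + d = 0" for a d
  proof (cases "a \<ge> 0")
    case True
    have "R a d = (\<Sum>s\<in>{a}. q powi (s * (d + s)) * h s * h (d + s) * h (a - s) * h (b - s))"
      unfolding R_def
    proof (rule sum.mono_neutral_right)
      show "\<forall>s\<in>I - {a}. q powi (s * (d + s)) * h s * h (d + s) * h (a - s) * h (b - s) = 0"
      proof
        fix s assume "s \<in> I - {a}"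
        then have "d + s < 0 \<or> a - s < 0" using ad by auto
        then show "q powi (s * (d + s)) * h s * h (d + s) * h (a - s) * h (b - s) = 0" by auto
      qed
    qed (use True I \<open>finite I\<close> in auto)
    also have "\<dots> = h a * h (b - a)" using ad by (simp add: add.commute)
    also have "\<dots> = (qfac b * h b) * (h a * h (b - a))"
      using qfac_h[of b] True by (cases "b \<ge> 0") auto
    finally show ?thesis by (simp only: mult_ac)
  next
    case False
    then have "h s * h (a - s) = 0" for s by (cases "s < 0") auto
    then have "R a d = 0" unfolding R_def by (intro sum.neutral) auto
    with False show ?thesis by simp
  qed
  have R_rec: "(1 - q powi (a + d)) * R a d = R (a - 1) d + q powi a * R a (d - 1)" for a d
  proof -
    have "(1 - q powi (a + d)) * (q powi (s * (d + s)) * h s * h (d + s) * h (a - s) * h (b - s))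
      = q powi (s * (d + s)) * h s * h (d + s) * h (a - 1 - s) * h (b - s)
        + q powi a * (q powi (s * (d - 1 + s)) * h s * h (d - 1 + s) * h (a - s) * h (b - s))" for s
    proof -
      have 1: "h (a - 1 - s) = (1 - q powi (a - s)) * h (a - s)"
        using h_pred[of "a - s"] by (simp add: algebra_simps)
      have 2: "h (d - 1 + s) = (1 - q powi (d + s)) * h (d + s)"
        using h_pred[of "d + s"] by (simp add: algebra_simps)
      have "q powi (s * (d + s)) * q powi (a - s) = q powi (s * (d + s) + (a - s))"
        by (simp only: powi_add)
      also have "s * (d + s) + (a - s) = a + s * (d - 1 + s)" by (simp add: algebra_simps)
      finally have 3: "q powi a * q powi (s * (d - 1 + s)) = q powi (s * (d + s)) * q powi (a - s)"
        by (simp only: powi_add)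
      have "q powi (a - s) * q powi (d + s) = q powi (a - s + (d + s))" by (simp only: powi_add)
      then have 4: "q powi (a + d) = q powi (a - s) * q powi (d + s)" by (simp add: algebra_simps)
      have "q powi a * (q powi (s * (d - 1 + s)) * h s * h (d - 1 + s) * h (a - s) * h (b - s))
        = (q powi a * q powi (s * (d - 1 + s))) * h s * h (d - 1 + s) * h (a - s) * h (b - s)"
        by (simp only: mult_ac)
      then show ?thesis unfolding 1 2 3 4 by (simp add: algebra_simps)
    qed
    then show ?thesis
      unfolding R_def by (simp add: sum_distrib_left flip: sum.distrib)
  qed
  have "R a d = qfac (a + b + d) * h a * h b * h (a + d) * h (b + d)"
    if "a + d = int m" "{0..a} \<subseteq> I" for m a d
    using that
  proof (induction m arbitrary: a d)
    case 0
    then have "d = - a" by simp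
    with 0 R_0[of a d] show ?case by simp
  next
    case (Suc m)
    have nz: "1 - q powi (a + d) \<noteq> 0"
      using Suc.prems by (intro one_minus_powi_nonzero) simp
    have sub: "{0..a - 1} \<subseteq> I" using Suc.prems(2) by auto
    have IH1: "R (a - 1) d = qfac (a + b + d - 1) * h (a - 1) * h b * h (a + d - 1) * h (b + d)"
      using Suc.IH[of "a - 1" d, OF _ sub] Suc.prems(1) by (simp add: algebra_simps)
    have IH2: "R a (d - 1) = qfac (a + b + d - 1) * h a * h b * h (a + d - 1) * h (b + d - 1)"
      using Suc.IH[of a "d - 1"] Suc.prems by (simp add: algebra_simps)
    \<comment> \<open>For \<open>b < 0\<close> both sides vanish with \<open>h b\<close>; otherwise
      \<open>a + b + d\<close> is at least 1.\<close>
    have *: "qfac (a + b + d) * h b = (1 - q powi (a + b + d)) * (qfac (a + b + d - 1) * h b)"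
      using qfac_pred[of "a + b + d"] Suc.prems by (cases "b < 0") auto
    have pw: "q powi (a + d) = q powi a * q powi d" "q powi (b + d) = q powi b * q powi d"
      "q powi (a + b + d) = q powi a * q powi b * q powi d" by (simp_all only: powi_add)
    have "(1 - q powi (a + d)) * R a d
        = qfac (a + b + d - 1) * h b * ((1 - q powi a) + q powi a * (1 - q powi (b + d)))
          * ((1 - q powi (a + d)) * h a * h (a + d) * h (b + d))"
      unfolding R_rec IH1 IH2 h_pred by (simp add: algebra_simps)
    also have "(1 - q powi a) + q powi a * (1 - q powi (b + d)) = 1 - q powi (a + b + d)"
      unfolding pw by (simp add: algebra_simps)
    also have "qfac (a + b + d - 1) * h b * (1 - q powi (a + b + d)) = qfac (a + b + d) * h b"
      using * by (simp only: mult_ac)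
    finally show ?case using nz by (simp add: mult_ac)
  qed
  then have "R a d = qfac (a + b + d) * h a * h b * h (a + d) * h (b + d)"
    using R_neg[of a d] assms(2) zero_le_imp_eq_int[of "a + d"]
    by (cases "a + d < 0") (auto simp: not_less)
  then show ?thesis unfolding R_def .
qed

text \<open>The reflection \<open>s \<mapsto> a - s\<close> gives a second expansion of the same
  product with another power of \<open>q\<close>. One form expands the kernel, the other resums it
  after a step.\<close>

lemma q_vandermonde':
  assumes "finite I" "{0..a} \<subseteq> I"
  shows "(\<Sum>s\<in>I. q powi ((a - s) * (b - s)) * h s * h (d + s) * h (a - s) * h (b - s))
       = qfac (a + b + d) * h a * h b * h (a + d) * h (b + d)"
proof -
  let ?t = "\<lambda>s. q powi ((a - s) * (b - s)) * h s * h (d + s) * h (a - s) * h (b - s)"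
  have "sum ?t I = sum ?t {0..a}"
    by (rule sum.mono_neutral_right) (use assms in \<open>force+\<close>)
  also have "\<dots> = (\<Sum>s\<in>{0..a}. q powi (s * (b - a + s)) * h s * h (b - a + s) * h (a - s) * h (a + d - s))"
    by (rule sum.reindex_bij_witness[of _ "\<lambda>s. a - s" "\<lambda>s. a - s"]) (auto simp: algebra_simps)
  also have "\<dots> = qfac (a + (a + d) + (b - a)) * h a * h (a + d) * h (a + (b - a)) * h (a + d + (b - a))"
    by (rule q_vandermonde) auto
  finally show ?thesis by (simp add: algebra_simps)
qed

text \<open>The case \<open>b \<rightarrow> \<infinity>\<close> of q-Vandermonde with
  \<open>s = r - \<alpha>\<close>. It is proved directly by induction on \<open>L - \<beta>\<close>,
  splitting \<open>1 - q^(L - \<beta>) = (1 - q^(L - r)) + q^(L - r) * (1 - q^(r -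
  \<beta>))\<close>.\<close>

lemma q_vandermonde_limit:
  assumes "finite I" "{max \<alpha> \<beta>..L} \<subseteq> I"
  shows "(\<Sum>r\<in>I. q powi ((r - \<alpha>) * (r - \<beta>)) * h (L - r) * h (r - \<alpha>) * h (r - \<beta>)) = h (L - \<alpha>) * h (L - \<beta>)"
proof -
  define S where
    "S L \<beta> = (\<Sum>r\<in>I. q powi ((r - \<alpha>) * (r - \<beta>)) * h (L - r) * h (r - \<alpha>) * h (r - \<beta>))" for L \<beta>
  have S_neg: "S L \<beta> = 0" if "L - \<beta> < 0" for L \<beta>
    unfolding S_def
  proof (intro sum.neutral ballI)
    fix r
    have "L - r < 0 \<or> r - \<beta> < 0" using that by linarith
    then show "q powi ((r - \<alpha>) * (r - \<beta>)) * h (L - r) * h (r - \<alpha>) * h (r - \<beta>) = 0" by auto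
  qed
  have S_0: "S L L = h (L - \<alpha>)" if I: "{max \<alpha> L..L} \<subseteq> I" for L
  proof (cases "\<alpha> \<le> L")
    case True
    have "S L L = (\<Sum>r\<in>{L}. q powi ((r - \<alpha>) * (r - L)) * h (L - r) * h (r - \<alpha>) * h (r - L))"
      unfolding S_def
    proof (rule sum.mono_neutral_right)
      show "\<forall>r\<in>I - {L}. q powi ((r - \<alpha>) * (r - L)) * h (L - r) * h (r - \<alpha>) * h (r - L) = 0"
      proof
        fix r assume "r \<in> I - {L}"
        then have "L - r < 0 \<or> r - L < 0" by auto
        then show "q powi ((r - \<alpha>) * (r - L)) * h (L - r) * h (r - \<alpha>) * h (r - L) = 0" by auto
      qed
    qed (use True I \<open>finite I\<close> in auto)
    then show ?thesis by simp
  next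
    case False
    then have "r - \<alpha> < 0 \<or> L - r < 0" for r by linarith
    then have "S L L = 0" unfolding S_def by (intro sum.neutral) (metis (no_types) h_neg mult_zero_left mult_zero_right)
    with False show ?thesis by simp
  qed
  have S_rec: "(1 - q powi (L - \<beta>)) * S L \<beta> = S (L - 1) \<beta> + q powi (L - \<alpha>) * S L (\<beta> + 1)" for L \<beta>
  proof -
    have "(1 - q powi (L - \<beta>)) * (q powi ((r - \<alpha>) * (r - \<beta>)) * h (L - r) * h (r - \<alpha>) * h (r - \<beta>))
      = q powi ((r - \<alpha>) * (r - \<beta>)) * h (L - 1 - r) * h (r - \<alpha>) * h (r - \<beta>)
        + q powi (L - \<alpha>) * (q powi ((r - \<alpha>) * (r - (\<beta> + 1))) * h (L - r) * h (r - \<alpha>) * h (r - (\<beta> + 1)))" for r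
    proof -
      have 1: "h (L - 1 - r) = (1 - q powi (L - r)) * h (L - r)"
        using h_pred[of "L - r"] by (simp add: algebra_simps)
      have 2: "h (r - (\<beta> + 1)) = (1 - q powi (r - \<beta>)) * h (r - \<beta>)"
        using h_pred[of "r - \<beta>"] by (simp add: algebra_simps)
      have "q powi ((r - \<alpha>) * (r - \<beta>)) * q powi (L - r) = q powi ((r - \<alpha>) * (r - \<beta>) + (L - r))"
        by (simp only: powi_add)
      also have "(r - \<alpha>) * (r - \<beta>) + (L - r) = (L - \<alpha>) + (r - \<alpha>) * (r - (\<beta> + 1))" by (simp add: algebra_simps)
      finally have 3: "q powi (L - \<alpha>) * q powi ((r - \<alpha>) * (r - (\<beta> + 1))) = q powi ((r - \<alpha>) * (r - \<beta>)) * q powi (L - r)"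
        by (simp only: powi_add)
      have "q powi (L - r) * q powi (r - \<beta>) = q powi (L - r + (r - \<beta>))" by (simp only: powi_add)
      then have 4: "q powi (L - \<beta>) = q powi (L - r) * q powi (r - \<beta>)" by (simp add: algebra_simps)
      have "q powi (L - \<alpha>) * (q powi ((r - \<alpha>) * (r - (\<beta> + 1))) * h (L - r) * h (r - \<alpha>) * h (r - (\<beta> + 1)))
        = (q powi (L - \<alpha>) * q powi ((r - \<alpha>) * (r - (\<beta> + 1)))) * h (L - r) * h (r - \<alpha>) * h (r - (\<beta> + 1))"
        by (simp only: mult_ac)
      then show ?thesis unfolding 1 2 3 4 by (simp add: algebra_simps)
    qed
    then show ?thesis
      unfolding S_def by (simp add: sum_distrib_left flip: sum.distrib)
  qed
  have "S L \<beta> = h (L - \<alpha>) * h (L - \<beta>)" if "L - \<beta> = int m" "{max \<alpha> \<beta>..L} \<subseteq> I" for m L \<beta>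
    using that
  proof (induction m arbitrary: L \<beta>)
    case 0
    then have "\<beta> = L" by simp
    with 0 S_0[of L] show ?case by simp
  next
    case (Suc m)
    have nz: "1 - q powi (L - \<beta>) \<noteq> 0"
      using Suc.prems by (intro one_minus_powi_nonzero) simp
    have IH1: "S (L - 1) \<beta> = h (L - \<alpha> - 1) * h (L - \<beta> - 1)"
      using Suc.IH[of "L - 1" \<beta>] Suc.prems by (simp add: algebra_simps subset_iff)
    have "{max \<alpha> (\<beta> + 1)..L} \<subseteq> I" using Suc.prems(2) by (auto simp: subset_iff)
    then have IH2: "S L (\<beta> + 1) = h (L - \<alpha>) * h (L - \<beta> - 1)"
      using Suc.IH[of L "\<beta> + 1"] Suc.prems by (simp add: algebra_simps)
    have "(1 - q powi (L - \<beta>)) * S L \<beta> = (1 - q powi (L - \<beta>)) * (h (L - \<alpha>) * h (L - \<beta>))"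
      unfolding S_rec IH1 IH2 h_pred by (simp add: algebra_simps)
    then show ?case using nz by simp
  qed
  then have "S L \<beta> = h (L - \<alpha>) * h (L - \<beta>)"
    using S_neg[of L \<beta>] assms(2) zero_le_imp_eq_int[of "L - \<beta>"]
    by (cases "L - \<beta> < 0") (auto simp: not_less)
  then show ?thesis unfolding S_def .
qed


section \<open>The A2 Bailey kernel and its eigenvalue\<close>

text \<open>The A2 counterpart of \<open>1 / ((q)_(L - a) (q)_(L + a))\<close> in the classical
  Bailey lemma. It is symmetric in the three coordinates \<open>a\<close>, \<open>b\<close> and
  \<open>c = - a - b\<close>.\<close>

definition kernel :: "int \<Rightarrow> int \<Rightarrow> int \<Rightarrow> int \<Rightarrow> complex" where
  "kernel L M a b = qfac (L + M) * (h (L - a) * h (L - b) * h (L + a + b))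
     * (h (M + a) * h (M + b) * h (M - a - b))"

lemma kernel_expand:
  assumes "finite S" "{0..L - a} \<subseteq> S"
  shows "kernel L M a b = (\<Sum>s\<in>S. q powi ((L - a - s) * (M + b - s)) * h s * h (a - b + s)
           * h (L - a - s) * h (M + b - s) * (h (L + a + b) * h (M - a - b)))"
proof -
  have "kernel L M a b = qfac ((L - a) + (M + b) + (a - b)) * h (L - a) * h (M + b) * h ((L - a) + (a - b))
          * h ((M + b) + (a - b)) * (h (L + a + b) * h (M - a - b))"
    by (simp add: kernel_def mult_ac add_ac)
  also have "\<dots> = (\<Sum>s\<in>S. q powi ((L - a - s) * (M + b - s)) * h s * h (a - b + s)
           * h (L - a - s) * h (M + b - s)) * (h (L + a + b) * h (M - a - b))"
    using q_vandermonde'[of S "L - a" "M + b" "a - b"] assms by simp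
  finally show ?thesis by (simp only: sum_distrib_right)
qed

text \<open>The weight couples \<open>r\<close> and \<open>t\<close> only through
  \<open>- r * t\<close>, and the exponent \<open>(r - a - s) * (t + b - s)\<close> of the expanded
  kernel contains \<open>r * t\<close>. After this cancellation each variable is summed by
  \<open>q_vandermonde_limit\<close>; the remaining sum over \<open>s\<close> is q-Vandermonde in
  its first form.\<close>

theorem kernel_step:
  "(\<Sum>r\<in>{0..L}. \<Sum>t\<in>{0..M}. q powi (r^2 - r * t + t^2) * h (L - r) * h (M - t) * kernel r t a b)
     = q powi (a^2 + a * b + b^2) * kernel L M a b"
proof -
  let ?S = "{0..L - a}"
  define u where "u s = q powi (a^2 + a * b + b^2) * q powi (s * (a - b + s)) * h s * h (a - b + s)" for s
  define v where "v s r = q powi ((r - (a + s)) * (r - (- a - b))) * h (L - r) * h (r - (a + s)) * h (r - (- a - b))" for s r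
  define w where "w s t = q powi ((t - (s - b)) * (t - (a + b))) * h (M - t) * h (t - (s - b)) * h (t - (a + b))" for s t
  have "q powi (r^2 - r * t + t^2) * h (L - r) * h (M - t) * kernel r t a b = (\<Sum>s\<in>?S. u s * (v s r * w s t))"
    if "r \<in> {0..L}" for r t
  proof -
    have *: "q powi (r^2 - r * t + t^2) * q powi ((r - a - s) * (t + b - s))
      = q powi (a^2 + a * b + b^2) * q powi (s * (a - b + s)) * q powi ((r - (a + s)) * (r - (- a - b)))
        * q powi ((t - (s - b)) * (t - (a + b)))" for s
      unfolding powi_add[symmetric] by (rule arg_cong[of _ _ "\<lambda>n. q powi n"]) (simp add: algebra_simps power2_eq_square)
    have "q powi (r^2 - r * t + t^2) * h (L - r) * h (M - t) * (q powi ((r - a - s) * (t + b - s)) * h s * h (a - b + s)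
           * h (r - a - s) * h (t + b - s) * (h (r + a + b) * h (t - a - b))) = u s * (v s r * w s t)" for s
    proof -
      have e: "r - (a + s) = r - a - s" "r - (- a - b) = r + a + b" "t - (s - b) = t + b - s" "t - (a + b) = t - a - b"
        by simp_all
      have "q powi (r^2 - r * t + t^2) * h (L - r) * h (M - t) * (q powi ((r - a - s) * (t + b - s)) * h s * h (a - b + s)
           * h (r - a - s) * h (t + b - s) * (h (r + a + b) * h (t - a - b)))
        = (q powi (r^2 - r * t + t^2) * q powi ((r - a - s) * (t + b - s))) * h (L - r) * h (M - t) * (h s * h (a - b + s)
           * h (r - a - s) * h (t + b - s) * (h (r + a + b) * h (t - a - b)))"
        by (simp only: mult_ac)
      also have "\<dots> = u s * (v s r * w s t)"
        unfolding * u_def v_def w_def e by (simp only: mult_ac)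
      finally show ?thesis .
    qed
    moreover have "{0..r - a} \<subseteq> ?S" using that by auto
    ultimately show ?thesis
      by (subst kernel_expand[of ?S]) (simp_all only: finite_atLeastAtMost_int sum_distrib_left)
  qed
  then have "(\<Sum>r\<in>{0..L}. \<Sum>t\<in>{0..M}. q powi (r^2 - r * t + t^2) * h (L - r) * h (M - t) * kernel r t a b)
    = (\<Sum>r\<in>{0..L}. \<Sum>t\<in>{0..M}. \<Sum>s\<in>?S. u s * (v s r * w s t))" by simp
  also have "\<dots> = (\<Sum>r\<in>{0..L}. \<Sum>s\<in>?S. \<Sum>t\<in>{0..M}. u s * (v s r * w s t))"
    by (rule sum.cong[OF refl], rule sum.swap)
  also have "\<dots> = (\<Sum>s\<in>?S. \<Sum>r\<in>{0..L}. \<Sum>t\<in>{0..M}. u s * (v s r * w s t))"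
    by (rule sum.swap)
  also have "\<dots> = (\<Sum>s\<in>?S. u s * ((\<Sum>r\<in>{0..L}. v s r) * (\<Sum>t\<in>{0..M}. w s t)))"
    by (simp only: sum_product) (simp only: sum_distrib_left)
  also have "\<dots> = (\<Sum>s\<in>?S. u s * ((h (L - a - s) * h (L + a + b)) * (h (M + b - s) * h (M - a - b))))"
  proof (rule sum.cong[OF refl])
    fix s assume s: "s \<in> ?S"
    show "u s * ((\<Sum>r\<in>{0..L}. v s r) * (\<Sum>t\<in>{0..M}. w s t))
      = u s * ((h (L - a - s) * h (L + a + b)) * (h (M + b - s) * h (M - a - b)))"
    \<comment> \<open>If \<open>a - b + s < 0\<close> then \<open>u s = 0\<close>. Otherwise
      \<open>a + s\<close> and \<open>- a - b\<close> are not both negative, and neither are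
      \<open>s - b\<close> and \<open>a + b\<close>, so ranges starting at 0 contain the full
      supports.\<close>
    proof (cases "a - b + s < 0")
      case True
      then show ?thesis by (simp add: u_def)
    next
      case False
      have "(\<Sum>r\<in>{0..L}. v s r) = h (L - (a + s)) * h (L - (- a - b))"
        unfolding v_def by (rule q_vandermonde_limit) (use s False in auto)
      moreover have "(\<Sum>t\<in>{0..M}. w s t) = h (M - (s - b)) * h (M - (a + b))"
        unfolding w_def by (rule q_vandermonde_limit) (use s False in auto)
      ultimately show ?thesis by (simp add: algebra_simps)
    qed
  qed
  also have "\<dots> = q powi (a^2 + a * b + b^2) * ((\<Sum>s\<in>?S. q powi (s * (a - b + s)) * h s * h (a - b + s) * h (L - a - s) * h (M + b - s))
       * (h (L + a + b) * h (M - a - b)))"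
    unfolding sum_distrib_left sum_distrib_right
    by (rule sum.cong[OF refl]) (simp only: u_def mult_ac)
  also have "(\<Sum>s\<in>?S. q powi (s * (a - b + s)) * h s * h (a - b + s) * h (L - a - s) * h (M + b - s))
     = qfac ((L - a) + (M + b) + (a - b)) * h (L - a) * h (M + b) * h ((L - a) + (a - b)) * h ((M + b) + (a - b))"
    by (rule q_vandermonde) auto
  finally show ?thesis by (simp add: kernel_def mult_ac add_ac)
qed

end

section \<open>Alternating kernels\<close>

text \<open>The Weyl alternant of type A2, evaluated along the direction \<open>\<rho>\<close>: the sum over
  the permutations \<open>\<rho>\<close> of \<open>(-1, 0, 1)\<close> of the signed powers of \<open>x\<close> with exponent
  the inner product of \<open>\<rho>\<close> and \<open>(a, b, - a - b)\<close>.\<close>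
definition alt :: "complex \<Rightarrow> int \<Rightarrow> int \<Rightarrow> complex" where
  "alt x a b = x powi (- 2 * a - b) + x powi (a + 2 * b) + x powi (a - b)
     - x powi (- a - 2 * b) - x powi (b - a) - x powi (2 * a + b)"

lemma alt_0_0 [simp]: "alt x 0 0 = 0"
  by (simp add: alt_def)

text \<open>Multiplicativity of the 3x3 determinant: column \<open>j\<close> on the left is the
  coefficient matrix applied to \<open>(y_j, v_j, x_j)\<close>. Stated over a commutative ring
  because it is used for numbers and for polynomials.\<close>

lemma det_linear_forms:
  fixes x1 x2 x3 v1 v2 v3 y1 y2 y3 :: "'a :: comm_ring_1"
  shows "(m11 * y1 + m12 * v1 + m13 * x1) * (m21 * y2 + m22 * v2 + m23 * x2) * (m31 * y3 + m32 * v3 + m33 * x3)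
       + (m21 * y1 + m22 * v1 + m23 * x1) * (m31 * y2 + m32 * v2 + m33 * x2) * (m11 * y3 + m12 * v3 + m13 * x3)
       + (m31 * y1 + m32 * v1 + m33 * x1) * (m11 * y2 + m12 * v2 + m13 * x2) * (m21 * y3 + m22 * v3 + m23 * x3)
       - (m21 * y1 + m22 * v1 + m23 * x1) * (m11 * y2 + m12 * v2 + m13 * x2) * (m31 * y3 + m32 * v3 + m33 * x3)
       - (m11 * y1 + m12 * v1 + m13 * x1) * (m31 * y2 + m32 * v2 + m33 * x2) * (m21 * y3 + m22 * v3 + m23 * x3)
       - (m31 * y1 + m32 * v1 + m33 * x1) * (m21 * y2 + m22 * v2 + m23 * x2) * (m11 * y3 + m12 * v3 + m13 * x3)
     = (m11 * (m22 * m33 - m23 * m32) - m12 * (m21 * m33 - m23 * m31) + m13 * (m21 * m32 - m22 * m31))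
       * (y1 * v2 * x3 + v1 * x2 * y3 + x1 * y2 * v3 - v1 * y2 * x3 - y1 * x2 * v3 - x1 * v2 * y3)"
  by (simp add: algebra_simps)

lemma det_scale_rows:
  fixes H1 H2 H3 :: "'a :: comm_ring_1"
  shows "Q * ((l1 * H1) * (m2 * H2) * (u3 * H3) + (m1 * H1) * (u2 * H2) * (l3 * H3)
       + (u1 * H1) * (l2 * H2) * (m3 * H3) - (m1 * H1) * (l2 * H2) * (u3 * H3)
       - (l1 * H1) * (u2 * H2) * (m3 * H3) - (u1 * H1) * (m2 * H2) * (l3 * H3))
    = Q * (H1 * H2 * H3) * (l1 * m2 * u3 + m1 * u2 * l3 + u1 * l2 * m3 - m1 * l2 * u3 - l1 * u2 * m3 - u1 * m2 * l3)"
  by (simp add: algebra_simps)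

context nome
begin

definition alt_kernel :: "int \<Rightarrow> int \<Rightarrow> int \<Rightarrow> int \<Rightarrow> complex" where
  "alt_kernel L M a b = alt q a b * kernel (L + 1) (M + 1) a b"

text \<open>With one index of the kernel equal to 0 its support is the origin, and there the
  alternant is zero.\<close>

lemma alt_kernel_boundary: "alt_kernel (- 1) M a b = 0" "alt_kernel L (- 1) a b = 0"
proof -
  have "h (- a) * h (- b) * h (a + b) = 0 \<and> h a * h b * h (- a - b) = 0 \<or> a = 0 \<and> b = 0"
    by (cases "a < 0 \<or> b < 0 \<or> a + b < 0"; cases "a > 0 \<or> b > 0 \<or> a + b > 0") auto
  then show "alt_kernel (- 1) M a b = 0" "alt_kernel L (- 1) a b = 0"
    by (auto simp: alt_kernel_def kernel_def)
qed

text \<open>Replacing \<open>(r, t)\<close> by \<open>(r + 1, t + 1)\<close> adds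
  \<open>r + t + 1\<close> to \<open>r^2 - r * t + t^2\<close>. So this is
  \<open>kernel_step\<close> at \<open>(L + 1, M + 1)\<close>: the summand 1 accounts for the
  \<open>- 1\<close> in the eigenvalue, and the extra terms with \<open>r = - 1\<close> or
  \<open>t = - 1\<close> vanish by the boundary lemma.\<close>

lemma alt_kernel_step:
  assumes "L \<ge> - 1" "M \<ge> - 1"
  shows "(\<Sum>r\<in>{0..L}. \<Sum>t\<in>{0..M}. q powi (r^2 - r * t + t^2 + (r + t)) * h (L - r) * h (M - t) * alt_kernel r t a b)
     = q powi (a^2 + a * b + b^2 - 1) * alt_kernel L M a b"
proof -
  define F where "F r t = q powi (r^2 - r * t + t^2 + (r + t)) * h (L - r) * h (M - t) * alt_kernel r t a b" for r t
  have split_L: "{-1..L} = insert (- 1) {0..L}" and split_M: "{-1..M} = insert (- 1) {0..M}"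
    using assms by auto
  have "q powi (a^2 + a * b + b^2) * alt_kernel L M a b
    = (\<Sum>r\<in>{0..L+1}. \<Sum>t\<in>{0..M+1}. alt q a b * (q powi (r^2 - r * t + t^2) * h (L + 1 - r) * h (M + 1 - t) * kernel r t a b))"
    unfolding sum_distrib_left[symmetric] kernel_step alt_kernel_def by (simp only: mult_ac)
  also have "\<dots> = (\<Sum>r\<in>{-1..L}. \<Sum>t\<in>{0..M+1}. alt q a b * (q powi ((r+1)^2 - (r+1) * t + t^2) * h (L - r) * h (M + 1 - t) * kernel (r+1) t a b))"
    by (rule sum.reindex_bij_witness[of _ "\<lambda>r. r + 1" "\<lambda>r. r - 1"]) (auto simp: diff_diff_eq2)
  also have "\<dots> = (\<Sum>r\<in>{-1..L}. \<Sum>t\<in>{-1..M}. alt q a b * (q powi ((r+1)^2 - (r+1) * (t+1) + (t+1)^2) * h (L - r) * h (M - t) * kernel (r+1) (t+1) a b))"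
    by (intro sum.cong refl sum.reindex_bij_witness[of _ "\<lambda>r. r + 1" "\<lambda>r. r - 1"]) (auto simp: diff_diff_eq2)
  also have "\<dots> = (\<Sum>r\<in>{-1..L}. \<Sum>t\<in>{-1..M}. q * F r t)"
  proof (intro sum.cong refl)
    fix r t
    have "q powi ((r+1)^2 - (r+1) * (t+1) + (t+1)^2) = q powi (1 + (r^2 - r * t + t^2 + (r + t)))"
      by (rule arg_cong[of _ _ "\<lambda>n. q powi n"]) (simp add: algebra_simps power2_eq_square)
    then have *: "q powi ((r+1)^2 - (r+1) * (t+1) + (t+1)^2) = q * q powi (r^2 - r * t + t^2 + (r + t))"
      by (simp add: powi_add)
    show "alt q a b * (q powi ((r+1)^2 - (r+1) * (t+1) + (t+1)^2) * h (L - r) * h (M - t) * kernel (r+1) (t+1) a b) = q * F r t"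
      unfolding * F_def alt_kernel_def by (simp only: mult_ac)
  qed
  also have "\<dots> = (\<Sum>r\<in>{-1..L}. \<Sum>t\<in>{0..M}. q * F r t)"
    by (simp add: split_M F_def alt_kernel_boundary)
  also have "\<dots> = (\<Sum>r\<in>{0..L}. \<Sum>t\<in>{0..M}. q * F r t)"
    by (simp add: split_L F_def alt_kernel_boundary)
  also have "\<dots> = q * (\<Sum>r\<in>{0..L}. \<Sum>t\<in>{0..M}. F r t)"
    by (simp only: sum_distrib_left)
  finally have "q powi (a^2 + a * b + b^2) * alt_kernel L M a b = q * (\<Sum>r\<in>{0..L}. \<Sum>t\<in>{0..M}. F r t)" .
  then show ?thesis
    using q_nonzero by (simp add: F_def power_int_diff field_simps)
qed

lemma kernel_factors:
  "kernel L M a b = qfac (L + M) * ((h (L - a) * h (M + a)) * (h (L - b) * h (M + b))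
     * (h (L - (- a - b)) * h (M + (- a - b))))"
proof -
  have "L - (- a - b) = L + a + b" "M + (- a - b) = M - a - b" by simp_all
  then show ?thesis by (simp only: kernel_def mult_ac)
qed

text \<open>Up to a common factor the six kernels on the right are the terms of a 3x3 determinant
  whose rows are linear forms in \<open>q powi - c\<close>, \<open>1\<close>, \<open>q powi c\<close> for the three coordinates \<open>c\<close>;
  hence it is a multiple of the alternant.\<close>
lemma alt_kernel_contract:
  assumes "L \<ge> 0" "M \<ge> 0"
  shows "(1 - q powi (L + M + 1)) * alt_kernel L M a b
    = q powi (- 2 * a - b) * kernel L M (a - 1) b + q powi (a + 2 * b) * kernel L M a (b + 1)
      + q powi (a - b) * kernel L M (a + 1) (b - 1) - q powi (- a - 2 * b) * kernel L M a (b - 1)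
      - q powi (b - a) * kernel L M (a - 1) (b + 1) - q powi (2 * a + b) * kernel L M (a + 1) b"
proof -
  define U V where "U = q powi L" and "V = q powi M"
  define x y H where "x c = q powi c" and "y c = q powi (- c)" and "H c = h (L + 1 - c) * h (M + 1 + c)" for c
  have xy: "x c * y c = 1" for c
    using q_nonzero by (simp add: x_def y_def power_int_minus)
  have L0: "h (L - c) = (1 - q * U * y c) * h (L + 1 - c)" for c
  proof -
    have "q powi (L + 1 - c) = q * U * y c"
      using powi_add[of "1 + L" "- c"] by (simp add: U_def y_def powi_add add.commute)
    then show ?thesis using h_pred[of "L + 1 - c"] by (simp add: algebra_simps)
  qed
  have L1: "h (L - 1 - c) = (1 - U * y c) * h (L - c)" for c
  proof -
    have "q powi (L - c) = U * y c"
      using powi_add[of L "- c"] by (simp add: U_def y_def)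
    then show ?thesis using h_pred[of "L - c"] by (simp add: algebra_simps)
  qed
  have M0: "h (M + c) = (1 - q * V * x c) * h (M + 1 + c)" for c
    using h_pred[of "M + 1 + c"] by (simp add: V_def x_def powi_add algebra_simps)
  have M1: "h (M - 1 + c) = (1 - V * x c) * h (M + c)" for c
    using h_pred[of "M + c"] by (simp add: V_def x_def powi_add algebra_simps)
  \<comment> \<open>A coordinate is lowered, kept or raised and multiplied by \<open>y c\<close>,
    \<open>1\<close> or \<open>x c\<close>. By \<open>x c * y c = 1\<close> each result is a linear
    form in \<open>y c\<close>, \<open>1\<close>, \<open>x c\<close> times the same factor
    \<open>H c\<close>.\<close>
  have lower: "y c * (h (L - (c - 1)) * h (M + (c - 1))) = (1 * y c + - (q * V + V) + q * V * V * x c) * H c" for c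
  proof -
    have "y c * (h (L - (c - 1)) * h (M + (c - 1))) = y c * (1 - V * x c) * (1 - q * V * x c) * H c"
    proof -
      have "L - (c - 1) = L + 1 - c" "M + (c - 1) = M - 1 + c" by simp_all
      then show ?thesis unfolding H_def by (simp only: M1 M0 mult_ac)
    qed
    also have "y c * (1 - V * x c) * (1 - q * V * x c) = 1 * y c + - (q * V + V) * (x c * y c) + q * V * V * x c * (x c * y c)"
      by (simp add: algebra_simps)
    finally show ?thesis by (simp add: xy)
  qed
  have middle: "h (L - c) * h (M + c) = (- (q * U) * y c + (1 + q * U * (q * V)) + - (q * V) * x c) * H c" for c
  proof -
    have "h (L - c) * h (M + c) = (1 - q * U * y c) * (1 - q * V * x c) * H c"
      unfolding L0 M0 H_def by (simp only: mult_ac)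
    also have "(1 - q * U * y c) * (1 - q * V * x c) = - (q * U) * y c + (1 + q * U * (q * V) * (x c * y c)) + - (q * V) * x c"
      by (simp add: algebra_simps)
    finally show ?thesis by (simp add: xy)
  qed
  have upper: "x c * (h (L - (c + 1)) * h (M + (c + 1))) = (q * U * U * y c + - (q * U + U) + 1 * x c) * H c" for c
  proof -
    have "x c * (h (L - (c + 1)) * h (M + (c + 1))) = x c * (1 - U * y c) * (1 - q * U * y c) * H c"
    proof -
      have "L - (c + 1) = L - 1 - c" "M + (c + 1) = M + 1 + c" by simp_all
      then show ?thesis unfolding H_def by (simp only: L1 L0 mult_ac)
    qed
    also have "x c * (1 - U * y c) * (1 - q * U * y c) = q * U * U * y c * (x c * y c) + - (q * U + U) * (x c * y c) + 1 * x c"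
      by (simp add: algebra_simps)
    finally show ?thesis by (simp add: xy)
  qed
  define c where "c = - a - b"
  have K: "kernel L M a' b' = qfac (L + M) * ((h (L - a') * h (M + a')) * (h (L - b') * h (M + b')) * (h (L - c') * h (M + c')))"
    if "c' = - a' - b'" for a' b' c'
    unfolding that by (rule kernel_factors)
  have K1: "kernel L M (a - 1) b = qfac (L + M) * ((h (L - (a - 1)) * h (M + (a - 1))) * (h (L - b) * h (M + b)) * (h (L - (c + 1)) * h (M + (c + 1))))"
    by (rule K) (simp add: c_def)
  have K2: "kernel L M a (b + 1) = qfac (L + M) * ((h (L - a) * h (M + a)) * (h (L - (b + 1)) * h (M + (b + 1))) * (h (L - (c - 1)) * h (M + (c - 1))))"
    by (rule K) (simp add: c_def)
  have K3: "kernel L M (a + 1) (b - 1) = qfac (L + M) * ((h (L - (a + 1)) * h (M + (a + 1))) * (h (L - (b - 1)) * h (M + (b - 1))) * (h (L - c) * h (M + c)))"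
    by (rule K) (simp add: c_def)
  have K4: "kernel L M a (b - 1) = qfac (L + M) * ((h (L - a) * h (M + a)) * (h (L - (b - 1)) * h (M + (b - 1))) * (h (L - (c + 1)) * h (M + (c + 1))))"
    by (rule K) (simp add: c_def)
  have K5: "kernel L M (a - 1) (b + 1) = qfac (L + M) * ((h (L - (a - 1)) * h (M + (a - 1))) * (h (L - (b + 1)) * h (M + (b + 1))) * (h (L - c) * h (M + c)))"
    by (rule K) (simp add: c_def)
  have K6: "kernel L M (a + 1) b = qfac (L + M) * ((h (L - (a + 1)) * h (M + (a + 1))) * (h (L - b) * h (M + b)) * (h (L - (c - 1)) * h (M + (c - 1))))"
    by (rule K) (simp add: c_def)
  have P: "q powi (- 2 * a - b) = y a * x c" "q powi (a + 2 * b) = x b * y c" "q powi (a - b) = x a * y b"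
     "q powi (- a - 2 * b) = y b * x c" "q powi (b - a) = y a * x b" "q powi (2 * a + b) = x a * y c"
    unfolding x_def y_def powi_add[symmetric] c_def by (simp_all add: algebra_simps)
  have "q powi (- 2 * a - b) * kernel L M (a - 1) b + q powi (a + 2 * b) * kernel L M a (b + 1)
      + q powi (a - b) * kernel L M (a + 1) (b - 1) - q powi (- a - 2 * b) * kernel L M a (b - 1)
      - q powi (b - a) * kernel L M (a - 1) (b + 1) - q powi (2 * a + b) * kernel L M (a + 1) b
    = qfac (L + M) * (
        (y a * (h (L - (a - 1)) * h (M + (a - 1)))) * (h (L - b) * h (M + b)) * (x c * (h (L - (c + 1)) * h (M + (c + 1))))
      + (h (L - a) * h (M + a)) * (x b * (h (L - (b + 1)) * h (M + (b + 1)))) * (y c * (h (L - (c - 1)) * h (M + (c - 1))))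
      + (x a * (h (L - (a + 1)) * h (M + (a + 1)))) * (y b * (h (L - (b - 1)) * h (M + (b - 1)))) * (h (L - c) * h (M + c))
      - (h (L - a) * h (M + a)) * (y b * (h (L - (b - 1)) * h (M + (b - 1)))) * (x c * (h (L - (c + 1)) * h (M + (c + 1))))
      - (y a * (h (L - (a - 1)) * h (M + (a - 1)))) * (x b * (h (L - (b + 1)) * h (M + (b + 1)))) * (h (L - c) * h (M + c))
      - (x a * (h (L - (a + 1)) * h (M + (a + 1)))) * (h (L - b) * h (M + b)) * (y c * (h (L - (c - 1)) * h (M + (c - 1)))))"
    unfolding P right_diff_distrib distrib_left K1 K2 K3 K4 K5 K6 by (simp only: mult_ac)
  also have "\<dots> = qfac (L + M) * (H a * H b * H c) * (
      (1 * y a + - (q * V + V) + q * V * V * x a) * (- (q * U) * y b + (1 + q * U * (q * V)) + - (q * V) * x b) * (q * U * U * y c + - (q * U + U) + 1 * x c)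
    + (- (q * U) * y a + (1 + q * U * (q * V)) + - (q * V) * x a) * (q * U * U * y b + - (q * U + U) + 1 * x b) * (1 * y c + - (q * V + V) + q * V * V * x c)
    + (q * U * U * y a + - (q * U + U) + 1 * x a) * (1 * y b + - (q * V + V) + q * V * V * x b) * (- (q * U) * y c + (1 + q * U * (q * V)) + - (q * V) * x c)
    - (- (q * U) * y a + (1 + q * U * (q * V)) + - (q * V) * x a) * (1 * y b + - (q * V + V) + q * V * V * x b) * (q * U * U * y c + - (q * U + U) + 1 * x c)
    - (1 * y a + - (q * V + V) + q * V * V * x a) * (q * U * U * y b + - (q * U + U) + 1 * x b) * (- (q * U) * y c + (1 + q * U * (q * V)) + - (q * V) * x c)
    - (q * U * U * y a + - (q * U + U) + 1 * x a) * (- (q * U) * y b + (1 + q * U * (q * V)) + - (q * V) * x b) * (1 * y c + - (q * V + V) + q * V * V * x c))"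
    (is "_ = _ * ?det")
    unfolding lower upper unfolding middle by (rule det_scale_rows)
  \<comment> \<open>The coefficient determinant factors completely. One \<open>1 - q * U * V\<close>
    is the factor on the left of the lemma; the other two factors raise \<open>qfac (L + M)\<close>
    to \<open>qfac (L + M + 2)\<close>.\<close>
  also have "?det = (1 - q * U * V) ^ 2 * (1 - q ^ 2 * U * V) * (y a * x c + x b * y c + x a * y b - y b * x c - y a * x b - x a * y c)"
    unfolding det_linear_forms[where ?v1.0 = 1 and ?v2.0 = 1 and ?v3.0 = 1, unfolded mult_1_right] by (rule arg_cong2[of _ _ _ _ "(*)"]) (simp_all add: algebra_simps power2_eq_square)
  also have "y a * x c + x b * y c + x a * y b - y b * x c - y a * x b - x a * y c = alt q a b"
    unfolding alt_def P by simp
  also have "qfac (L + M) * (H a * H b * H c) * ((1 - q * U * V) ^ 2 * (1 - q ^ 2 * U * V) * alt q a b)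
    = (1 - q * U * V) * (alt q a b * (((1 - q ^ 2 * U * V) * ((1 - q * U * V) * qfac (L + M))) * (H a * H b * H c)))"
    by (simp only: power2_eq_square mult_ac)
  also have "(1 - q ^ 2 * U * V) * ((1 - q * U * V) * qfac (L + M)) = qfac ((L + 1) + (M + 1))"
  proof -
    have 1: "q powi (L + M + 1) = q * U * V" "q powi (L + M + 2) = q ^ 2 * U * V"
      by (simp_all add: U_def V_def powi_add)
    have "qfac (L + M + 2) = (1 - q powi (L + M + 2)) * qfac (L + M + 1)"
      using qfac_pred[of "L + M + 2"] assms by (simp add: algebra_simps)
    moreover have "qfac (L + M + 1) = (1 - q powi (L + M + 1)) * qfac (L + M)"
      using qfac_pred[of "L + M + 1"] assms by (simp add: algebra_simps)
    moreover have "(L + 1) + (M + 1) = L + M + 2" by simp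
    ultimately show ?thesis by (simp only: 1)
  qed
  also have "qfac ((L + 1) + (M + 1)) * (H a * H b * H c) = kernel (L + 1) (M + 1) a b"
    unfolding H_def c_def by (rule kernel_factors[symmetric])
  also have "1 - q * U * V = 1 - q powi (L + M + 1)"
    by (simp add: U_def V_def powi_add)
  finally show ?thesis by (simp add: alt_kernel_def)
qed

end

section \<open>The seed of the Bailey chain\<close>

definition omega :: complex where "omega = Complex (- 1 / 2) (sqrt 3 / 2)"

lemma omega_square: "omega ^ 2 = - 1 - omega"
  by (simp add: omega_def complex_eq_iff power2_eq_square)

lemma omega_cube: "omega ^ 3 = 1"
proof -
  have *: "omega * omega = - 1 - omega" using omega_square by (simp add: power2_eq_square)
  have "omega ^ 3 = omega * (omega * omega)" by (simp add: power3_eq_cube)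
  also have "\<dots> = - omega - omega * omega" unfolding * by (simp add: right_diff_distrib *)
  finally show ?thesis by (simp add: *)
qed

lemma omega_nonzero: "omega \<noteq> 0"
  using omega_cube by auto

lemma omega_diff_nonzero: "omega ^ 2 - omega \<noteq> 0"
  by (simp add: omega_square) (simp add: omega_def complex_eq_iff)

lemma norm_omega_powi [simp]: "norm (omega powi n) = 1"
proof -
  have "norm omega ^ 3 = 1" by (metis norm_one norm_power omega_cube)
  then have "norm omega = 1" using power_eq_imp_eq_base[of "norm omega" 3 1] by simp
  then show ?thesis by (simp add: norm_power_int)
qed

lemma omega_powi_shift: "omega powi (n + 3 * k) = omega powi n"
proof -
  have "omega powi (3 * k) = 1"
    using omega_cube by (simp add: power_int_mult flip: power_int_numeral)
  then show ?thesis using power_int_add[of omega n "3 * k"] omega_nonzero by simp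
qed

lemma int_choose_2: "2 * int (n choose 2) = int n * (int n - 1)"
proof (induction n)
  case (Suc n)
  then show ?case by (simp add: numeral_2_eq_2 algebra_simps)
qed (simp add: numeral_2_eq_2)

lemma coeff_linear_mult_Suc: "coeff (p * [:1, c:]) (Suc a) = coeff p (Suc a) + c * coeff p a"
  for c :: "'a :: comm_semiring_1"
  by (simp add: mult_pCons_right)

lemma coeff_cube_mult_Suc: "coeff (p * [:1, 0, 0, c:]) (3 * Suc a) = coeff p (3 * Suc a) + c * coeff p (3 * a)"
  for c :: "'a :: comm_semiring_1"
  by (simp add: mult_pCons_right numeral_3_eq_3)

lemma coeff_cube_shift: "coeff (p * [:0, 0, 0, c:]) (3 * Suc a) = c * coeff p (3 * a)"
  for c :: "'a :: comm_semiring_1"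
  by (simp add: mult_pCons_right numeral_3_eq_3)

text \<open>Substituting the cube of the variable. It reduces the determinant below to the
  q-binomial theorem in base \<open>q^3\<close>.\<close>

lemma coeff_prod_cube:
  fixes c :: "nat \<Rightarrow> 'a :: comm_semiring_1"
  shows "coeff (\<Prod>j<n. [:1, 0, 0, c j:]) (3 * a) = coeff (\<Prod>j<n. [:1, c j:]) a"
proof (induction n arbitrary: a)
  case (Suc n)
  show ?case
  proof (cases a)
    case 0
    then show ?thesis using Suc[of 0] by (simp add: coeff_mult_0)
  next
    case (Suc b)
    show ?thesis unfolding Suc prod.lessThan_Suc coeff_linear_mult_Suc coeff_cube_mult_Suc Suc.IH ..
  qed
qed (auto simp: one_pCons coeff_pCons split: nat.splits)

lemma coeff_triple_mult:
  fixes p1 p2 p3 :: "'a :: comm_semiring_1 poly"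
  shows "coeff (p1 * p2 * p3) m = (\<Sum>(i, j)\<in>{(i, j). i + j \<le> m}. coeff p1 i * coeff p2 j * coeff p3 (m - i - j))"
proof -
  have "coeff (p1 * p2 * p3) m = (\<Sum>i\<le>m. \<Sum>j\<le>m - i. coeff p1 i * coeff p2 j * coeff p3 (m - i - j))"
    by (simp add: coeff_mult mult.assoc sum_distrib_left)
  also have "\<dots> = (\<Sum>(i, j)\<in>Sigma {..m} (\<lambda>i. {..m - i}). coeff p1 i * coeff p2 j * coeff p3 (m - i - j))"
    by (simp add: sum.Sigma)
  also have "Sigma {..m} (\<lambda>i. {..m - i}) = {(i, j). i + j \<le> m}" by auto
  finally show ?thesis .
qed

context nome
begin

lemma powi_nat: "q powi int n = q ^ n"
  by (simp add: power_int_def)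

section \<open>The q-binomial theorem and lattice sums of kernels\<close>

text \<open>Induction by the q-Pascal rule. The Gaussian binomial is written with \<open>h\<close>,
  so coefficients beyond degree \<open>N\<close> vanish by convention.\<close>

theorem q_binomial:
  "coeff (\<Prod>j<N. [:1, z * q ^ j:]) a = z ^ a * q ^ (a choose 2) * (qpoch q q N * h (int a) * h (int N - int a))"
proof (induction N arbitrary: a)
  case 0
  show ?case by (cases a) (simp_all add: qpoch_def one_pCons numeral_2_eq_2)
next
  case (Suc N)
  show ?case
  proof (cases a)
    case 0
    then show ?thesis using Suc[of 0] qfac_h[of "int (Suc N)"] qfac_h[of "int N"]
      by (simp add: coeff_mult_0 numeral_2_eq_2 del: of_nat_Suc)
  next
    case (Suc b)
    define A where "A = q ^ b"
    have aa: "(Suc b choose 2) = b + (b choose 2)" by (simp add: numeral_2_eq_2)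
    have 1: "h (int b) = (1 - q * A) * h (int (Suc b))"
      using h_pred[of "int (Suc b)"] by (simp add: A_def power_int_def nat_add_distrib)
    have 2: "h (int N - int (Suc b)) = (1 - q powi (int N - int b)) * h (int (Suc N) - int (Suc b))"
      using h_pred[of "int N - int b"] by (simp add: algebra_simps)
    have 3: "h (int N - int b) = h (int (Suc N) - int (Suc b))" by simp
    have "q ^ N = q powi ((int N - int b) + int b)" by (simp add: power_int_def)
    then have 4: "q ^ N = q powi (int N - int b) * A" by (simp only: powi_add powi_nat A_def)
    have "coeff (\<Prod>j<Suc N. [:1, z * q ^ j:]) (Suc b)
        = z ^ Suc b * q ^ (Suc b choose 2) * (qpoch q q N * h (int (Suc b)) * h (int N - int (Suc b)))
        + (z * q ^ N) * (z ^ b * q ^ (b choose 2) * (qpoch q q N * h (int b) * h (int N - int b)))"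
      by (simp only: prod.lessThan_Suc coeff_linear_mult_Suc Suc.IH)
    also have "\<dots> = z ^ Suc b * q ^ (Suc b choose 2) * qpoch q q N * h (int (Suc b)) * h (int (Suc N) - int (Suc b))
       * ((1 - q powi (int N - int b)) + q powi (int N - int b) * (1 - q * A))"
      unfolding aa 2 unfolding 1 unfolding 3 unfolding 4 unfolding power_add A_def[symmetric] by (simp add: algebra_simps)
    also have "(1 - q powi (int N - int b)) + q powi (int N - int b) * (1 - q * A) = 1 - q ^ Suc N"
      using 4 by (simp add: algebra_simps)
    finally show ?thesis unfolding Suc qpoch_Suc by (simp only: mult_ac)
  qed
qed

lemma kernel_eq_0: "a > L \<or> b > L \<or> a + b < - L \<Longrightarrow> kernel L M a b = 0"
  by (auto simp: kernel_def)

text \<open>Each coordinate of the kernel gives a Gaussian binomial of \<open>R + T\<close> over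
  \<open>R - a\<close>, \<open>R - b\<close> or \<open>R + a + b\<close>. These lower entries add up
  to \<open>3 * R\<close>, so the lattice sum is a coefficient of a product of three q-binomial
  polynomials. Three binomials have three numerators \<open>(q)_(R + T)\<close> and the kernel has
  one, whence the square in the divisor.\<close>

lemma has_sum_kernel:
  fixes R T :: nat and z1 z2 z3 :: complex
  assumes z: "z1 \<noteq> 0" "z2 \<noteq> 0" "z3 \<noteq> 0"
  defines "P \<equiv> \<lambda>z. \<Prod>j<R + T. [:1, z * q ^ j:]"
  shows "((\<lambda>(a, b). z1 powi (- a) * z2 powi (- b) * z3 powi (a + b) * q powi (a^2 + a * b + b^2) * kernel (int R) (int T) a b)
    has_sum (coeff (P z1 * P z2 * P z3) (3 * R) / ((z1 * z2 * z3) ^ R * q ^ (3 * (R choose 2)) * qpoch q q (R + T) ^ 2))) UNIV"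
    (is "(?f has_sum ?s) UNIV")
proof -
  define C where "C = (z1 * z2 * z3) ^ R * q ^ (3 * (R choose 2)) * qpoch q q (R + T) ^ 2"
  have C: "C \<noteq> 0" using z q_nonzero qpoch_nonzero by (simp add: C_def)
  let ?D = "{(i, j). i + j \<le> 3 * R}"
  let ?g = "\<lambda>(i, j). (int R - int i, int R - int j)"
  have fin: "finite ?D" by (rule finite_subset[of _ "{..3*R} \<times> {..3*R}"]) auto
  have inj: "inj_on ?g ?D" by (auto simp: inj_on_def)
  have term_eq: "coeff (P z1) i * coeff (P z2) j * coeff (P z3) (3 * R - i - j) = C * ?f (int R - int i, int R - int j)"
    if "i + j \<le> 3 * R" for i j
  proof -
    define l where "l = 3 * R - i - j"
    define a b where "a = int R - int i" and "b = int R - int j"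
    have i: "int i = int R - a" and j: "int j = int R - b" and l: "int l = int R + a + b"
      using that by (simp_all add: a_def b_def l_def)
    have z_powers: "z1 ^ i * z2 ^ j * z3 ^ l = (z1 * z2 * z3) ^ R * (z1 powi (- a) * z2 powi (- b) * z3 powi (a + b))"
    proof -
      have *: "z1 ^ i = z1 ^ R * z1 powi (- a)" "z2 ^ j = z2 ^ R * z2 powi (- b)" "z3 ^ l = z3 ^ R * z3 powi (a + b)"
        using z power_int_add[of z1 "int R" "- a"] power_int_add[of z2 "int R" "- b"] power_int_add[of z3 "int R" "a + b"]
        unfolding power_int_of_nat[symmetric] i j l by (simp_all add: add.assoc)
      show ?thesis unfolding * by (simp only: power_mult_distrib mult_ac)
    qed
    \<comment> \<open>The deviations \<open>- a\<close>, \<open>- b\<close>, \<open>a + b\<close>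
      from \<open>R\<close> add up to zero, so only their squares survive, giving
      \<open>2 * Q(a, b)\<close>.\<close>
    have "2 * int ((i choose 2) + (j choose 2) + (l choose 2)) = 2 * (int (3 * (R choose 2)) + (a^2 + a * b + b^2))"
      using int_choose_2[of i] int_choose_2[of j] int_choose_2[of l] int_choose_2[of R]
      unfolding i j l by (simp add: algebra_simps power2_eq_square)
    then have "int ((i choose 2) + (j choose 2) + (l choose 2)) = int (3 * (R choose 2)) + (a^2 + a * b + b^2)" by simp
    then have q_powers: "q ^ (i choose 2) * q ^ (j choose 2) * q ^ (l choose 2) = q ^ (3 * (R choose 2)) * q powi (a^2 + a * b + b^2)"
      by (metis powi_add powi_nat power_add)
    have k: "qpoch q q (R + T) ^ 2 * kernel (int R) (int T) a b = (qpoch q q (R + T) * h (int i) * h (int (R + T) - int i))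
       * (qpoch q q (R + T) * h (int j) * h (int (R + T) - int j)) * (qpoch q q (R + T) * h (int l) * h (int (R + T) - int l))"
    proof -
      have e: "int R - a = int i" "int R - b = int j" "int R + a + b = int l" "int T + a = int (R + T) - int i"
        "int T + b = int (R + T) - int j" "int T - a - b = int (R + T) - int l" "nat (int R + int T) = R + T"
        using i j l by (simp_all add: nat_add_distrib)
      show ?thesis unfolding kernel_def e by (simp only: power2_eq_square mult_ac)
    qed
    have "coeff (P z1) i * coeff (P z2) j * coeff (P z3) l
      = (z1 ^ i * z2 ^ j * z3 ^ l) * (q ^ (i choose 2) * q ^ (j choose 2) * q ^ (l choose 2))
        * ((qpoch q q (R + T) * h (int i) * h (int (R + T) - int i))
       * (qpoch q q (R + T) * h (int j) * h (int (R + T) - int j)) * (qpoch q q (R + T) * h (int l) * h (int (R + T) - int l)))"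
      unfolding P_def q_binomial by (simp only: mult_ac)
    also have "\<dots> = C * ?f (a, b)"
      unfolding z_powers q_powers k[symmetric] C_def by (simp only: case_prod_conv mult_ac)
    finally show ?thesis by (simp add: l_def a_def b_def)
  qed
  have "(?f has_sum ?s) (?g ` ?D)"
  proof (rule has_sum_finiteI)
    show "finite (?g ` ?D)" using fin by simp
    have "coeff (P z1 * P z2 * P z3) (3 * R) = (\<Sum>x\<in>?D. C * ?f (?g x))"
      unfolding coeff_triple_mult by (rule sum.cong) (use term_eq in auto)
    also have "\<dots> = C * sum ?f (?g ` ?D)"
      unfolding sum.reindex[OF inj] by (simp add: sum_distrib_left o_def)
    finally show "?s = sum ?f (?g ` ?D)" using C by (simp add: C_def)
  qed
  moreover have "?f x = 0" if "x \<notin> ?g ` ?D" for x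
  proof -
    obtain a b where x: "x = (a, b)" by force
    have "a > int R \<or> b > int R \<or> a + b < - int R"
    proof (rule ccontr)
      assume "\<not> ?thesis"
      then have "x = ?g (nat (int R - a), nat (int R - b))" "(nat (int R - a), nat (int R - b)) \<in> ?D"
        by (auto simp: x)
      then show False using that by blast
    qed
    then have "kernel (int R) (int T) a b = 0" by (rule kernel_eq_0)
    then show ?thesis by (simp add: x)
  qed
  ultimately show ?thesis
    by (subst has_sum_cong_neutral[where T = "?g ` ?D" and g = ?f]) auto
qed

text \<open>The innermost factor of the summand, at the last vector \<open>(r, t)\<close>.\<close>

definition seed :: "nat \<Rightarrow> nat \<Rightarrow> complex" where
  "seed r t = qpoch (q^3) (q^3) (r + t) * inv_qpoch (q^3) (q^3) (int r) * inv_qpoch (q^3) (q^3) (int t)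
     * h (int (r + t) + 1) * h (int (r + t))"


text \<open>After the common factors are removed, the entries are quadratic, so the determinant is a
  multiple of a Vandermonde determinant; the common factors combine to a polynomial in the cube of
  the variable because \<open>(1 - y)(1 - \<omega> y)(1 - \<omega>\<^sup>2 y) = 1 - y\<^sup>3\<close>.\<close>
lemma det_q_products:
  fixes n :: nat
  defines "P \<equiv> \<lambda>m i. (\<Prod>j<n + 2. [:1, - (q ^ m * omega ^ i) * q ^ j:])"
  shows "P 0 0 * P 1 1 * P 2 2 + P 1 0 * P 2 1 * P 0 2 + P 2 0 * P 0 1 * P 1 2
       - P 1 0 * P 0 1 * P 2 2 - P 0 0 * P 2 1 * P 1 2 - P 2 0 * P 1 1 * P 0 2
     = (\<Prod>j<n. [:1, 0, 0, - (q ^ 6) * (q ^ 3) ^ j:])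
       * [:0, 0, 0, q ^ 2 * (1 - q ^ (n + 2)) ^ 2 * (1 - q ^ (n + 1)) * (3 * (omega ^ 2 - omega)):]"
proof -
  \<comment> \<open>The factors of \<open>P m\<close> belong to the powers \<open>q^m\<close>, ...,
    \<open>q^(m + n + 1)\<close>. For \<open>m = 0, 1, 2\<close> they share \<open>q^2\<close>, ...,
    \<open>q^(n + 1)\<close>, and two factors of each are left over.\<close>
  define C where "C i = (\<Prod>j<n. [:1, - (q ^ (j + 2) * omega ^ i):])" for i
  define t where "t = q ^ (n + 1)"
  have split: "(\<Prod>j<n + 2. g j) = g 0 * (g 1 * (\<Prod>j<n. g (j + 2)))" for g :: "nat \<Rightarrow> complex poly"
    by (simp add: prod.lessThan_Suc_shift del: prod.lessThan_Suc)
  have split': "(\<Prod>j<n + 2. g j) = g 0 * ((\<Prod>j<n. g (j + 1)) * g (n + 1))" for g :: "nat \<Rightarrow> complex poly"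
    using prod.lessThan_Suc[of "\<lambda>j. g (j + 1)" n] prod.lessThan_Suc_shift[of "\<lambda>j. g (j + 1)" n] split[of g]
    by (simp del: prod.lessThan_Suc)
  have P0: "P 0 i = C i * ([:1, - (omega ^ i):] * [:1, - q * omega ^ i:])" for i
  proof -
    have "(\<Prod>j<n. [:1, - (q ^ 0 * omega ^ i) * q ^ (j + 2):]) = C i"
      unfolding C_def by (rule prod.cong) (simp_all add: mult_ac)
    moreover have "[:1, - (q ^ 0 * omega ^ i) * q ^ 0:] = [:1, - (omega ^ i):]"
      "[:1, - (q ^ 0 * omega ^ i) * q ^ 1:] = [:1, - q * omega ^ i:]" by simp_all
    ultimately show ?thesis unfolding P_def split by (simp only: mult_ac)
  qed
  have P1: "P 1 i = C i * ([:1, - q * omega ^ i:] * [:1, - (q * t) * omega ^ i:])" for i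
  proof -
    have "(\<Prod>j<n. [:1, - (q ^ 1 * omega ^ i) * q ^ (j + 1):]) = C i"
      unfolding C_def by (rule prod.cong) (simp_all add: mult_ac)
    moreover have "[:1, - (q ^ 1 * omega ^ i) * q ^ 0:] = [:1, - q * omega ^ i:]"
      "[:1, - (q ^ 1 * omega ^ i) * q ^ (n + 1):] = [:1, - (q * t) * omega ^ i:]" by (simp_all add: t_def)
    ultimately show ?thesis unfolding P_def split' by (simp only: mult_ac)
  qed
  have P2: "P 2 i = C i * ([:1, - (q * t) * omega ^ i:] * [:1, - (q ^ 2 * t) * omega ^ i:])" for i
  proof -
    have "(\<Prod>j<n. [:1, - (q ^ 2 * omega ^ i) * q ^ j:]) = C i"
      unfolding C_def by (rule prod.cong) (simp_all add: mult_ac power_add power2_eq_square)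
    moreover have "[:1, - (q ^ 2 * omega ^ i) * q ^ n:] = [:1, - (q * t) * omega ^ i:]"
      "[:1, - (q ^ 2 * omega ^ i) * q ^ (Suc n):] = [:1, - (q ^ 2 * t) * omega ^ i:]"
      by (simp_all add: t_def power2_eq_square)
    ultimately show ?thesis unfolding P_def add_2_eq_Suc' prod.lessThan_Suc by (simp only: mult_ac)
  qed
  have form: "C i * ([:1, u * omega ^ i:] * [:1, v * omega ^ i:])
     = C i * ([:1:] * [:1:] + [:u + v:] * [:0, omega ^ i:] + [:u * v:] * [:0, 0, omega ^ (2 * i):])" for i u v
    by (rule arg_cong[of _ _ "(*) (C i)"]) (simp add: algebra_simps power_mult power2_eq_square)
  have C3: "C 0 * C 1 * C 2 = (\<Prod>j<n. [:1, 0, 0, - (q ^ 6) * (q ^ 3) ^ j:])"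
    unfolding C_def prod.distrib[symmetric]
  proof (rule prod.cong[OF refl])
    fix j
    define y where "y = q ^ (j + 2)"
    have y: "y ^ 3 = q ^ 6 * (q ^ 3) ^ j" unfolding y_def by (simp add: power_add power_mult_distrib mult_ac flip: power_mult)
    have o2: "omega * (omega * x) = - x - omega * x" for x
      using omega_square by (simp add: power2_eq_square left_diff_distrib flip: mult.assoc)
    have *: "[:1, - (y * omega ^ 0):] * [:1, - (y * omega ^ 1):] * [:1, - (y * omega ^ 2):] = [:1, 0, 0, - (y ^ 3 * omega ^ 3):]"
      unfolding omega_square by (simp add: algebra_simps power3_eq_cube o2)
    show "[:1, - (q ^ (j + 2) * omega ^ 0):] * [:1, - (q ^ (j + 2) * omega ^ 1):] * [:1, - (q ^ (j + 2) * omega ^ 2):]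
       = [:1, 0, 0, - (q ^ 6) * (q ^ 3) ^ j:]"
      unfolding y_def[symmetric] * by (simp only: y omega_cube mult_1_right mult_minus_left)
  qed
  define F where "F m i = (if m = 0 then [:1:] * [:1:] + [:- 1 + - q:] * [:0, omega ^ i:] + [:- 1 * - q:] * [:0, 0, omega ^ (2 * i):]
     else if m = 1 then [:1:] * [:1:] + [:- q + - (q * t):] * [:0, omega ^ i:] + [:- q * - (q * t):] * [:0, 0, omega ^ (2 * i):]
     else [:1:] * [:1:] + [:- (q * t) + - (q ^ 2 * t):] * [:0, omega ^ i:] + [:- (q * t) * - (q ^ 2 * t):] * [:0, 0, omega ^ (2 * i):])"
    for m i :: nat
  have PF: "P 0 i = F 0 i * C i" "P 1 i = F 1 i * C i" "P 2 i = F 2 i * C i" for i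
    unfolding P0 P1 P2 F_def using form[of i "- 1" "- q"] form[of i "- q" "- (q * t)"] form[of i "- (q * t)" "- (q ^ 2 * t)"]
    by (simp_all add: mult.commute)
  \<comment> \<open>The second factor is the Vandermonde determinant at \<open>1\<close>,
    \<open>omega\<close>, \<open>omega^2\<close> times the cube of the variable; its value is
    \<open>3 * (omega^2 - omega)\<close> because
    \<open>(omega - 1) * (omega^2 - 1) = 3\<close>.\<close>
  have det: "F 0 0 * F 1 1 * F 2 2 + F 1 0 * F 2 1 * F 0 2 + F 2 0 * F 0 1 * F 1 2
       - F 1 0 * F 0 1 * F 2 2 - F 0 0 * F 2 1 * F 1 2 - F 2 0 * F 1 1 * F 0 2
     = [:q ^ 2 * (1 - q * t) ^ 2 * (1 - t):] * [:0, 0, 0, 3 * (omega ^ 2 - omega):]"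
  proof -
    have o2: "omega * omega = - 1 - omega" "omega * (omega * x) = - x - omega * x" for x
      using omega_square by (simp_all add: power2_eq_square left_diff_distrib flip: mult.assoc)
    have o4: "omega ^ 4 = omega" using power_add[of omega 3 1] omega_cube by simp
    show ?thesis
      unfolding F_def
      apply (simp only: if_True if_False zero_neq_one one_neq_zero numeral_eq_one_iff zero_neq_numeral numeral_neq_zero semiring_norm refl)
      apply (subst det_linear_forms)
      apply (rule arg_cong2[of _ _ _ _ "(*)"])
      apply (simp add: algebra_simps power2_eq_square)
      apply (simp add: algebra_simps power2_eq_square o2 o4)
      done
  qed
  have "P 0 0 * P 1 1 * P 2 2 + P 1 0 * P 2 1 * P 0 2 + P 2 0 * P 0 1 * P 1 2
       - P 1 0 * P 0 1 * P 2 2 - P 0 0 * P 2 1 * P 1 2 - P 2 0 * P 1 1 * P 0 2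
     = 1 * ((F 0 0 * C 0) * (F 1 1 * C 1) * (F 2 2 * C 2) + (F 1 0 * C 0) * (F 2 1 * C 1) * (F 0 2 * C 2)
        + (F 2 0 * C 0) * (F 0 1 * C 1) * (F 1 2 * C 2) - (F 1 0 * C 0) * (F 0 1 * C 1) * (F 2 2 * C 2)
        - (F 0 0 * C 0) * (F 2 1 * C 1) * (F 1 2 * C 2) - (F 2 0 * C 0) * (F 1 1 * C 1) * (F 0 2 * C 2))"
    unfolding PF by simp
  also have "\<dots> = (C 0 * C 1 * C 2) * ([:q ^ 2 * (1 - q * t) ^ 2 * (1 - t):] * [:0, 0, 0, 3 * (omega ^ 2 - omega):])"
    unfolding det_scale_rows det by simp
  finally show ?thesis unfolding C3 t_def by (simp add: mult_ac)
qed


text \<open>The signs cancel because the exponents add up to zero, and the exponent of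
  \<open>omega\<close> is \<open>- b + 2 * (a + b) = (b - a) + 3 * a\<close>.\<close>

lemma omega_power_combine:
  assumes "m1 + m2 + m3 = 3"
  shows "(- (q ^ m1 * omega ^ 0)) powi (- a) * (- (q ^ m2 * omega ^ 1)) powi (- b) * (- (q ^ m3 * omega ^ 2)) powi (a + b)
    = omega powi (b - a) * q powi (int m3 * (a + b) - int m1 * a - int m2 * b)"
proof -
  have split: "(- (q ^ m * omega ^ i)) powi c = (- 1) powi c * q powi (int m * c) * omega powi (int i * c)" for m i c
    by (simp only: power_int_mult_distrib[of "- 1" "q ^ m * omega ^ i", simplified mult_minus1] power_int_mult_distrib
        power_int_mult power_int_of_nat mult.assoc)
  have 1: "(- 1 :: complex) powi (- a) * (- 1) powi (- b) * (- 1) powi (a + b) = 1"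
    by (simp flip: power_int_add)
  have 2: "omega powi (int 0 * (- a)) * omega powi (int 1 * (- b)) * omega powi (int 2 * (a + b)) = omega powi (b - a)"
    unfolding power_int_add[OF disjI1[OF omega_nonzero], symmetric] 
    using omega_powi_shift[of "b - a" a] by (simp add: algebra_simps)
  have 3: "q powi (int m1 * (- a)) * q powi (int m2 * (- b)) * q powi (int m3 * (a + b))
      = q powi (int m3 * (a + b) - int m1 * a - int m2 * b)"
    by (simp only: powi_add[symmetric]) (simp add: algebra_simps)
  have shuffle: "(u1 * v1 * w1) * (u2 * v2 * w2) * (u3 * v3 * w3) = (u1 * u2 * u3) * (w1 * w2 * w3) * (v1 * v2 * v3)"
    for u1 u2 u3 v1 v2 v3 w1 w2 w3 :: complex by (simp only: mult_ac)
  show ?thesis unfolding split by (rule trans[OF shuffle]) (simp only: 1 2 3 mult_1)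
qed

text \<open>The six terms of the alternant correspond to the six ways of giving the shifts 0, 1, 2
  to the variables \<open>1\<close>, \<open>omega\<close>, \<open>omega^2\<close>. Their signed sum
  is minus a coefficient of the determinant above, which is a polynomial in the cube of the
  variable. Its coefficient of degree \<open>3 * (r + 1)\<close> is a Gaussian binomial in base
  \<open>q^3\<close>, and this produces the factors \<open>(q^3; q^3)\<close> of the seed.\<close>

theorem seed_has_sum:
  "((\<lambda>(a, b). omega powi (b - a) * q powi (a^2 + a * b + b^2) * alt_kernel (int r) (int t) a b)
     has_sum (3 * (omega ^ 2 - omega) / q * seed r t)) UNIV"
proof -
  define n where "n = r + t"
  define P where "P m i = (\<Prod>j<n + 2. [:1, - (q ^ m * omega ^ i) * q ^ j:])" for m i
  \<comment> \<open>The divisor from \<open>has_sum_kernel\<close> at \<open>R = r + 1\<close>: the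
    product of the three variables is \<open>- (q^3)\<close> for every assignment of the
    shifts.\<close>
  define D where "D = (- (q ^ 3)) ^ Suc r * q ^ (3 * (Suc r choose 2)) * qpoch q q (n + 2) ^ 2"
  define f where "f m1 m2 m3 = (\<lambda>(a, b). omega powi (b - a) * q powi (a^2 + a * b + b^2)
       * (q powi (int m3 * (a + b) - int m1 * a - int m2 * b) * kernel (int r + 1) (int t + 1) a b))" for m1 m2 m3
  have f: "(f m1 m2 m3 has_sum (coeff (P m1 0 * P m2 1 * P m3 2) (3 * Suc r) / D)) UNIV" if "m1 + m2 + m3 = 3" for m1 m2 m3
  proof -
    have N: "Suc r + Suc t = n + 2" by (simp add: n_def)
    have "- (q ^ m1 * omega ^ 0) * - (q ^ m2 * omega ^ 1) * - (q ^ m3 * omega ^ 2) = - (q ^ (m1 + m2 + m3) * omega ^ 3)"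
      by (simp add: power_add power3_eq_cube power2_eq_square mult_ac)
    also have "\<dots> = - (q ^ 3)" by (simp add: that omega_cube)
    finally have z: "- (q ^ m1 * omega ^ 0) * - (q ^ m2 * omega ^ 1) * - (q ^ m3 * omega ^ 2) = - (q ^ 3)" .
    have nz: "- (q ^ m * omega ^ i) \<noteq> 0" for m i using q_nonzero omega_nonzero by simp
    have "f m1 m2 m3 = (\<lambda>(a, b). (- (q ^ m1 * omega ^ 0)) powi (- a) * (- (q ^ m2 * omega ^ 1)) powi (- b) * (- (q ^ m3 * omega ^ 2)) powi (a + b)
       * q powi (a^2 + a * b + b^2) * kernel (int (Suc r)) (int (Suc t)) a b)"
      unfolding f_def omega_power_combine[OF that] by (intro ext) (auto simp: mult_ac add_ac)
    then have fe: "f m1 m2 m3 = (\<lambda>(a, b). (- (q ^ m1 * omega ^ 0)) powi (- a) * (- (q ^ m2 * omega ^ 1)) powi (- b) * (- (q ^ m3 * omega ^ 2)) powi (a + b)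
       * q powi (a^2 + a * b + b^2) * kernel (int (Suc r)) (int (Suc t)) a b)" .
    show ?thesis unfolding fe
      using has_sum_kernel[OF nz nz nz, of m1 0 m2 1 m3 2 "Suc r" "Suc t"] unfolding z N P_def D_def .
  qed
  have has_sum_diff: "((\<lambda>x. u x - v x) has_sum s - t) UNIV"
    if "(u has_sum s) UNIV" "(v has_sum t) UNIV" for u v :: "int \<times> int \<Rightarrow> complex" and s t
    using has_sum_add[OF that(1) has_sum_uminusI[OF that(2)]] by simp
  have distrib: "w * ((A + B + C - A' - B' - C') * K)
      = w * (A * K) + w * (B * K) + w * (C * K) - (w * (A' * K) + w * (B' * K) + w * (C' * K))"
    for w A B C A' B' C' K :: complex by (simp add: algebra_simps)
  define g where "g = (\<lambda>(a, b). omega powi (b - a) * q powi (a^2 + a * b + b^2) * alt_kernel (int r) (int t) a b)"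
  have g: "g = (\<lambda>x. f 2 1 0 x + f 1 0 2 x + f 0 2 1 x - (f 1 2 0 x + f 2 0 1 x + f 0 1 2 x))"
  proof
    fix x :: "int \<times> int"
    obtain a b where x: "x = (a, b)" by force
    have e: "int 0 * (a + b) - int 2 * a - int 1 * b = - 2 * a - b" "int 2 * (a + b) - int 1 * a - int 0 * b = a + 2 * b"
      "int 1 * (a + b) - int 0 * a - int 2 * b = a - b" "int 0 * (a + b) - int 1 * a - int 2 * b = - a - 2 * b"
      "int 1 * (a + b) - int 2 * a - int 0 * b = b - a" "int 2 * (a + b) - int 0 * a - int 1 * b = 2 * a + b"
      by simp_all
    show "g x = f 2 1 0 x + f 1 0 2 x + f 0 2 1 x - (f 1 2 0 x + f 2 0 1 x + f 0 1 2 x)"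
      unfolding x g_def f_def case_prod_conv e alt_kernel_def alt_def by (rule distrib)
  qed
  have "(g has_sum (coeff (P 2 0 * P 1 1 * P 0 2) (3 * Suc r) / D + coeff (P 1 0 * P 0 1 * P 2 2) (3 * Suc r) / D
     + coeff (P 0 0 * P 2 1 * P 1 2) (3 * Suc r) / D - (coeff (P 1 0 * P 2 1 * P 0 2) (3 * Suc r) / D
     + coeff (P 2 0 * P 0 1 * P 1 2) (3 * Suc r) / D + coeff (P 0 0 * P 1 1 * P 2 2) (3 * Suc r) / D))) UNIV" (is "(g has_sum ?s) _")
    unfolding g by (intro has_sum_diff has_sum_add f) simp_all
  also have "?s = - coeff (P 0 0 * P 1 1 * P 2 2 + P 1 0 * P 2 1 * P 0 2 + P 2 0 * P 0 1 * P 1 2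
       - P 1 0 * P 0 1 * P 2 2 - P 0 0 * P 2 1 * P 1 2 - P 2 0 * P 1 1 * P 0 2) (3 * Suc r) / D"
    by (simp add: diff_divide_distrib add_divide_distrib)
  also have "\<dots> = - coeff ((\<Prod>j<n. [:1, 0, 0, - (q ^ 6) * (q ^ 3) ^ j:])
       * [:0, 0, 0, q ^ 2 * (1 - q ^ (n + 2)) ^ 2 * (1 - q ^ (n + 1)) * (3 * (omega ^ 2 - omega)):]) (3 * Suc r) / D"
    unfolding P_def det_q_products ..
  also have "\<dots> = - (q ^ 2 * (1 - q ^ (n + 2)) ^ 2 * (1 - q ^ (n + 1)) * (3 * (omega ^ 2 - omega)))
       * coeff (\<Prod>j<n. [:1, - (q ^ 6) * (q ^ 3) ^ j:]) r / D"
    unfolding coeff_cube_shift coeff_prod_cube by simp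
  also have "coeff (\<Prod>j<n. [:1, - (q ^ 6) * (q ^ 3) ^ j:]) r = (- (q ^ 6)) ^ r * (q ^ 3) ^ (r choose 2)
       * (qpoch (q^3) (q^3) n * inv_qpoch (q^3) (q^3) (int r) * inv_qpoch (q^3) (q^3) (int n - int r))"
  proof -
    have "nome (q ^ 3)"
      using q_nonzero norm_q by unfold_locales (auto simp: norm_power power_less_one_iff)
    then show ?thesis by (rule nome.q_binomial)
  qed
  also have "- (q ^ 2 * (1 - q ^ (n + 2)) ^ 2 * (1 - q ^ (n + 1)) * (3 * (omega ^ 2 - omega))) * \<dots> / D = 3 * (omega ^ 2 - omega) / q * seed r t"
  proof -
    have choose: "(Suc r choose 2) = r + (r choose 2)" by (simp add: numeral_2_eq_2)
    have "D = - (q ^ 3) * ((- (q ^ 6)) ^ r * (q ^ 3) ^ (r choose 2)) * qpoch q q (n + 2) ^ 2"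
    proof -
      have "- (q ^ 3) * q ^ 3 = - (q ^ 6)" by (simp flip: power_add)
      then have e1: "(- (q ^ 3)) ^ r * (q ^ 3) ^ r = (- (q ^ 6)) ^ r" by (simp only: power_mult_distrib[symmetric])
      have e2: "q ^ (3 * (Suc r choose 2)) = (q ^ 3) ^ r * (q ^ 3) ^ (r choose 2)"
        unfolding choose by (simp add: power_add power_mult distrib_left)
      have "D = - (q ^ 3) * ((- (q ^ 3)) ^ r * (q ^ 3) ^ r * (q ^ 3) ^ (r choose 2)) * qpoch q q (n + 2) ^ 2"
        unfolding D_def power_Suc e2 by (simp only: mult_ac)
      then show ?thesis unfolding e1 .
    qed
    moreover have "qpoch q q (n + 2) = (1 - q ^ (n + 2)) * ((1 - q ^ (n + 1)) * qpoch q q n)"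
      by (simp add: qpoch_Suc)
    moreover have "seed r t = qpoch (q^3) (q^3) n * inv_qpoch (q^3) (q^3) (int r) * inv_qpoch (q^3) (q^3) (int n - int r)
        / ((1 - q ^ (n + 1)) * qpoch q q n * qpoch q q n)"
    proof -
      have "h (int n + 1) = 1 / ((1 - q ^ (n + 1)) * qpoch q q n)" "h (int n) = 1 / qpoch q q n"
        using qpoch_Suc[of n] by (simp_all add: inv_qpoch_def nat_add_distrib)
      moreover have t: "int t = int n - int r" by (simp add: n_def)
      ultimately show ?thesis unfolding seed_def n_def[symmetric] t by simp
    qed
    moreover have "- (q ^ 2 * A ^ 2 * B * v) * (X * S) / (- (q ^ 3) * X * (A * (B * F)) ^ 2) = v / q * (S / (B * F * F))"
      if "A \<noteq> 0" "B \<noteq> 0" "F \<noteq> 0" "X \<noteq> 0" for A B F X S v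
      using that q_nonzero by (simp add: field_simps power2_eq_square power3_eq_cube)
    moreover have "(- (q ^ 6)) ^ r * (q ^ 3) ^ (r choose 2) \<noteq> 0" using q_nonzero by simp
    ultimately show ?thesis
      using qpoch_nonzero[of n] one_minus_power_nonzero[of "n + 1"] one_minus_power_nonzero[of "n + 2"]
      by (simp only: mult.assoc) simp
  qed
  finally show ?thesis unfolding g_def .
qed

end

section \<open>The Jacobi triple product\<close>

text \<open>By the Weierstrass test the finite partial sums converge uniformly in \<open>n\<close>,
  so the two limits may be exchanged.\<close>

lemma tannery_tendsto:
  fixes f :: "nat \<Rightarrow> 'a \<Rightarrow> complex"
  assumes bound: "\<And>n x. x \<in> A \<Longrightarrow> norm (f n x) \<le> g x" and g: "g summable_on A"
    and S: "\<And>n. (f n has_sum S n) A" and F: "\<And>x. x \<in> A \<Longrightarrow> (\<lambda>n. f n x) \<longlonglongrightarrow> F x"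
    and L: "(F has_sum L) A"
  shows "S \<longlonglongrightarrow> L"
proof -
  have U: "uniform_limit UNIV (\<lambda>X n. \<Sum>x\<in>X. f n x) S (finite_subsets_at_top A)"
    by (rule Weierstrass_m_test_general'[where M = g]) (use bound g S in auto)
  show ?thesis
  proof (rule swap_uniform_limit'[OF _ _ U])
    show "\<forall>\<^sub>F X in finite_subsets_at_top A. (\<lambda>n. \<Sum>x\<in>X. f n x) \<longlonglongrightarrow> (\<Sum>x\<in>X. F x)"
      by (rule eventually_finite_subsets_at_top_weakI) (auto intro!: tendsto_sum F)
    show "((\<lambda>X. \<Sum>x\<in>X. F x) \<longlongrightarrow> L) (finite_subsets_at_top A)"
      using L by (simp add: has_sum_def)
  qed auto
qed

text \<open>The converse use: the limit of the sums is known and evaluates the limiting series,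
  which the bound shows to be summable.\<close>

lemma tannery_has_sum:
  fixes f :: "nat \<Rightarrow> 'a \<Rightarrow> complex"
  assumes bound: "\<And>n x. x \<in> A \<Longrightarrow> norm (f n x) \<le> g x" and g: "g summable_on A"
    and S: "\<And>n. (f n has_sum S n) A" and F: "\<And>x. x \<in> A \<Longrightarrow> (\<lambda>n. f n x) \<longlonglongrightarrow> F x"
    and L: "S \<longlonglongrightarrow> L"
  shows "(F has_sum L) A"
proof -
  have "norm (F x) \<le> g x" if "x \<in> A" for x
    by (rule LIMSEQ_le_const2[OF tendsto_norm[OF F[OF that]]]) (use bound[OF that] in auto)
  then have "(\<lambda>x. norm (F x)) summable_on A"
    by (rule Infinite_Sum.abs_summable_on_comparison_test'[OF g])
  then have FS: "(F has_sum infsum F A) A"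
    by (rule has_sum_infsum[OF abs_summable_summable])
  have "S \<longlonglongrightarrow> infsum F A" by (rule tannery_tendsto[OF bound g S F FS])
  then have "L = infsum F A" using L by (rule LIMSEQ_unique[rotated])
  then show ?thesis using FS by simp
qed

lemma has_sum_Times:
  fixes f :: "'a \<Rightarrow> complex" and g :: "'b \<Rightarrow> complex"
  assumes "(f has_sum S) A" "(g has_sum T) B"
  shows "((\<lambda>(x, y). f x * g y) has_sum (S * T)) (A \<times> B)"
proof (rule has_sum_SigmaI)
  have f: "(\<lambda>x. norm (f x)) summable_on A" and g: "(\<lambda>y. norm (g y)) summable_on B"
    using assms[THEN has_sum_imp_summable] by (simp_all only: summable_on_iff_abs_summable_on_complex)
  have "(\<lambda>z. norm (case z of (x, y) \<Rightarrow> f x * g y)) summable_on A \<times> B"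
    unfolding Infinite_Sum.abs_summable_on_Sigma_iff
  proof (intro conjI ballI)
    show "(\<lambda>y. norm (case (x, y) of (x, y) \<Rightarrow> f x * g y)) summable_on B" for x
      using g by (simp add: norm_mult summable_on_cmult_right)
    show "(\<lambda>x. norm (\<Sum>\<^sub>\<infinity>y\<in>B. norm (case (x, y) of (x, y) \<Rightarrow> f x * g y))) summable_on A"
      using f by (simp add: norm_mult infsum_cmult_right' abs_mult summable_on_cmult_left)
  qed
  then show "(\<lambda>(x, y). f x * g y) summable_on A \<times> B" by (rule abs_summable_summable)
  show "((\<lambda>y. case (x, y) of (x, y) \<Rightarrow> f x * g y) has_sum f x * T) B" for x
    using assms(2) by (auto intro: has_sum_cmult_right)
  show "((\<lambda>x. f x * T) has_sum S * T) A"
    using assms(1) by (rule has_sum_cmult_left)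
qed

lemma summable_on_geometric_int:
  fixes \<rho> :: real
  assumes "0 \<le> \<rho>" "\<rho> < 1"
  shows "(\<lambda>s::int. \<rho> ^ nat \<bar>s\<bar>) summable_on UNIV"
proof -
  have geo: "(\<lambda>n::nat. \<rho> ^ n) summable_on UNIV"
    using assms by (intro norm_summable_imp_summable_on) (simp add: summable_geometric)
  have "(\<lambda>s::int. \<rho> ^ nat \<bar>s\<bar>) summable_on (range int)"
    by (subst summable_on_reindex) (use geo in \<open>auto simp: o_def inj_on_def\<close>)
  moreover have "(\<lambda>s::int. \<rho> ^ nat \<bar>s\<bar>) summable_on (range (\<lambda>n. - int n))"
    by (subst summable_on_reindex) (use geo in \<open>auto simp: o_def inj_on_def\<close>)
  ultimately have "(\<lambda>s::int. \<rho> ^ nat \<bar>s\<bar>) summable_on (range int \<union> range (\<lambda>n. - int n))"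
    by (rule summable_on_union)
  also have "range int \<union> range (\<lambda>n. - int n) = UNIV"
  proof -
    have "s \<in> range int \<union> range (\<lambda>n. - int n)" for s
      by (cases s rule: int_cases2) auto
    then show ?thesis by auto
  qed
  finally show ?thesis .
qed

lemma summable_on_geometric_int2:
  fixes \<rho> :: real
  assumes "0 \<le> \<rho>" "\<rho> < 1"
  shows "(\<lambda>(a::int, b::int). \<rho> ^ nat \<bar>a\<bar> * \<rho> ^ nat \<bar>b\<bar>) summable_on UNIV"
proof -
  let ?g = "\<lambda>s::int. \<rho> ^ nat \<bar>s\<bar>"
  have g: "(?g has_sum infsum ?g UNIV) UNIV"
    by (rule has_sum_infsum[OF summable_on_geometric_int[OF assms]])
  have "(\<lambda>x. case x of (a, b) \<Rightarrow> ?g a * ?g b) summable_on UNIV \<times> UNIV"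
  proof (rule summable_on_SigmaI)
    show "((\<lambda>b. case (a, b) of (a, b) \<Rightarrow> ?g a * ?g b) has_sum ?g a * infsum ?g UNIV) UNIV" for a
      using has_sum_cmult_right[OF g, of "?g a"] by simp
    show "(\<lambda>a. ?g a * infsum ?g UNIV) summable_on UNIV"
      using has_sum_cmult_left[OF g] by (rule has_sum_imp_summable)
  qed (use assms in auto)
  then show ?thesis by simp
qed

section \<open>Infinite q-products as limits\<close>

lemma has_prod_qpoch:
  assumes "norm p < 1"
  shows "(\<lambda>j. 1 - x * p ^ j) has_prod qpoch_inf x p"
proof -
  have "summable (\<lambda>j. norm (1 - x * p ^ j - 1))"
    using assms by (simp add: norm_mult norm_power summable_mult summable_geometric)
  then have "convergent_prod (\<lambda>j. 1 - x * p ^ j)"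
    by (intro abs_convergent_prod_imp_convergent_prod summable_imp_abs_convergent_prod)
  then show ?thesis unfolding qpoch_inf_def by (rule convergent_prod_has_prod)
qed

lemma qpoch_tendsto:
  "norm p < 1 \<Longrightarrow> (\<lambda>n. qpoch x p n) \<longlonglongrightarrow> qpoch_inf x p"
  unfolding qpoch_def by (rule has_prod_imp_tendsto'[OF has_prod_qpoch])

lemma prod_lessThan_add: "(\<Prod>j<m + n. f j) = (\<Prod>j<m. f j) * (\<Prod>j<n. f (m + j))"
  for f :: "nat \<Rightarrow> 'a :: comm_monoid_mult"
  by (induction n) (simp_all add: mult.assoc)

definition tri :: "int \<Rightarrow> int" where "tri s = s * (s - 1) div 2"

lemma tri: "2 * tri s = s * (s - 1)"
proof -
  have "even (s * (s - 1))" by (cases "even s") auto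
  then show ?thesis by (simp add: tri_def)
qed

context nome
begin

lemma qpoch_inf_nonzero: "qpoch_inf q q \<noteq> 0"
proof -
  have "convergent_prod (\<lambda>j. 1 - q * q ^ j)"
    using has_prod_qpoch[OF norm_q, of q] by (simp add: has_prod_iff)
  then show ?thesis unfolding qpoch_inf_def
  proof (rule prodinf_nonzero)
    show "1 - q * q ^ i \<noteq> 0" for i using one_minus_power_nonzero[of "Suc i"] by simp
  qed
qed

lemma h_nat_tendsto: "(\<lambda>n. h (int n)) \<longlonglongrightarrow> 1 / qpoch_inf q q"
  using tendsto_divide[OF tendsto_const qpoch_tendsto[OF norm_q, of q] qpoch_inf_nonzero, of 1]
  by (simp add: inv_qpoch_def)

lemma h_shift_tendsto: "(\<lambda>n. h (int n + c)) \<longlonglongrightarrow> 1 / qpoch_inf q q"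
proof -
  have "filterlim (\<lambda>n. nat (int n + c)) at_top sequentially"
    unfolding filterlim_at_top
  proof
    fix Z show "\<forall>\<^sub>F n in sequentially. Z \<le> nat (int n + c)"
      by (rule eventually_sequentiallyI[of "Z + nat \<bar>c\<bar>"]) auto
  qed
  then have "(\<lambda>n. h (int (nat (int n + c)))) \<longlonglongrightarrow> 1 / qpoch_inf q q"
    by (rule filterlim_compose[OF h_nat_tendsto])
  moreover have "\<forall>\<^sub>F n in sequentially. h (int (nat (int n + c))) = h (int n + c)"
    by (rule eventually_sequentiallyI[of "nat \<bar>c\<bar>"]) auto
  ultimately show ?thesis by (rule Lim_transform_eventually)
qed

text \<open>Both sequences converge. The common constant serves in all majorants that must not
  depend on the level.\<close>

lemma h_bounded: obtains K where "K \<ge> 1" "\<And>n. norm (h n) \<le> K" "\<And>n. norm (qpoch q q n) \<le> K"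
proof -
  have "Bseq (\<lambda>n. h (int n))" "Bseq (\<lambda>n. qpoch q q n)"
    by (rule convergent_imp_Bseq[OF convergentI[OF h_nat_tendsto]], rule convergent_imp_Bseq[OF convergentI[OF qpoch_tendsto[OF norm_q]]])
  then obtain K1 K2 where K: "\<And>n. norm (h (int n)) \<le> K1" "\<And>n. norm (qpoch q q n) \<le> K2"
    by (auto simp: Bseq_def)
  show ?thesis
  proof
    show "1 \<le> max 1 (max K1 K2)" by simp
    show "norm (h n) \<le> max 1 (max K1 K2)" for n
      using K(1)[of "nat n"] by (cases "n < 0") (auto simp: not_less)
    show "norm (qpoch q q n) \<le> max 1 (max K1 K2)" for n
      using K(2)[of n] by auto
  qed
qed

lemma norm_powi_bound:
  assumes "int (nat \<bar>a\<bar>) - C \<le> e"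
  shows "norm (q powi e) \<le> norm q powi (- C) * norm q ^ nat \<bar>a\<bar>"
proof -
  have q: "0 < norm q" using q_nonzero by simp
  have "norm (q powi e) = norm q powi e" by (simp add: norm_power_int)
  also have "\<dots> \<le> norm q powi (- C + int (nat \<bar>a\<bar>))"
    using assms norm_q q by (intro power_int_decreasing) auto
  also have "\<dots> = norm q powi (- C) * norm q ^ nat \<bar>a\<bar>"
    using q by (subst power_int_add) (auto simp: power_int_def)
  finally show ?thesis .
qed


section \<open>From the q-binomial theorem to the triple product\<close>

lemma q_binomial_sum:
  "(\<Prod>j<N. 1 + z * q ^ j) = (\<Sum>a\<le>N. z ^ a * q ^ (a choose 2) * (qpoch q q N * h (int a) * h (int N - int a)))"
proof -
  let ?p = "\<Prod>j<N. [:1, z * q ^ j:]"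
  have "degree ?p \<le> (\<Sum>j<N. degree [:1, z * q ^ j:])"
    by (rule degree_prod_sum_le[unfolded o_def]) simp
  also have "\<dots> \<le> (\<Sum>j<N. 1)" by (rule sum_mono) simp
  finally have deg: "degree ?p \<le> N" by simp
  have "(\<Prod>j<N. 1 + z * q ^ j) = poly ?p 1" by (simp add: poly_prod)
  also have "\<dots> = (\<Sum>a\<le>degree ?p. coeff ?p a)"
    by (simp add: poly_altdef)
  also have "\<dots> = (\<Sum>a\<le>N. coeff ?p a)"
    by (rule sum.mono_neutral_left) (use deg in \<open>auto intro: coeff_eq_0\<close>)
  finally show ?thesis by (simp only: q_binomial)
qed

text \<open>The q-binomial theorem with \<open>2 * N\<close> factors at
  \<open>z = - x / q^N\<close>. The upper half of the factors is \<open>(x; q)_N\<close>; the lower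
  half, read backwards, is \<open>(q / x; q)_N\<close> up to the constant \<open>C\<close>.\<close>

lemma jacobi_triple_finite:
  assumes "x \<noteq> 0"
  shows "(\<Sum>s\<in>{- int N..int N}. (- x) powi s * q powi tri s * (qpoch q q (2 * N) * h (int N + s) * h (int N - s)))
    = qpoch x q N * qpoch (q / x) q N"
proof -
  define z where "z = - x / q ^ N"
  define C where "C = (- x) ^ N * q powi (int (N choose 2) - int N * int N)"
  have x: "- x \<noteq> 0" using assms by simp
  have C: "C \<noteq> 0" using assms q_nonzero by (simp add: C_def)
  have "(\<Prod>j<2 * N. 1 + z * q ^ j) = (\<Prod>j<N. 1 + z * q ^ j) * (\<Prod>j<N. 1 + z * q ^ (N + j))"
    by (simp add: mult_2 prod_lessThan_add)
  also have "(\<Prod>j<N. 1 + z * q ^ (N + j)) = qpoch x q N"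
    using q_nonzero by (simp add: z_def qpoch_def power_add)
  also have "(\<Prod>j<N. 1 + z * q ^ j) = (\<Prod>j<N. 1 + z * q ^ (N - Suc j))"
    by (rule prod.nat_diff_reindex[symmetric])
  also have "\<dots> = (\<Prod>j<N. - x / q ^ Suc j * (1 - q / x * q ^ j))"
  proof (rule prod.cong[OF refl])
    fix j assume "j \<in> {..<N}"
    then have "N = (N - Suc j) + Suc j" by simp
    then have "q ^ N = q ^ (N - Suc j) * q ^ Suc j" by (metis power_add)
    then have zq: "z * q ^ (N - Suc j) = - (x / q ^ Suc j)"
      unfolding z_def using q_nonzero by simp
    have "x / q ^ Suc j * (q / x * q ^ j) = 1" using assms q_nonzero by simp
    moreover have "- w * (1 - u) = w * u + - w" for w u :: complex by (simp add: algebra_simps)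
    ultimately show "1 + z * q ^ (N - Suc j) = - x / q ^ Suc j * (1 - q / x * q ^ j)"
      unfolding zq minus_divide_left by (metis minus_divide_left)
  qed
  also have "\<dots> = C * qpoch (q / x) q N"
  proof -
    have "(\<Prod>j<N. q ^ Suc j) = q ^ (N + (N choose 2))"
      by (induction N) (simp_all add: numeral_2_eq_2 power_add)
    moreover have "q powi (int (N choose 2) - int N * int N) * q ^ (N + (N choose 2)) = 1"
    proof -
      have "int (N choose 2) - int N * int N + int (N + (N choose 2)) = 0"
        using int_choose_2[of N] by (simp add: algebra_simps)
      then show ?thesis unfolding powi_nat[symmetric] powi_add[symmetric] by simp
    qed
    ultimately have e: "(\<Prod>j<N. q ^ Suc j) = q ^ (N + (N choose 2))"
      "q powi (int (N choose 2) - int N * int N) = 1 / q ^ (N + (N choose 2))"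
      using q_nonzero by (simp_all only: nonzero_eq_divide_eq power_not_zero not_False_eq_True simp_thms)
    have "(\<Prod>j<N. - x / q ^ Suc j) = C"
      unfolding prod_dividef C_def e by simp
    then show ?thesis unfolding prod.distrib qpoch_def by simp
  qed
  finally have 1: "(\<Prod>j<2 * N. 1 + z * q ^ j) = C * (qpoch x q N * qpoch (q / x) q N)" by (simp only: mult_ac)
  have "(\<Prod>j<2 * N. 1 + z * q ^ j) = (\<Sum>a\<le>2 * N. z ^ a * q ^ (a choose 2) * (qpoch q q (2 * N) * h (int a) * h (int (2 * N) - int a)))"
    by (rule q_binomial_sum)
  also have "\<dots> = (\<Sum>s\<in>{- int N..int N}. C * ((- x) powi s * q powi tri s * (qpoch q q (2 * N) * h (int N + s) * h (int N - s))))"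
  proof (rule sum.reindex_bij_witness[of _ "\<lambda>s. nat (int N + s)" "\<lambda>a. int a - int N"])
    fix a assume "a \<in> {..2 * N}"
    define s where "s = int a - int N"
    have a: "int a = int N + s" by (simp add: s_def)
    have "(- x) ^ a = (- x) powi (int N + s)" unfolding a[symmetric] by simp
    also have "\<dots> = (- x) ^ N * (- x) powi s" using x by (subst power_int_add) simp_all
    finally have xa: "(- x) ^ a = (- x) ^ N * (- x) powi s" .
    have "int (a choose 2) - int N * int a = (int (N choose 2) - int N * int N) + tri s"
      using tri[of s] int_choose_2[of a] int_choose_2[of N] unfolding a by (simp add: algebra_simps)
    then have "q powi (int (a choose 2) - int N * int a) = q powi (int (N choose 2) - int N * int N) * q powi tri s"
      by (simp only: powi_add)
    moreover have "q powi (int (a choose 2) - int N * int a) = q ^ (a choose 2) / (q ^ N) ^ a"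
    proof -
      have "q powi (int N * int a) = (q ^ N) ^ a" by (simp only: power_int_mult power_int_of_nat)
      then show ?thesis using q_nonzero by (simp add: power_int_diff)
    qed
    ultimately have e: "q ^ (a choose 2) / (q ^ N) ^ a = q powi (int (N choose 2) - int N * int N) * q powi tri s" by simp
    have "z ^ a * q ^ (a choose 2) = (- x) ^ a * (q ^ (a choose 2) / (q ^ N) ^ a)" unfolding z_def power_divide by simp
    then have "z ^ a * q ^ (a choose 2) = C * ((- x) powi s * q powi tri s)"
      unfolding C_def xa e by (simp only: mult_ac)
    then have "z ^ a * q ^ (a choose 2) * (qpoch q q (2 * N) * h (int a) * h (int (2 * N) - int a))
       = C * ((- x) powi s * q powi tri s) * (qpoch q q (2 * N) * h (int a) * h (int (2 * N) - int a))" by simp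
    moreover have e2: "int (2 * N) - int a = int N - s" by (simp add: s_def)
    ultimately show "C * ((- x) powi (int a - int N) * q powi tri (int a - int N) * (qpoch q q (2 * N) * h (int N + (int a - int N)) * h (int N - (int a - int N))))
       = z ^ a * q ^ (a choose 2) * (qpoch q q (2 * N) * h (int a) * h (int (2 * N) - int a))"
      unfolding s_def[symmetric] a[symmetric] e2 by (simp only: mult_ac)
  qed auto
  finally show ?thesis using C unfolding 1 sum_distrib_left[symmetric] by simp
qed

text \<open>Writes a bound for \<open>y powi s\<close> as a power of \<open>r\<close> with exponent
  linear in \<open>|s|\<close>, to be beaten later by a quadratic exponent.\<close>

lemma powi_le_power:
  fixes y r :: real
  assumes "0 < y" "0 < r" "r < 1"
  obtains M :: int where "M \<ge> 0" "\<And>s. y powi s \<le> r powi (- M * \<bar>s\<bar>)"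
proof -
  obtain m where m: "max y (1 / y) < (1 / r) ^ m"
    using real_arch_pow[of "1 / r" "max y (1 / y)"] assms by auto
  have "y powi s \<le> r powi (- int m * \<bar>s\<bar>)" for s
  proof -
    define k where "k = nat \<bar>s\<bar>"
    have "- int m * \<bar>s\<bar> = - int (m * k)" by (simp add: k_def)
    then have "r powi (- int m * \<bar>s\<bar>) = ((1 / r) ^ m) ^ k"
      by (simp only: power_int_minus power_int_of_nat power_mult power_one_over inverse_eq_divide)
    moreover have "y powi s \<le> (max y (1 / y)) ^ k"
      unfolding k_def using assms by (auto simp: power_int_def inverse_eq_divide intro!: power_mono)
    moreover have "(max y (1 / y)) ^ k \<le> ((1 / r) ^ m) ^ k"
      using m assms by (intro power_mono) auto
    ultimately show ?thesis by simp
  qed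
  then show ?thesis using that[of "int m"] by simp
qed

lemma tri_summable:
  assumes "x \<noteq> 0"
  shows "(\<lambda>s. norm (x powi s * q powi tri s)) summable_on UNIV"
proof -
  have q: "0 < norm q" using q_nonzero by simp
  obtain M where M: "M \<ge> 0" "\<And>s. norm x powi s \<le> norm q powi (- M * \<bar>s\<bar>)"
    using powi_le_power[of "norm x" "norm q"] assms q norm_q by auto
  have bound: "norm (x powi s * q powi tri s) \<le> norm q powi (- ((M + 2)^2)) * norm q ^ nat \<bar>s\<bar>" for s
  proof -
    \<comment> \<open>The shift \<open>M + 2\<close> leaves a surplus \<open>4 * |s|\<close>, which
      pays for the linear part of \<open>tri s\<close> and for the geometric factor.\<close>
    have "0 \<le> (\<bar>s\<bar> - (M + 2)) ^ 2" by simp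
    also have "\<dots> = s * s + (M + 2)^2 - 2 * (M * \<bar>s\<bar>) - 4 * \<bar>s\<bar>"
      by (simp add: power2_eq_square algebra_simps)
    finally have 1: "2 * (M * \<bar>s\<bar>) + 4 * \<bar>s\<bar> \<le> s * s + (M + 2)^2" by simp
    have 2: "2 * tri s = s * s - s" using tri[of s] by (simp add: algebra_simps)
    have 3: "s \<le> \<bar>s\<bar>" "0 \<le> (M + 2)^2" by simp_all
    have e: "int (nat \<bar>s\<bar>) - (M + 2)^2 \<le> - M * \<bar>s\<bar> + tri s"
    proof -
      have "int (nat \<bar>s\<bar>) = \<bar>s\<bar>" by simp
      then show ?thesis using 1 2 3 unfolding minus_mult_left[symmetric] by linarith
    qed
    have "norm (x powi s * q powi tri s) \<le> norm q powi (- M * \<bar>s\<bar>) * norm q powi tri s"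
      unfolding norm_mult norm_power_int by (intro mult_right_mono M) auto
    also have "\<dots> = norm (q powi (- M * \<bar>s\<bar> + tri s))"
      unfolding norm_power_int by (rule power_int_add[symmetric]) (use q in simp)
    also have "\<dots> \<le> norm q powi (- ((M + 2)^2)) * norm q ^ nat \<bar>s\<bar>"
      by (rule norm_powi_bound[OF e])
    finally show ?thesis .
  qed
  show ?thesis
    by (rule Infinite_Sum.abs_summable_on_comparison_test'[OF _ bound])
       (intro summable_on_cmult_right summable_on_geometric_int norm_ge_zero norm_q)
qed

text \<open>Limit of the finite form: each Gaussian binomial stays bounded and tends to
  \<open>1 / (q; q)_\<infinity>\<close>.\<close>

theorem jacobi_triple_product:
  assumes "x \<noteq> 0"
  shows "((\<lambda>s. (- x) powi s * q powi tri s) has_sum (qpoch_inf x q * qpoch_inf (q / x) q * qpoch_inf q q)) UNIV"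
proof -
  define f where "f N s = (- x) powi s * q powi tri s * (qpoch q q (2 * N) * h (int N + s) * h (int N - s))" for N :: nat and s
  obtain K where K: "K \<ge> 1" "\<And>n. norm (h n) \<le> K" "\<And>n. norm (qpoch q q n) \<le> K" using h_bounded by blast
  have "((\<lambda>s. (- x) powi s * q powi tri s * (qpoch_inf q q * (1 / qpoch_inf q q) * (1 / qpoch_inf q q)))
     has_sum (qpoch_inf x q * qpoch_inf (q / x) q)) UNIV"
  proof (rule tannery_has_sum[where f = f])
    show "norm (f N s) \<le> norm ((- x) powi s * q powi tri s) * (K * K * K)" for N s
    proof -
      have "norm (qpoch q q (2 * N) * h (int N + s) * h (int N - s)) \<le> K * K * K"
        unfolding norm_mult by (intro mult_mono K) (use K(1) in auto)
      then show ?thesis unfolding f_def norm_mult[of "(- x) powi s * q powi tri s"] by (rule mult_left_mono) simp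
    qed
    show "(\<lambda>s. norm ((- x) powi s * q powi tri s) * (K * K * K)) summable_on UNIV"
      by (rule summable_on_cmult_left, rule tri_summable) (use assms in simp)
    show "(f N has_sum (qpoch x q N * qpoch (q / x) q N)) UNIV" for N
      unfolding jacobi_triple_finite[OF assms, symmetric] f_def
      by (rule has_sum_finite_neutralI[of "{- int N..int N}"]) (auto simp: not_le)
    show "(\<lambda>N. f N s) \<longlonglongrightarrow> (- x) powi s * q powi tri s * (qpoch_inf q q * (1 / qpoch_inf q q) * (1 / qpoch_inf q q))" for s
    proof -
      have "filterlim (\<lambda>N. 2 * N) at_top sequentially"
        by (rule filterlim_subseq) (simp add: strict_mono_def)
      then have "(\<lambda>N. qpoch q q (2 * N)) \<longlonglongrightarrow> qpoch_inf q q"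
        by (rule filterlim_compose[OF qpoch_tendsto[OF norm_q]])
      then show ?thesis unfolding f_def
        using h_shift_tendsto[of s] h_shift_tendsto[of "- s"] by (intro tendsto_mult tendsto_const) simp_all
    qed
    show "(\<lambda>N. qpoch x q N * qpoch (q / x) q N) \<longlonglongrightarrow> qpoch_inf x q * qpoch_inf (q / x) q"
      by (intro tendsto_mult qpoch_tendsto norm_q)
  qed
  from has_sum_cmult_left[OF this, of "qpoch_inf q q"] show ?thesis
    using qpoch_inf_nonzero by simp
qed

end

section \<open>The A2 Macdonald identity\<close>

lemma minus_one_powi: "(- 1 :: complex) powi n = (if even n then 1 else - 1)"
  by (auto simp: power_int_def even_nat_iff)

lemma has_sum_reindex_pairs:
  assumes "(H has_sum s) UNIV" "\<And>a b. fi (f a b) (g a b) = a" "\<And>a b. gi (f a b) (g a b) = b"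
    "\<And>a b. f (fi a b) (gi a b) = a" "\<And>a b. g (fi a b) (gi a b) = b"
  shows "((\<lambda>(a, b). H (f a b, g a b)) has_sum s) UNIV"
proof -
  have "bij_betw (\<lambda>(a, b). (f a b, g a b)) UNIV UNIV"
    by (rule bij_betwI[where g = "\<lambda>(a, b). (fi a b, gi a b)"]) (auto simp: assms)
  from has_sum_reindex_bij_betw[OF this, of H s] assms(1) show ?thesis by (simp add: case_prod_unfold)
qed

text \<open>The nonprincipal character modulo 3.\<close>

definition theta_sign :: "int \<Rightarrow> complex" where
  "theta_sign d = (if d mod 3 = 1 then 1 else if d mod 3 = 2 then - 1 else 0)"

context nome
begin

lemma nome_power: "n \<ge> 1 \<Longrightarrow> nome (q ^ n)"
  using q_nonzero norm_q by unfold_locales (auto simp: norm_power power_less_one_iff)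

text \<open>The triple product in base \<open>q^3\<close> at \<open>x = q\<close>: its three
  products run through the residue classes modulo 3 and merge into
  \<open>(q; q)_\<infinity>\<close>.\<close>

lemma pentagonal: "((\<lambda>c. (- 1) powi c * q powi (c + 3 * tri c)) has_sum qpoch_inf q q) UNIV"
proof -
  interpret cube: nome "q ^ 3" by (rule nome_power) simp
  have "(\<lambda>n. qpoch q (q^3) n * qpoch (q^3 / q) (q^3) n * qpoch (q^3) (q^3) n)
      \<longlonglongrightarrow> qpoch_inf q (q^3) * qpoch_inf (q^3 / q) (q^3) * qpoch_inf (q^3) (q^3)"
    by (intro tendsto_mult qpoch_tendsto cube.norm_q)
  moreover have "qpoch q (q^3) n * qpoch (q^3 / q) (q^3) n * qpoch (q^3) (q^3) n = qpoch q q (3 * n)" for n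
  proof -
    have "q ^ 3 / q = q ^ 2" using q_nonzero by (simp add: power3_eq_cube power2_eq_square)
    moreover have "qpoch q (q^3) n * qpoch (q^2) (q^3) n * qpoch (q^3) (q^3) n = qpoch q q (3 * n)"
    proof (induction n)
      case (Suc n)
      have rec: "qpoch y r (Suc n) = qpoch y r n * (1 - y * r ^ n)" for y r by (simp add: qpoch_def)
      have A: "qpoch q q (3 * Suc n) = qpoch q q (3 * n) * ((1 - q * q ^ (3 * n)) * (1 - q * q ^ (3 * n + 1)) * (1 - q * q ^ (3 * n + 2)))"
      proof -
        have "3 * Suc n = Suc (Suc (Suc (3 * n)))" by simp
        then show ?thesis by (simp add: qpoch_def del: mult_Suc_right)
      qed
      have B: "q * (q ^ 3) ^ n = q * q ^ (3 * n)" "q ^ 2 * (q ^ 3) ^ n = q * q ^ (3 * n + 1)" "q ^ 3 * (q ^ 3) ^ n = q * q ^ (3 * n + 2)"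
        by (simp_all add: power_mult power_add power3_eq_cube power2_eq_square)
      show ?case unfolding A rec B Suc[symmetric] by (simp only: mult_ac)
    qed (simp add: qpoch_def)
    ultimately show ?thesis by simp
  qed
  moreover have "(\<lambda>n. qpoch q q (3 * n)) \<longlonglongrightarrow> qpoch_inf q q"
    by (rule filterlim_compose[OF qpoch_tendsto[OF norm_q]], rule filterlim_subseq) (simp add: strict_mono_def)
  ultimately have prod: "qpoch_inf q (q^3) * qpoch_inf (q^3 / q) (q^3) * qpoch_inf (q^3) (q^3) = qpoch_inf q q"
    by (simp add: LIMSEQ_unique)
  have "(- q) powi c * (q ^ 3) powi tri c = (- 1) powi c * q powi (c + 3 * tri c)" for c
    using power_int_mult_distrib[of "- 1" q c] by (simp add: powi_add power_int_mult)
  then show ?thesis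
    using cube.jacobi_triple_product[OF q_nonzero] unfolding prod by simp
qed

text \<open>Since \<open>a^2 + b^2 \<le> 2 * Q(a, b)\<close>, completing squares in
  \<open>|a|\<close> and \<open>|b|\<close> shows that the quadratic form dominates every linear
  exponent.\<close>

lemma lattice_bound:
  assumes "x \<noteq> 0"
  obtains C where "C \<ge> 0" "\<And>a b. norm (q powi (a^2 + a * b + b^2) * x powi (A * a + B * b))
      \<le> C * (norm q ^ nat \<bar>a\<bar> * norm q ^ nat \<bar>b\<bar>)"
proof -
  have q: "0 < norm q" using q_nonzero by simp
  obtain M where M: "M \<ge> 0" "\<And>s. norm x powi s \<le> norm q powi (- M * \<bar>s\<bar>)"
    using powi_le_power[of "norm x" "norm q"] assms q norm_q by auto
  define N where "N = M * (\<bar>A\<bar> + \<bar>B\<bar>)"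
  have N: "N \<ge> 0" using M by (simp add: N_def)
  have bound: "norm (q powi (a^2 + a * b + b^2) * x powi (A * a + B * b))
      \<le> norm q powi (- ((N + 1)^2)) * (norm q ^ nat \<bar>a\<bar> * norm q ^ nat \<bar>b\<bar>)" for a b
  proof -
    have lin: "M * \<bar>A * a + B * b\<bar> \<le> N * \<bar>a\<bar> + N * \<bar>b\<bar>"
    proof -
      have "\<bar>A * a + B * b\<bar> \<le> \<bar>A\<bar> * \<bar>a\<bar> + \<bar>B\<bar> * \<bar>b\<bar>"
        using abs_triangle_ineq[of "A * a" "B * b"] by (simp add: abs_mult)
      also have "\<dots> \<le> (\<bar>A\<bar> + \<bar>B\<bar>) * \<bar>a\<bar> + (\<bar>A\<bar> + \<bar>B\<bar>) * \<bar>b\<bar>"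
        by (intro add_mono mult_right_mono) auto
      finally show ?thesis
        using M(1) by (auto simp: N_def mult.assoc simp flip: distrib_left intro!: mult_left_mono)
    qed
    have sq: "2 * (N + 1) * \<bar>s\<bar> \<le> s^2 + (N + 1)^2" for s
    proof -
      have "0 \<le> (\<bar>s\<bar> - (N + 1)) ^ 2" by simp
      also have "\<dots> = s^2 + (N + 1)^2 - 2 * (N + 1) * \<bar>s\<bar>" by (simp add: power2_diff)
      finally show ?thesis by simp
    qed
    have "0 \<le> (a + b)^2" by simp
    then have quad: "a^2 + b^2 \<le> 2 * (a^2 + a * b + b^2)" by (simp add: power2_sum)
    have e: "\<bar>a\<bar> + \<bar>b\<bar> - (N + 1)^2 \<le> a^2 + a * b + b^2 + - M * \<bar>A * a + B * b\<bar>"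
      using lin sq[of a] sq[of b] quad by (simp add: algebra_simps)
    have "norm (q powi (a^2 + a * b + b^2) * x powi (A * a + B * b))
       \<le> norm q powi (a^2 + a * b + b^2) * norm q powi (- M * \<bar>A * a + B * b\<bar>)"
      unfolding norm_mult norm_power_int by (intro mult_left_mono M) auto
    also have "\<dots> = norm q powi (a^2 + a * b + b^2 + - M * \<bar>A * a + B * b\<bar>)"
      by (rule power_int_add[symmetric]) (use q in simp)
    also have "\<dots> \<le> norm q powi (- ((N + 1)^2) + (int (nat \<bar>a\<bar>) + int (nat \<bar>b\<bar>)))"
      using e norm_q q by (intro power_int_decreasing) auto
    also have "\<dots> = norm q powi (- ((N + 1)^2)) * (norm q ^ nat \<bar>a\<bar> * norm q ^ nat \<bar>b\<bar>)"
    proof -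
      have nz: "norm q \<noteq> 0" using q by simp
      show ?thesis by (simp only: power_int_add[OF disjI1[OF nz]] power_int_of_nat)
    qed
    finally show ?thesis .
  qed
  show ?thesis by (rule that[OF _ bound]) simp
qed

lemma lattice_summable:
  assumes "x \<noteq> 0"
  shows "(\<lambda>(a, b). norm (q powi (a^2 + a * b + b^2) * x powi (A * a + B * b))) summable_on UNIV"
proof -
  obtain C where C: "\<And>a b. norm (q powi (a^2 + a * b + b^2) * x powi (A * a + B * b))
      \<le> C * (norm q ^ nat \<bar>a\<bar> * norm q ^ nat \<bar>b\<bar>)"
    using lattice_bound[OF assms, of A B] by metis
  have "(\<lambda>z. C * (case z of (a, b) \<Rightarrow> norm q ^ nat \<bar>a\<bar> * norm q ^ nat \<bar>b\<bar>)) summable_on UNIV"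
    by (intro summable_on_cmult_right summable_on_geometric_int2 norm_ge_zero norm_q)
  from Infinite_Sum.abs_summable_on_comparison_test'[OF this, of "\<lambda>(a, b). q powi (a^2 + a * b + b^2) * x powi (A * a + B * b)"]
  show ?thesis using C by (auto simp: case_prod_unfold)
qed

text \<open>Three triple products are multiplied; the resulting triple sum is grouped by the lattice
  vector \<open>(u, v)\<close>, and the remaining sum over \<open>c\<close> is a shifted pentagonal series, or cancels in
  pairs if the exponent \<open>d\<close> of \<open>x\<close> is divisible by 3.\<close>
theorem theta_product:
  assumes "x \<noteq> 0"
  shows "((\<lambda>(u, v). theta_sign (- 2 * u - v) * (x powi (- 2 * u - v) * q powi (u^2 + u * v + v^2))) has_sum
    (q / x ^ 2 * (qpoch_inf x (q^3) ^ 2 * qpoch_inf (q^3 / x) (q^3) ^ 2 * qpoch_inf (x^2) (q^3)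
      * qpoch_inf (q^3 / x^2) (q^3) * qpoch_inf (q^3) (q^3) ^ 2))) UNIV"
proof -
  define p where "p = q ^ 3"
  interpret p: nome p unfolding p_def by (rule nome_power) simp
  define J where "J x = qpoch_inf x p * qpoch_inf (p / x) p * qpoch_inf p p" for x
  define t where "t x s = (- x) powi s * p powi tri s" for x s
  have t: "(t x has_sum J x) UNIV" if "x \<noteq> 0" for x
    unfolding t_def J_def by (rule p.jacobi_triple_product[OF that])
  have x2: "x ^ 2 \<noteq> 0" using assms by simp
  have "((\<lambda>(z, c). (case z of (a, b) \<Rightarrow> t x a * t x b) * t (x^2) c) has_sum (J x * J x * J (x^2))) ((UNIV \<times> UNIV) \<times> UNIV)"
    by (intro has_sum_Times t assms x2)
  then have triple: "((\<lambda>((a, b), c). t x a * t x b * t (x^2) c) has_sum (J x * J x * J (x^2))) UNIV"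
    by (simp add: case_prod_unfold)
  \<comment> \<open>The new variables are chosen so that the total exponent of \<open>x\<close>,
    which is \<open>2 - 2 * u - v\<close>, does not involve \<open>c\<close>.\<close>
  define F where "F = (\<lambda>((u, v), c). t x (1 - u - v - c) * t x (1 - u - c) * t (x^2) c)"
  have F: "(F has_sum (J x * J x * J (x^2))) (UNIV \<times> UNIV)"
  proof -
    have "(F has_sum (J x * J x * J (x^2))) UNIV \<longleftrightarrow> ((\<lambda>((a, b), c). t x a * t x b * t (x^2) c) has_sum (J x * J x * J (x^2))) UNIV"
      by (rule has_sum_reindex_bij_witness[where i = "\<lambda>((a, b), c). ((1 - b - c, b - a), c)"
            and j = "\<lambda>((u, v), c). ((1 - u - v - c, 1 - u - c), c)"]) (auto simp: F_def)
    with triple show ?thesis by simp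
  qed
  define E where "E u v c = tri (1 - u - v - c) + tri (1 - u - c) + tri c" for u v c
  have F_eq: "F ((u, v), c) = x powi (- 2 * u - v + 2) * ((- 1) powi (v + c) * p powi E u v c)" for u v c
  proof -
    have neg: "(- y) powi s = (- 1) powi s * y powi s" for y :: complex and s
      using power_int_mult_distrib[of "- 1" y s] by simp
    have "x powi (1 - u - v - c) * x powi (1 - u - c) * (x^2) powi c = x powi ((1 - u - v - c) + (1 - u - c) + 2 * c)"
      using assms by (simp only: power_int_add power_int_mult power_int_numeral simp_thms)
    also have "(1 - u - v - c) + (1 - u - c) + 2 * c = - 2 * u - v + 2" by simp
    finally have 1: "x powi (1 - u - v - c) * x powi (1 - u - c) * (x^2) powi c = x powi (- 2 * u - v + 2)" .
    have "(- 1 :: complex) powi (1 - u - v - c) * (- 1) powi (1 - u - c) * (- 1) powi c = (- 1) powi ((1 - u - v - c) + (1 - u - c) + c)"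
      by (simp only: power_int_add neg_equal_0_iff_equal one_neq_zero simp_thms)
    also have "\<dots> = (- 1) powi (v + c)" by (simp add: minus_one_powi)
    finally have 2: "(- 1 :: complex) powi (1 - u - v - c) * (- 1) powi (1 - u - c) * (- 1) powi c = (- 1) powi (v + c)" .
    have 3: "p powi tri (1 - u - v - c) * p powi tri (1 - u - c) * p powi tri c = p powi E u v c"
      by (simp only: E_def p.powi_add)
    have "F ((u, v), c) = (x powi (1 - u - v - c) * x powi (1 - u - c) * (x^2) powi c)
      * (((- 1) powi (1 - u - v - c) * (- 1) powi (1 - u - c) * (- 1) powi c)
      * (p powi tri (1 - u - v - c) * p powi tri (1 - u - c) * p powi tri c))"
      unfolding F_def case_prod_conv t_def neg[of x] neg[of "x^2"] by (simp only: mult_ac)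
    then show ?thesis unfolding 1 2 3 .
  qed
  have inner: "((\<lambda>c. F ((u, v), c)) has_sum (theta_sign (- 2 * u - v) * (x powi (- 2 * u - v + 2) * q powi (u^2 + u * v + v^2 - 1)) * qpoch_inf p p)) UNIV"
    (is "(?f has_sum _) UNIV") for u v
  proof -
    have reflect: "bij_betw (\<lambda>c::int. k - c) UNIV UNIV" for k
      by (rule bij_betwI[where g = "\<lambda>c. k - c"]) auto
    have shift: "bij_betw (\<lambda>c::int. k + c) UNIV UNIV" for k
      by (rule bij_betwI[where g = "\<lambda>c. c - k"]) auto
    have pp: "q powi (3 * X) = p powi X" for X
      by (simp only: power_int_mult p_def power_int_numeral)
    define d where "d = - 2 * u - v"
    define m where "m = d div 3"
    have twoE: "2 * E u v c = u^2 + (u + v)^2 + d + 3 * c^2 - (2 * d + 3) * c" for c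
      using tri[of "1 - u - v - c"] tri[of "1 - u - c"] tri[of c]
      by (simp add: E_def d_def power2_eq_square algebra_simps)
    have parity: "(- 1 :: complex) powi (v + c) = (- 1) powi (d + c)" for c
      by (simp add: d_def minus_one_powi)
    have v: "v = - 2 * u - d" by (simp add: d_def)
    consider "d = 3 * m" | "d = 3 * m + 1" | "d = 3 * m + 2"
    proof -
      have "d = 3 * m \<or> d = 3 * m + 1 \<or> d = 3 * m + 2" unfolding m_def by presburger
      then show ?thesis using that by blast
    qed
    then show ?thesis
    proof cases
      case 1
      have sgn: "theta_sign (- 2 * u - v) = 0" unfolding d_def[symmetric] by (simp add: theta_sign_def 1)
      have summ: "?f summable_on UNIV"
      proof -
        have "(\<lambda>(z, c). F (z, c)) summable_on UNIV \<times> UNIV"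
          using has_sum_imp_summable[OF F] by simp
        from summable_on_SigmaD1[OF this, of "(u, v)"] show ?thesis by simp
      qed
      \<comment> \<open>As a quadratic polynomial in \<open>c\<close>, \<open>E\<close> has its
        vertex at \<open>(2 * d + 3) / 6\<close>, here \<open>m + 1 / 2\<close>. Reflection in the
        vertex fixes \<open>E\<close> and changes the sign.\<close>
      have anti: "?f (2 * m + 1 - c) = - ?f c" for c
      proof -
        have "2 * E u v (2 * m + 1 - c) = 2 * E u v c"
          unfolding twoE 1 by (simp add: power2_eq_square algebra_simps)
        then have e: "E u v (2 * m + 1 - c) = E u v c" by simp
        have "(- 1 :: complex) powi (d + (2 * m + 1 - c)) = - ((- 1) powi (d + c))"
          unfolding 1 by (simp add: minus_one_powi)
        then show ?thesis unfolding F_eq parity e by simp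
      qed
      have "(?f has_sum infsum ?f UNIV) UNIV" by (rule has_sum_infsum[OF summ])
      then have "((\<lambda>c. ?f (2 * m + 1 - c)) has_sum infsum ?f UNIV) UNIV"
        unfolding has_sum_reindex_bij_betw[OF reflect, of ?f] .
      then have "((\<lambda>c. - ?f c) has_sum infsum ?f UNIV) UNIV" unfolding anti .
      moreover have "((\<lambda>c. - ?f c) has_sum - infsum ?f UNIV) UNIV"
        by (rule has_sum_uminusI[OF has_sum_infsum[OF summ]])
      ultimately have "infsum ?f UNIV = - infsum ?f UNIV" by (rule has_sum_unique)
      then have "infsum ?f UNIV = 0" by simp
      then show ?thesis using has_sum_infsum[OF summ] unfolding sgn by simp
    next
      case 2
      have sgn: "theta_sign (- 2 * u - v) = 1" unfolding d_def[symmetric] by (simp add: theta_sign_def 2)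
      \<comment> \<open>The vertex of \<open>E\<close> is now \<open>m + 5 / 6\<close>. The
        substitution moves it to \<open>1 / 6\<close>, the vertex of the pentagonal
        exponent.\<close>
      have f: "?f (m + 1 - c) = (x powi (- 2 * u - v + 2) * q powi (u^2 + u * v + v^2 - 1)) * ((- 1) powi c * p powi (c + 3 * tri c))" for c
      proof -
        have "3 * (2 * E u v (m + 1 - c)) = 2 * (u^2 + u * v + v^2 - 1) + 6 * c + 9 * (2 * tri c)"
          unfolding twoE unfolding tri v 2 by (simp add: power2_eq_square algebra_simps)
        then have "3 * E u v (m + 1 - c) = (u^2 + u * v + v^2 - 1) + 3 * (c + 3 * tri c)" by simp
        then have "q powi (3 * E u v (m + 1 - c)) = q powi (u^2 + u * v + v^2 - 1) * q powi (3 * (c + 3 * tri c))"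
          by (simp only: powi_add)
        then have "p powi E u v (m + 1 - c) = q powi (u^2 + u * v + v^2 - 1) * p powi (c + 3 * tri c)"
          unfolding pp .
        moreover have "(- 1 :: complex) powi (d + (m + 1 - c)) = (- 1) powi c" by (simp add: 2 minus_one_powi)
        ultimately show ?thesis unfolding F_eq parity by simp
      qed
      have "((\<lambda>c. ?f (m + 1 - c)) has_sum ((x powi (- 2 * u - v + 2) * q powi (u^2 + u * v + v^2 - 1)) * qpoch_inf p p)) UNIV"
        unfolding f by (intro has_sum_cmult_right p.pentagonal)
      then show ?thesis unfolding sgn mult_1
        unfolding has_sum_reindex_bij_betw[OF reflect, of ?f] .
    next
      case 3
      have sgn: "theta_sign (- 2 * u - v) = - 1" unfolding d_def[symmetric] by (simp add: theta_sign_def 3)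
      \<comment> \<open>Here the vertex \<open>m + 7 / 6\<close> is moved to \<open>1 / 6\<close>,
        and the sign changes.\<close>
      have f: "?f (m + 1 + c) = - (x powi (- 2 * u - v + 2) * q powi (u^2 + u * v + v^2 - 1)) * ((- 1) powi c * p powi (c + 3 * tri c))" for c
      proof -
        have "3 * (2 * E u v (m + 1 + c)) = 2 * (u^2 + u * v + v^2 - 1) + 6 * c + 9 * (2 * tri c)"
          unfolding twoE unfolding tri v 3 by (simp add: power2_eq_square algebra_simps)
        then have "3 * E u v (m + 1 + c) = (u^2 + u * v + v^2 - 1) + 3 * (c + 3 * tri c)" by simp
        then have "q powi (3 * E u v (m + 1 + c)) = q powi (u^2 + u * v + v^2 - 1) * q powi (3 * (c + 3 * tri c))"
          by (simp only: powi_add)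
        then have "p powi E u v (m + 1 + c) = q powi (u^2 + u * v + v^2 - 1) * p powi (c + 3 * tri c)"
          unfolding pp .
        moreover have "(- 1 :: complex) powi (d + (m + 1 + c)) = - ((- 1) powi c)" by (simp add: 3 minus_one_powi)
        ultimately show ?thesis unfolding F_eq parity by simp
      qed
      have "((\<lambda>c. ?f (m + 1 + c)) has_sum (- (x powi (- 2 * u - v + 2) * q powi (u^2 + u * v + v^2 - 1)) * qpoch_inf p p)) UNIV"
        unfolding f by (intro has_sum_cmult_right p.pentagonal)
      then show ?thesis unfolding sgn mult_minus1
        unfolding has_sum_reindex_bij_betw[OF shift, of ?f] .
    qed
  qed
  have "((\<lambda>(u, v). theta_sign (- 2 * u - v) * (x powi (- 2 * u - v + 2) * q powi (u^2 + u * v + v^2 - 1)) * qpoch_inf p p)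
      has_sum (J x * J x * J (x^2))) UNIV"
    by (rule has_sum_Sigma'[OF F]) (use inner in auto)
  from has_sum_cmult_left[OF this, of "q / x ^ 2 / qpoch_inf p p"]
  have "((\<lambda>(u, v). theta_sign (- 2 * u - v) * (x powi (- 2 * u - v) * q powi (u^2 + u * v + v^2)))
      has_sum (J x * J x * J (x^2) * (q / x ^ 2 / qpoch_inf p p))) UNIV"
  proof (rule has_sum_cong[THEN iffD1, rotated])
    fix z :: "int \<times> int"
    obtain u v where z: "z = (u, v)" by force
    have "x powi (- 2 * u - v + 2) = x powi (- 2 * u - v) * x ^ 2"
      using assms by (subst power_int_add) simp_all
    moreover have "q powi (u^2 + u * v + v^2 - 1) = q powi (u^2 + u * v + v^2) / q"
      using q_nonzero by (simp add: power_int_diff)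
    ultimately show "(case z of (u, v) \<Rightarrow> theta_sign (- 2 * u - v) * (x powi (- 2 * u - v + 2) * q powi (u^2 + u * v + v^2 - 1)) * qpoch_inf p p) * (q / x ^ 2 / qpoch_inf p p)
      = (case z of (u, v) \<Rightarrow> theta_sign (- 2 * u - v) * (x powi (- 2 * u - v) * q powi (u^2 + u * v + v^2)))"
      using assms q_nonzero p.qpoch_inf_nonzero by (simp add: z)
  qed
  also have "J x * J x * J (x^2) * (q / x ^ 2 / qpoch_inf p p) = q / x ^ 2 * (qpoch_inf x p ^ 2 * qpoch_inf (p / x) p ^ 2 * qpoch_inf (x^2) p
      * qpoch_inf (p / x^2) p * qpoch_inf p p ^ 2)"
    unfolding J_def using p.qpoch_inf_nonzero by (simp add: power2_eq_square)
  finally show ?thesis unfolding p_def .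
qed


text \<open>Cyclic permutations of the coordinates \<open>(a, b, - a - b)\<close> fix
  \<open>omega powi (b - a)\<close> and produce the positive terms of the alternant from the first;
  transpositions invert it and produce the negative terms. So the sum is
  \<open>3 * (s1 - s2)\<close>, and the difference of the two powers of \<open>omega\<close> is the
  character in \<open>theta_product\<close>.\<close>

theorem macdonald_A2:
  assumes "x \<noteq> 0"
  shows "((\<lambda>(a, b). omega powi (b - a) * (q powi (a^2 + a * b + b^2) * alt x a b)) has_sum
    (3 * (omega^2 - omega) * (q / x ^ 2 * (qpoch_inf x (q^3) ^ 2 * qpoch_inf (q^3 / x) (q^3) ^ 2 * qpoch_inf (x^2) (q^3)
      * qpoch_inf (q^3 / x^2) (q^3) * qpoch_inf (q^3) (q^3) ^ 2)))) UNIV"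
    (is "(_ has_sum (3 * _ * ?T)) _")
proof -
  define H1 where "H1 = (\<lambda>(a, b). omega powi (b - a) * (q powi (a^2 + a * b + b^2) * x powi (- 2 * a - b)))"
  define H2 where "H2 = (\<lambda>(a, b). omega powi (a - b) * (q powi (a^2 + a * b + b^2) * x powi (- 2 * a - b)))"
  have lattice: "(\<lambda>z. norm (case z of (a, b) \<Rightarrow> q powi (a^2 + a * b + b^2) * x powi (- 2 * a - b))) summable_on UNIV"
    using lattice_summable[OF assms, of "- 2" "- 1"] by (simp add: case_prod_unfold)
  have "H1 summable_on UNIV"
    by (rule abs_summable_summable, rule Infinite_Sum.abs_summable_on_comparison_test'[OF lattice])
       (auto simp: H1_def norm_mult)
  then obtain s1 where s1: "(H1 has_sum s1) UNIV" by (auto simp: summable_on_def)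
  have "H2 summable_on UNIV"
    by (rule abs_summable_summable, rule Infinite_Sum.abs_summable_on_comparison_test'[OF lattice])
       (auto simp: H2_def norm_mult)
  then obtain s2 where s2: "(H2 has_sum s2) UNIV" by (auto simp: summable_on_def)
  have diff: "((\<lambda>z. H1 z - H2 z) has_sum (s1 - s2)) UNIV"
    using has_sum_add[OF s1 has_sum_uminusI[OF s2]] by simp
  have chi: "omega powi (b - a) - omega powi (a - b) = (omega^2 - omega) * theta_sign (- 2 * a - b)" for a b
  proof -
    define m where "m = (a - b) div 3"
    have r: "(3 * n) mod 3 = 0" "(3 * n + 1) mod 3 = 1" "(3 * n + 2) mod 3 = 2" for n :: int by simp_all
    have w: "omega powi (3 * n) = 1" "omega powi (3 * n + 1) = omega" "omega powi (3 * n + 2) = omega ^ 2" for n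
      using omega_powi_shift[of 0 n] omega_powi_shift[of 1 n] omega_powi_shift[of 2 n] by (simp_all add: add.commute)
    have "a = b + 3 * m \<or> a = b + 3 * m + 1 \<or> a = b + 3 * m + 2" unfolding m_def by presburger
    then consider "a = b + 3 * m" | "a = b + 3 * m + 1" | "a = b + 3 * m + 2" by blast
    then show ?thesis
    proof cases
      case 1
      then have e: "- 2 * a - b = 3 * (- b - 2 * m)" "b - a = 3 * (- m)" "a - b = 3 * m" by simp_all
      show ?thesis unfolding e theta_sign_def r w by simp
    next
      case 2
      then have e: "- 2 * a - b = 3 * (- b - 2 * m - 1) + 1" "b - a = 3 * (- m - 1) + 2" "a - b = 3 * m + 1" by simp_all
      show ?thesis unfolding e theta_sign_def r w by simp
    next
      case 3
      then have e: "- 2 * a - b = 3 * (- b - 2 * m - 2) + 2" "b - a = 3 * (- m - 1) + 1" "a - b = 3 * m + 2" by simp_all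
      show ?thesis unfolding e theta_sign_def r w by simp
    qed
  qed
  have "((\<lambda>z. H1 z - H2 z) has_sum ((omega^2 - omega) * ?T)) UNIV"
  proof -
    have "(\<lambda>z. H1 z - H2 z) = (\<lambda>z. (omega^2 - omega) * (case z of (u, v) \<Rightarrow> theta_sign (- 2 * u - v) * (x powi (- 2 * u - v) * q powi (u^2 + u * v + v^2))))"
    proof
      fix z :: "int \<times> int"
      obtain a b where z: "z = (a, b)" by force
      show "H1 z - H2 z = (omega^2 - omega) * (case z of (u, v) \<Rightarrow> theta_sign (- 2 * u - v) * (x powi (- 2 * u - v) * q powi (u^2 + u * v + v^2)))"
        unfolding z H1_def H2_def case_prod_conv left_diff_distrib[symmetric] chi by (simp only: mult_ac)
    qed
    then show ?thesis using has_sum_cmult_right[OF theta_product[OF assms]] by simp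
  qed
  with diff have T: "s1 - s2 = (omega^2 - omega) * ?T" by (rule has_sum_unique)
  have "((\<lambda>z. H1 z + (case z of (a, b) \<Rightarrow> H1 (- a - b, a)) + (case z of (a, b) \<Rightarrow> H1 (b, - a - b))
      + - ((case z of (a, b) \<Rightarrow> H2 (b, a)) + (case z of (a, b) \<Rightarrow> H2 (a, - a - b)) + (case z of (a, b) \<Rightarrow> H2 (- a - b, b))))
      has_sum (s1 + s1 + s1 + - (s2 + s2 + s2))) UNIV"
  proof (intro has_sum_add has_sum_uminusI s1)
    show "((\<lambda>(a, b). H1 (- a - b, a)) has_sum s1) UNIV"
      by (rule has_sum_reindex_pairs[where fi = "\<lambda>a b. b" and gi = "\<lambda>a b. - a - b", OF s1]) simp_all
    show "((\<lambda>(a, b). H1 (b, - a - b)) has_sum s1) UNIV"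
      by (rule has_sum_reindex_pairs[where fi = "\<lambda>a b. - a - b" and gi = "\<lambda>a b. a", OF s1]) simp_all
    show "((\<lambda>(a, b). H2 (b, a)) has_sum s2) UNIV"
      by (rule has_sum_reindex_pairs[where fi = "\<lambda>a b. b" and gi = "\<lambda>a b. a", OF s2]) simp_all
    show "((\<lambda>(a, b). H2 (a, - a - b)) has_sum s2) UNIV"
      by (rule has_sum_reindex_pairs[where fi = "\<lambda>a b. a" and gi = "\<lambda>a b. - a - b", OF s2]) simp_all
    show "((\<lambda>(a, b). H2 (- a - b, b)) has_sum s2) UNIV"
      by (rule has_sum_reindex_pairs[where fi = "\<lambda>a b. - a - b" and gi = "\<lambda>a b. b", OF s2]) simp_all
  qed
  moreover have "s1 + s1 + s1 + - (s2 + s2 + s2) = 3 * (omega^2 - omega) * ?T"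
  proof -
    have "s1 + s1 + s1 + - (s2 + s2 + s2) = 3 * (s1 - s2)" by simp
    then show ?thesis unfolding T by (simp only: mult.assoc)
  qed
  moreover have "(\<lambda>z. H1 z + (case z of (a, b) \<Rightarrow> H1 (- a - b, a)) + (case z of (a, b) \<Rightarrow> H1 (b, - a - b))
      + - ((case z of (a, b) \<Rightarrow> H2 (b, a)) + (case z of (a, b) \<Rightarrow> H2 (a, - a - b)) + (case z of (a, b) \<Rightarrow> H2 (- a - b, b))))
    = (\<lambda>(a, b). omega powi (b - a) * (q powi (a^2 + a * b + b^2) * alt x a b))"
  proof
    fix z :: "int \<times> int"
    obtain a b where z: "z = (a, b)" by force
    have Q: "(- a - b)^2 + (- a - b) * a + a^2 = a^2 + a * b + b^2" "b^2 + b * (- a - b) + (- a - b)^2 = a^2 + a * b + b^2"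
      "b^2 + b * a + a^2 = a^2 + a * b + b^2" "a^2 + a * (- a - b) + (- a - b)^2 = a^2 + a * b + b^2"
      "(- a - b)^2 + (- a - b) * b + b^2 = a^2 + a * b + b^2"
      by (simp_all add: power2_eq_square algebra_simps)
    have W: "omega powi (a - (- a - b)) = omega powi (b - a)" "omega powi (- a - b - b) = omega powi (b - a)"
      using omega_powi_shift[of "b - a" a] omega_powi_shift[of "b - a" "- b"] by (simp_all add: algebra_simps)
    have X: "- 2 * (- a - b) - a = a + 2 * b" "- 2 * b - (- a - b) = a - b" "- 2 * b - a = - a - 2 * b"
      "- 2 * a - (- a - b) = b - a" "- 2 * (- a - b) - b = 2 * a + b" by simp_all
    have combine: "w * (e * x1) + w * (e * x2) + w * (e * x3) + - (w * (e * x4) + w * (e * x5) + w * (e * x6))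
      = w * (e * (x1 + x2 + x3 - x4 - x5 - x6))" for w e x1 x2 x3 x4 x5 x6 :: complex
      by (simp add: algebra_simps)
    show "H1 z + (case z of (a, b) \<Rightarrow> H1 (- a - b, a)) + (case z of (a, b) \<Rightarrow> H1 (b, - a - b))
      + - ((case z of (a, b) \<Rightarrow> H2 (b, a)) + (case z of (a, b) \<Rightarrow> H2 (a, - a - b)) + (case z of (a, b) \<Rightarrow> H2 (- a - b, b)))
      = (case z of (a, b) \<Rightarrow> omega powi (b - a) * (q powi (a^2 + a * b + b^2) * alt x a b))"
      unfolding z case_prod_conv H1_def H2_def Q W X alt_def by (rule combine)
  qed
  ultimately show ?thesis by simp
qed

end

section \<open>Summation along a Bailey chain\<close>

lemma has_sum_finite_sum:
  fixes f :: "'a \<Rightarrow> 'b \<Rightarrow> 'c :: topological_comm_monoid_add"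
  assumes "finite F" "\<And>x. x \<in> F \<Longrightarrow> (f x has_sum s x) A"
  shows "((\<lambda>y. \<Sum>x\<in>F. f x y) has_sum (\<Sum>x\<in>F. s x)) A"
  using assms
proof (induction F)
  case (insert x F)
  have "((\<lambda>y. f x y + (\<Sum>x\<in>F. f x y)) has_sum (s x + (\<Sum>x\<in>F. s x))) A"
    using insert by (intro has_sum_add) auto
  then show ?case using insert by simp
qed simp

lemma summable_on_prod_PiE:
  fixes f :: "'a \<Rightarrow> 'b :: countable \<Rightarrow> real"
  assumes "finite A" "\<And>x. x \<in> A \<Longrightarrow> f x summable_on UNIV" "\<And>x y. 0 \<le> f x y"
  shows "(\<lambda>g. \<Prod>x\<in>A. f x (g x)) summable_on (PiE A (\<lambda>_. UNIV))"
proof -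
  have "Infinite_Set_Sum.abs_summable_on (\<lambda>g. \<Prod>x\<in>A. f x (g x)) (PiE A (\<lambda>_. UNIV))"
  proof (rule abs_summable_on_prod_PiE[OF assms(1)])
    fix x assume "x \<in> A"
    then have "(\<lambda>y. norm (f x y)) summable_on UNIV" using assms(2)[of x] assms(3) by simp
    then show "Infinite_Set_Sum.abs_summable_on (f x) UNIV"
      by (rule abs_summable_equivalent[THEN iffD1])
  qed auto
  then have "(\<lambda>g. norm (\<Prod>x\<in>A. f x (g x))) summable_on (PiE A (\<lambda>_. UNIV))"
    by (rule abs_summable_equivalent[THEN iffD2])
  moreover have "norm (\<Prod>x\<in>A. f x (g x)) = (\<Prod>x\<in>A. f x (g x))" for g
    by (simp add: prod_nonneg assms(3))
  ultimately show ?thesis by (simp only:)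
qed

context nome
begin

section \<open>One step with a decaying weight\<close>

definition weight_bound :: "real \<Rightarrow> int \<times> int \<Rightarrow> real" where
  "weight_bound C v = C * (norm q ^ nat \<bar>fst v\<bar> * norm q ^ nat \<bar>snd v\<bar>)"

definition decaying :: "(int \<times> int \<Rightarrow> complex) \<Rightarrow> bool" where
  "decaying w \<longleftrightarrow> (\<exists>C\<ge>0. \<forall>v. norm (w v) \<le> weight_bound C v)"

text \<open>Vanishing off the quadrant makes a step a finite sum, and boundedness gives majorants. A
  step with decaying weight preserves both.\<close>

definition admissible :: "(int \<times> int \<Rightarrow> complex) \<Rightarrow> bool" where
  "admissible \<beta> \<longleftrightarrow> (\<forall>v. fst v < 0 \<or> snd v < 0 \<longrightarrow> \<beta> v = 0) \<and> (\<exists>B\<ge>0. \<forall>v. norm (\<beta> v) \<le> B)"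

definition bailey_step :: "(int \<times> int \<Rightarrow> complex) \<Rightarrow> (int \<times> int \<Rightarrow> complex) \<Rightarrow> int \<times> int \<Rightarrow> complex" where
  "bailey_step w \<beta> L = (\<Sum>r\<in>{0..fst L} \<times> {0..snd L}. w r * inv_qpoch2 q q (L - r) * \<beta> r)"

lemma summable_weight_bound: "weight_bound C summable_on UNIV"
proof -
  have "(\<lambda>v. C * (case v of (a, b) \<Rightarrow> norm q ^ nat \<bar>a\<bar> * norm q ^ nat \<bar>b\<bar>)) summable_on UNIV"
    by (intro summable_on_cmult_right summable_on_geometric_int2 norm_ge_zero norm_q)
  then show ?thesis by (simp add: weight_bound_def[abs_def] case_prod_unfold)
qed

lemma weight_bound_nonneg: "C \<ge> 0 \<Longrightarrow> 0 \<le> weight_bound C v"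
  by (simp add: weight_bound_def)

lemma inv_qpoch2_bounded: obtains K where "K \<ge> 1" "\<And>v. norm (inv_qpoch2 q q v) \<le> K"
proof -
  obtain K where K: "K \<ge> 1" "\<And>n. norm (h n) \<le> K" "\<And>n. norm (qpoch q q n) \<le> K" using h_bounded by blast
  have 1: "norm (inv_qpoch2 q q v) \<le> K * K" for v
    unfolding inv_qpoch2_def norm_mult by (intro mult_mono K) (use K(1) in auto)
  have 2: "K * K \<ge> 1" using mult_mono[of 1 K 1 K] K(1) by simp
  show ?thesis by (rule that[OF 2 1])
qed

lemma bailey_step_has_sum:
  assumes "admissible \<beta>"
  shows "((\<lambda>r. w r * inv_qpoch2 q q (L - r) * \<beta> r) has_sum bailey_step w \<beta> L) UNIV"
proof (rule has_sum_finite_neutralI)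
  show "bailey_step w \<beta> L = (\<Sum>r\<in>{0..fst L} \<times> {0..snd L}. w r * inv_qpoch2 q q (L - r) * \<beta> r)"
    by (rule bailey_step_def)
  fix r assume "r \<in> UNIV - {0..fst L} \<times> {0..snd L}"
  then have d: "(fst r < 0 \<or> snd r < 0) \<or> (fst (L - r) < 0 \<or> snd (L - r) < 0)"
    by (cases r) auto
  have A: "\<beta> r = 0" if "fst r < 0 \<or> snd r < 0"
    using assms that unfolding admissible_def by blast
  have B: "inv_qpoch2 q q (L - r) = 0" if "fst (L - r) < 0 \<or> snd (L - r) < 0"
    using that unfolding inv_qpoch2_def by (elim disjE) (simp_all only: h_neg mult_zero_left mult_zero_right)
  from d show "w r * inv_qpoch2 q q (L - r) * \<beta> r = 0"
    by (elim disjE[of "fst r < 0 \<or> snd r < 0"]) (simp_all only: A B mult_zero_left mult_zero_right)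
qed auto

lemma admissible_bailey_step:
  assumes w: "decaying w" and \<beta>: "admissible \<beta>"
  shows "admissible (bailey_step w \<beta>)"
proof -
  obtain C where C: "C \<ge> 0" "\<And>v. norm (w v) \<le> weight_bound C v" using w by (auto simp: decaying_def)
  obtain B where B: "B \<ge> 0" "\<And>v. norm (\<beta> v) \<le> B" using \<beta> by (auto simp: admissible_def)
  obtain K where K: "K \<ge> 1" "\<And>v. norm (inv_qpoch2 q q v) \<le> K" using inv_qpoch2_bounded by blast
  have summ: "(\<lambda>v. weight_bound C v * K * B) summable_on UNIV"
    by (intro summable_on_cmult_left summable_weight_bound)
  have "norm (bailey_step w \<beta> L) \<le> infsum (\<lambda>v. weight_bound C v * K * B) UNIV" for L
  proof (rule norm_infsum_le[OF bailey_step_has_sum[OF \<beta>] has_sum_infsum[OF summ]])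
    show "norm (w r * inv_qpoch2 q q (L - r) * \<beta> r) \<le> weight_bound C r * K * B" for r
      unfolding norm_mult by (intro mult_mono C K B) (use C(1) K(1) B(1) weight_bound_nonneg in auto)
  qed
  moreover have "0 \<le> infsum (\<lambda>v. weight_bound C v * K * B) UNIV"
    using C(1) K(1) B(1) by (intro infsum_nonneg mult_nonneg_nonneg weight_bound_nonneg) auto
  moreover have "bailey_step w \<beta> v = 0" if "fst v < 0 \<or> snd v < 0" for v
    using that by (auto simp: bailey_step_def)
  ultimately show ?thesis unfolding admissible_def by blast
qed

text \<open>The denominator in the step tends to the square of \<open>(q; q)_\<infinity>\<close> for
  each fixed \<open>r\<close>. Removing it in the limit multiplies by that square.\<close>

lemma weighted_sum_limit:
  assumes w: "decaying w" and \<beta>: "admissible \<beta>"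
    and lim: "(\<lambda>N. bailey_step w \<beta> (int N, int N)) \<longlonglongrightarrow> l"
  shows "((\<lambda>r. w r * \<beta> r) has_sum (l * qpoch_inf q q ^ 2)) UNIV"
proof -
  obtain C where C: "C \<ge> 0" "\<And>v. norm (w v) \<le> weight_bound C v" using w by (auto simp: decaying_def)
  obtain B where B: "B \<ge> 0" "\<And>v. norm (\<beta> v) \<le> B" using \<beta> by (auto simp: admissible_def)
  obtain K where K: "K \<ge> 1" "\<And>v. norm (inv_qpoch2 q q v) \<le> K" using inv_qpoch2_bounded by blast
  have "((\<lambda>r. w r * (1 / qpoch_inf q q * (1 / qpoch_inf q q)) * \<beta> r) has_sum l) UNIV"
  proof (rule tannery_has_sum[where f = "\<lambda>N r. w r * inv_qpoch2 q q ((int N, int N) - r) * \<beta> r"])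
    show "norm (w r * inv_qpoch2 q q ((int N, int N) - r) * \<beta> r) \<le> weight_bound C r * K * B" for N r
      unfolding norm_mult by (intro mult_mono C K B) (use C(1) K(1) B(1) weight_bound_nonneg in auto)
    show "(\<lambda>v. weight_bound C v * K * B) summable_on UNIV"
      by (intro summable_on_cmult_left summable_weight_bound)
    show "(\<lambda>N. w r * inv_qpoch2 q q ((int N, int N) - r) * \<beta> r)
        \<longlonglongrightarrow> w r * (1 / qpoch_inf q q * (1 / qpoch_inf q q)) * \<beta> r" for r
    proof -
      have "(\<lambda>N. h (int N - fst r)) \<longlonglongrightarrow> 1 / qpoch_inf q q" "(\<lambda>N. h (int N - snd r)) \<longlonglongrightarrow> 1 / qpoch_inf q q"
        using h_shift_tendsto[of "- fst r"] h_shift_tendsto[of "- snd r"] by simp_all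
      then show ?thesis unfolding inv_qpoch2_def fst_diff snd_diff fst_conv snd_conv
        by (intro tendsto_mult tendsto_const)
    qed
  qed (use bailey_step_has_sum[OF \<beta>] lim in auto)
  from has_sum_cmult_left[OF this, of "qpoch_inf q q ^ 2"] show ?thesis
    using qpoch_inf_nonzero by (simp add: power2_eq_square)
qed

section \<open>Iterated steps and the multisum\<close>

text \<open>The step with the largest index acts first: it sums the innermost variable.\<close>

fun bailey_chain :: "(nat \<Rightarrow> int \<times> int \<Rightarrow> complex) \<Rightarrow> nat \<Rightarrow> (int \<times> int \<Rightarrow> complex) \<Rightarrow> int \<times> int \<Rightarrow> complex" where
  "bailey_chain w 0 \<beta> = \<beta>"
| "bailey_chain w (Suc m) \<beta> = bailey_chain w m (bailey_step (w (Suc m)) \<beta>)"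

text \<open>There are \<open>m\<close> weights but only \<open>m - 1\<close> links, since nothing
  precedes \<open>r 1\<close>.\<close>

definition chain_term :: "(nat \<Rightarrow> int \<times> int \<Rightarrow> complex) \<Rightarrow> nat \<Rightarrow> (nat \<Rightarrow> int \<times> int) \<Rightarrow> complex" where
  "chain_term w m r = (\<Prod>j=1..m. w j (r j)) * (\<Prod>j=1..m - 1. inv_qpoch2 q q (r j - r (j + 1)))"

lemma chain_term_summable:
  assumes w: "\<And>j. decaying (w j)" and \<beta>: "admissible \<beta>"
  shows "(\<lambda>r. norm (chain_term w m r * \<beta> (r m))) summable_on ({1..m} \<rightarrow>\<^sub>E UNIV)"
proof -
  obtain C where C: "\<And>j. C j \<ge> 0" "\<And>j v. norm (w j v) \<le> weight_bound (C j) v"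
    using w unfolding decaying_def by metis
  obtain B where B: "B \<ge> 0" "\<And>v. norm (\<beta> v) \<le> B" using \<beta> by (auto simp: admissible_def)
  obtain K where K: "K \<ge> 1" "\<And>v. norm (inv_qpoch2 q q v) \<le> K" using inv_qpoch2_bounded by blast
  have "(\<lambda>r. \<Prod>j=1..m. weight_bound (C j) (r j)) summable_on ({1..m} \<rightarrow>\<^sub>E UNIV)"
    by (rule summable_on_prod_PiE) (auto intro: summable_weight_bound weight_bound_nonneg C)
  then have "(\<lambda>r. (\<Prod>j=1..m. weight_bound (C j) (r j)) * K ^ (m - 1) * B) summable_on ({1..m} \<rightarrow>\<^sub>E UNIV)"
    by (intro summable_on_cmult_left)
  then show ?thesis
  proof (rule Infinite_Sum.abs_summable_on_comparison_test')
    fix r :: "nat \<Rightarrow> int \<times> int"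
    have "(\<Prod>j=1..m. norm (w j (r j))) \<le> (\<Prod>j=1..m. weight_bound (C j) (r j))"
      by (intro prod_mono) (use C in auto)
    moreover have "(\<Prod>j=1..m - 1. norm (inv_qpoch2 q q (r j - r (j + 1)))) \<le> (\<Prod>j=1..m - 1. K)"
      by (intro prod_mono) (use K in auto)
    ultimately show "norm (chain_term w m r * \<beta> (r m)) \<le> (\<Prod>j=1..m. weight_bound (C j) (r j)) * K ^ (m - 1) * B"
      unfolding chain_term_def norm_mult prod_norm[symmetric]
      by (intro mult_mono B(2)) (use B(1) K(1) C(1) in \<open>auto intro!: prod_nonneg mult_nonneg_nonneg weight_bound_nonneg\<close>)
  qed
qed

text \<open>Summing the innermost variable replaces \<open>\<beta>\<close> by its step, which is the
  induction hypothesis for one variable less. The joint sum exists by absolute summability, and its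
  value follows by uniqueness from the iterated sum.\<close>

theorem bailey_chain_has_sum:
  assumes w: "\<And>j. decaying (w j)" and \<beta>: "admissible \<beta>" and m: "m \<ge> 1"
    and lim: "(\<lambda>N. bailey_chain w m \<beta> (int N, int N)) \<longlonglongrightarrow> l"
  shows "((\<lambda>r. chain_term w m r * \<beta> (r m)) has_sum (l * qpoch_inf q q ^ 2)) ({1..m} \<rightarrow>\<^sub>E UNIV)"
  using m \<beta> lim
proof (induction m arbitrary: \<beta> rule: nat_induct_at_least)
  case base
  have "((\<lambda>v. w 1 v * \<beta> v) has_sum (l * qpoch_inf q q ^ 2)) UNIV"
    by (rule weighted_sum_limit[OF w base(1)]) (use base(2) in simp)
  moreover have bij: "bij_betw (\<lambda>r :: nat \<Rightarrow> int \<times> int. r 1) ({1..1} \<rightarrow>\<^sub>E UNIV) (UNIV :: (int \<times> int) set)"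
  proof (rule bij_betwI[where g = "\<lambda>v. \<lambda>j\<in>{1..1::nat}. v"])
    show "(\<lambda>j\<in>{1..1}. r 1) = r" if "r \<in> {1..1} \<rightarrow>\<^sub>E UNIV" for r :: "nat \<Rightarrow> int \<times> int"
    proof
      show "(\<lambda>j\<in>{1..1}. r 1) j = r j" for j
        using PiE_arb[OF that, of j] by (cases "j = 1") auto
    qed
  qed auto
  ultimately have "((\<lambda>r :: nat \<Rightarrow> int \<times> int. w 1 (r 1) * \<beta> (r 1)) has_sum (l * qpoch_inf q q ^ 2)) ({1..1} \<rightarrow>\<^sub>E UNIV)"
    using has_sum_reindex_bij_betw[OF bij, of "\<lambda>v. w 1 v * \<beta> v"] by simp
  then show ?case by (simp add: chain_term_def)
next
  case (Suc m)
  let ?\<beta> = "bailey_step (w (Suc m)) \<beta>"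
  have adm: "admissible ?\<beta>" by (rule admissible_bailey_step[OF w Suc.prems(1)])
  have IH: "((\<lambda>r. chain_term w m r * ?\<beta> (r m)) has_sum (l * qpoch_inf q q ^ 2)) ({1..m} \<rightarrow>\<^sub>E UNIV)"
    by (rule Suc.IH[OF adm]) (use Suc.prems(2) in simp)
  define A where "A = ({1..m} \<rightarrow>\<^sub>E (UNIV :: (int \<times> int) set))"
  let ?f = "\<lambda>r. chain_term w (Suc m) r * \<beta> (r (Suc m))"
  define ext where "ext = (\<lambda>(r :: nat \<Rightarrow> int \<times> int, v :: int \<times> int). r(Suc m := v))"
  have bij: "bij_betw ext (A \<times> UNIV) ({1..Suc m} \<rightarrow>\<^sub>E UNIV)"
  proof (rule bij_betwI[where g = "\<lambda>r. (restrict r {1..m}, r (Suc m))"])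
    show "ext \<in> A \<times> UNIV \<rightarrow> ({1..Suc m} \<rightarrow>\<^sub>E UNIV)"
      by (auto simp: ext_def A_def PiE_iff extensional_def)
    show "(\<lambda>r. (restrict r {1..m}, r (Suc m))) \<in> ({1..Suc m} \<rightarrow>\<^sub>E UNIV) \<rightarrow> A \<times> UNIV"
      by (auto simp: A_def)
    show "(restrict (ext z) {1..m}, ext z (Suc m)) = z" if z: "z \<in> A \<times> UNIV" for z
    proof -
      obtain r v where z': "z = (r, v)" by (cases z)
      have "restrict (r(Suc m := v)) {1..m} = restrict r {1..m}" by (rule restrict_ext) simp
      also have "\<dots> = r" using z unfolding z' A_def by (auto intro: PiE_restrict)
      finally show ?thesis by (simp add: z' ext_def)
    qed
    show "ext (restrict r {1..m}, r (Suc m)) = r" if "r \<in> {1..Suc m} \<rightarrow>\<^sub>E UNIV" for r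
    proof
      show "ext (restrict r {1..m}, r (Suc m)) j = r j" for j
        using PiE_arb[OF that, of j] by (cases "j = Suc m") (auto simp: ext_def restrict_def)
    qed
  qed
  have split: "?f (ext (r, v)) = chain_term w m r * (w (Suc m) v * inv_qpoch2 q q (r m - v) * \<beta> v)" for r v
  proof -
    have e1: "(\<Prod>j=1..Suc m. w j (ext (r, v) j)) = (\<Prod>j=1..m. w j (r j)) * w (Suc m) v"
      by (simp add: ext_def)
    have e2: "(\<Prod>j=1..m. inv_qpoch2 q q (ext (r, v) j - ext (r, v) (j + 1)))
        = (\<Prod>j=1..m - 1. inv_qpoch2 q q (r j - r (j + 1))) * inv_qpoch2 q q (r m - v)"
    proof -
      have "prod F {1..m} = prod F {1..m - 1} * F m" for F :: "nat \<Rightarrow> complex"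
        using Suc.hyps by (cases m) auto
      moreover have "(\<Prod>j=1..m - 1. inv_qpoch2 q q (ext (r, v) j - ext (r, v) (j + 1)))
          = (\<Prod>j=1..m - 1. inv_qpoch2 q q (r j - r (j + 1)))"
        by (rule prod.cong) (auto simp: ext_def)
      moreover have "ext (r, v) m = r m" "ext (r, v) (m + 1) = v" by (simp_all add: ext_def)
      ultimately show ?thesis by (simp only:)
    qed
    have "ext (r, v) (Suc m) = v" by (simp add: ext_def)
    then show ?thesis unfolding chain_term_def diff_Suc_1 e1 e2 by (simp only: mult_ac)
  qed
  have "?f summable_on ({1..Suc m} \<rightarrow>\<^sub>E UNIV)"
    by (rule abs_summable_summable[OF chain_term_summable[OF w Suc.prems(1)]])
  then obtain S where S: "(?f has_sum S) ({1..Suc m} \<rightarrow>\<^sub>E UNIV)" by (auto simp: summable_on_def)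
  then have "((\<lambda>z. ?f (ext z)) has_sum S) (A \<times> UNIV)"
    using has_sum_reindex_bij_betw[OF bij, of ?f S] by simp
  then have "((\<lambda>r. chain_term w m r * ?\<beta> (r m)) has_sum S) A"
  proof (rule has_sum_Sigma')
    show "((\<lambda>v. ?f (ext (r, v))) has_sum chain_term w m r * ?\<beta> (r m)) UNIV" for r
      unfolding split by (rule has_sum_cmult_right[OF bailey_step_has_sum[OF Suc.prems(1)]])
  qed
  then have "S = l * qpoch_inf q q ^ 2" using IH unfolding A_def by (rule has_sum_unique)
  with S show ?case by simp
qed

end

section \<open>Kernel expansions along the chain\<close>

text \<open>The first two coordinates of the permutations of \<open>(- 1, 0, 1)\<close>, in the
  order of the terms of \<open>alt\<close>.\<close>

definition roots :: "(int \<times> int) set" where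
  "roots = {(-1, 0), (0, 1), (1, -1), (0, -1), (-1, 1), (1, 0)}"

definition root_sign :: "int \<times> int \<Rightarrow> complex" where
  "root_sign \<rho> = (if \<rho> \<in> {(-1, 0), (0, 1), (1, -1)} then 1 else - 1)"

text \<open>The inner product of the three-coordinate vectors belonging to \<open>\<rho>\<close> and
  \<open>(a, b)\<close>.\<close>

definition pairing :: "int \<times> int \<Rightarrow> int \<Rightarrow> int \<Rightarrow> int" where
  "pairing \<rho> a b = (2 * fst \<rho> + snd \<rho>) * a + (fst \<rho> + 2 * snd \<rho>) * b"

lemma sum_roots:
  fixes f :: "int \<times> int \<Rightarrow> 'a :: comm_monoid_add"
  shows "(\<Sum>\<rho>\<in>roots. f \<rho>) = f (-1, 0) + (f (0, 1) + (f (1, -1) + (f (0, -1) + (f (-1, 1) + f (1, 0)))))"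
  by (simp add: roots_def)

lemma finite_roots [simp]: "finite roots"
  by (simp add: roots_def)

lemma pairing_roots:
  "pairing (- 1, 0) a b = - 2 * a - b" "pairing (0, 1) a b = a + 2 * b" "pairing (1, - 1) a b = a - b"
  "pairing (0, - 1) a b = - a - 2 * b" "pairing (- 1, 1) a b = b - a" "pairing (1, 0) a b = 2 * a + b"
  by (simp_all add: pairing_def)

lemma alt_eq_sum: "alt x a b = (\<Sum>\<rho>\<in>roots. root_sign \<rho> * x powi pairing \<rho> a b)"
  unfolding sum_roots pairing_roots by (simp add: root_sign_def alt_def)

lemma norm_root_sign [simp]: "norm (root_sign \<rho>) = 1"
  by (simp add: root_sign_def)

text \<open>Polarization of \<open>Q\<close>, which takes the value 1 at every root.\<close>

lemma quad_shift:
  assumes "\<rho> \<in> roots"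
  shows "(a + fst \<rho>)^2 + (a + fst \<rho>) * (b + snd \<rho>) + (b + snd \<rho>)^2 = (a^2 + a * b + b^2 + 1) + pairing \<rho> a b"
  using assms by (auto simp: roots_def pairing_def power2_eq_square algebra_simps)

abbreviation quad :: "int \<times> int \<Rightarrow> int" where
  "quad z \<equiv> fst z ^ 2 + fst z * snd z + snd z ^ 2"

context nome
begin

text \<open>For finite \<open>N\<close> the six terms carry different kernels and do not form an
  alternant. Only their common limit \<open>l\<close> lets the Macdonald identity apply.\<close>

lemma alternant_limit:
  assumes x: "x \<noteq> 0"
    and S: "\<And>N. ((\<lambda>(a, b). \<Sum>\<rho>\<in>roots. root_sign \<rho> * (omega powi (b - a) * (q powi (a^2 + a * b + b^2) * x powi pairing \<rho> a b)) * \<kappa> N \<rho> a b) has_sum S N) UNIV"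
    and bound: "\<And>N \<rho> a b. norm (\<kappa> N \<rho> a b) \<le> B"
    and lim: "\<And>\<rho> a b. (\<lambda>N. \<kappa> N \<rho> a b) \<longlonglongrightarrow> l"
  shows "S \<longlonglongrightarrow> 3 * (omega^2 - omega) * (q / x ^ 2 * (qpoch_inf x (q^3) ^ 2 * qpoch_inf (q^3 / x) (q^3) ^ 2 * qpoch_inf (x^2) (q^3)
      * qpoch_inf (q^3 / x^2) (q^3) * qpoch_inf (q^3) (q^3) ^ 2)) * l"
    (is "_ \<longlonglongrightarrow> ?T * l")
proof -
  let ?e = "\<lambda>\<rho> a b. root_sign \<rho> * (omega powi (b - a) * (q powi (a^2 + a * b + b^2) * x powi pairing \<rho> a b))"
  have B: "B \<ge> 0" using bound[of 0 "(0, 0)" 0 0] norm_ge_zero order_trans by blast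
  show ?thesis
  proof (rule tannery_tendsto[OF _ _ S])
    show "norm (case z of (a, b) \<Rightarrow> \<Sum>\<rho>\<in>roots. ?e \<rho> a b * \<kappa> N \<rho> a b)
        \<le> (\<Sum>\<rho>\<in>roots. norm (case z of (a, b) \<Rightarrow> q powi (a^2 + a * b + b^2) * x powi pairing \<rho> a b) * B)" for N z
    proof -
      obtain a b where z: "z = (a, b)" by (cases z)
      have "norm (?e \<rho> a b * \<kappa> N \<rho> a b) \<le> norm (q powi (a^2 + a * b + b^2) * x powi pairing \<rho> a b) * B" for \<rho>
        unfolding norm_mult[of "?e \<rho> a b"] norm_mult[of "root_sign \<rho>"] norm_mult[of "omega powi _"]
        by (simp add: mult_left_mono bound)
      then show ?thesis unfolding z by (simp add: sum_norm_le)
    qed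
    show "(\<lambda>z. \<Sum>\<rho>\<in>roots. norm (case z of (a, b) \<Rightarrow> q powi (a^2 + a * b + b^2) * x powi pairing \<rho> a b) * B) summable_on UNIV"
    proof -
      have "(\<lambda>z. norm (case z of (a, b) \<Rightarrow> q powi (a^2 + a * b + b^2) * x powi pairing \<rho> a b) * B) summable_on UNIV" for \<rho>
        using lattice_summable[OF x, of "2 * fst \<rho> + snd \<rho>" "fst \<rho> + 2 * snd \<rho>"]
        by (intro summable_on_cmult_left) (simp add: pairing_def case_prod_unfold)
      then have "((\<lambda>z. \<Sum>\<rho>\<in>roots. norm (case z of (a, b) \<Rightarrow> q powi (a^2 + a * b + b^2) * x powi pairing \<rho> a b) * B)
         has_sum (\<Sum>\<rho>\<in>roots. infsum (\<lambda>z. norm (case z of (a, b) \<Rightarrow> q powi (a^2 + a * b + b^2) * x powi pairing \<rho> a b) * B) UNIV)) UNIV"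
        by (intro has_sum_finite_sum has_sum_infsum) simp_all
      then show ?thesis by (rule has_sum_imp_summable)
    qed
    show "(\<lambda>N. case z of (a, b) \<Rightarrow> \<Sum>\<rho>\<in>roots. ?e \<rho> a b * \<kappa> N \<rho> a b)
        \<longlonglongrightarrow> (case z of (a, b) \<Rightarrow> omega powi (b - a) * (q powi (a^2 + a * b + b^2) * alt x a b)) * l" for z
    proof -
      obtain a b where z: "z = (a, b)" by (cases z)
      have "(\<lambda>N. \<Sum>\<rho>\<in>roots. ?e \<rho> a b * \<kappa> N \<rho> a b) \<longlonglongrightarrow> (\<Sum>\<rho>\<in>roots. ?e \<rho> a b * l)"
        by (intro tendsto_sum tendsto_mult tendsto_const lim)
      also have "(\<Sum>\<rho>\<in>roots. ?e \<rho> a b * l) = omega powi (b - a) * (q powi (a^2 + a * b + b^2) * alt x a b) * l"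
        unfolding alt_eq_sum sum_distrib_left sum_distrib_right by (rule sum.cong) (simp_all only: mult_ac)
      finally show ?thesis by (simp add: z)
    qed
    show "((\<lambda>z. (case z of (a, b) \<Rightarrow> omega powi (b - a) * (q powi (a^2 + a * b + b^2) * alt x a b)) * l) has_sum ?T * l) UNIV"
      by (rule has_sum_cmult_left[OF macdonald_A2[OF x]])
  qed
qed

text \<open>The exponent 5 is six reciprocal factorials against one in the numerator.\<close>

lemma kernel_tendsto:
  "(\<lambda>N. kernel (int N + int c) (int N + int c) a b) \<longlonglongrightarrow> 1 / qpoch_inf q q ^ 5"
proof -
  have "filterlim (\<lambda>N. 2 * N + 2 * c) at_top sequentially"
    by (rule filterlim_subseq) (simp add: strict_mono_def)
  then have "(\<lambda>N. qpoch q q (2 * N + 2 * c)) \<longlonglongrightarrow> qpoch_inf q q"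
    by (rule filterlim_compose[OF qpoch_tendsto[OF norm_q]])
  moreover have "nat (int N + int c + (int N + int c)) = 2 * N + 2 * c" for N by simp
  ultimately have qf: "(\<lambda>N. qfac (int N + int c + (int N + int c))) \<longlonglongrightarrow> qpoch_inf q q" by simp
  have h: "(\<lambda>N. h (int N + int c - a)) \<longlonglongrightarrow> 1 / qpoch_inf q q" "(\<lambda>N. h (int N + int c + a)) \<longlonglongrightarrow> 1 / qpoch_inf q q" for a
    using h_shift_tendsto[of "int c - a"] h_shift_tendsto[of "int c + a"] by (simp_all add: algebra_simps)
  have h2: "(\<lambda>N. h (int N + int c + a + b)) \<longlonglongrightarrow> 1 / qpoch_inf q q" "(\<lambda>N. h (int N + int c - a - b)) \<longlonglongrightarrow> 1 / qpoch_inf q q"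
    using h(2)[of "a + b"] h(1)[of "a + b"] by (simp_all add: algebra_simps)
  have "(\<lambda>N. kernel (int N + int c) (int N + int c) a b) \<longlonglongrightarrow>
     qpoch_inf q q * (1 / qpoch_inf q q * (1 / qpoch_inf q q) * (1 / qpoch_inf q q)) * (1 / qpoch_inf q q * (1 / qpoch_inf q q) * (1 / qpoch_inf q q))"
    unfolding kernel_def by (intro tendsto_mult qf h h2)
  moreover have "qpoch_inf q q * (1 / qpoch_inf q q * (1 / qpoch_inf q q) * (1 / qpoch_inf q q)) * (1 / qpoch_inf q q * (1 / qpoch_inf q q) * (1 / qpoch_inf q q))
      = 1 / qpoch_inf q q ^ 5"
    using qpoch_inf_nonzero by (simp add: eval_nat_numeral)
  ultimately show ?thesis by (simp only:)
qed

lemma kernel_bounded: obtains B where "\<And>L M a b. norm (kernel L M a b) \<le> B"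
proof -
  obtain K where K: "K \<ge> 1" "\<And>n. norm (h n) \<le> K" "\<And>n. norm (qpoch q q n) \<le> K" using h_bounded by blast
  have "norm (kernel L M a b) \<le> K * (K * K * K) * (K * K * K)" for L M a b
    unfolding kernel_def norm_mult by (intro mult_mono K) (use K(1) in auto)
  then show ?thesis by (rule that)
qed

section \<open>The three kinds of weights\<close>

definition plain_weight :: "int \<times> int \<Rightarrow> complex" where
  "plain_weight v = q powi halfCform v"

definition linear_weight :: "int \<times> int \<Rightarrow> complex" where
  "linear_weight v = q powi (halfCform v + vabs v)"

definition transition_weight :: "int \<times> int \<Rightarrow> complex" where
  "transition_weight v = plain_weight v * (1 - q powi (vabs v + 1))"

text \<open>Negating the second coordinate turns \<open>halfCform\<close> into \<open>Q\<close>, so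
  \<open>lattice_bound\<close> applies.\<close>

lemma decaying_powi: "decaying (\<lambda>v. q powi (halfCform v + c * vabs v))"
proof -
  obtain C where C: "C \<ge> 0" "\<And>a b. norm (q powi (a^2 + a * b + b^2) * q powi (c * a + (- c) * b))
      \<le> C * (norm q ^ nat \<bar>a\<bar> * norm q ^ nat \<bar>b\<bar>)"
    using lattice_bound[OF q_nonzero, of c "- c"] by metis
  have "norm (q powi (halfCform v + c * vabs v)) \<le> weight_bound C v" for v
  proof -
    have "q powi (halfCform v + c * vabs v) = q powi (fst v^2 + fst v * (- snd v) + (- snd v)^2) * q powi (c * fst v + (- c) * (- snd v))"
      by (simp add: halfCform_def vabs_def powi_add[symmetric] algebra_simps)
    then show ?thesis using C(2)[of "fst v" "- snd v"] by (simp add: weight_bound_def)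
  qed
  then show ?thesis using C(1) unfolding decaying_def by blast
qed

lemma decaying_diff:
  assumes "decaying f" "decaying g"
  shows "decaying (\<lambda>v. f v - c * g v)"
proof -
  obtain C D where C: "C \<ge> 0" "\<And>v. norm (f v) \<le> weight_bound C v" and D: "D \<ge> 0" "\<And>v. norm (g v) \<le> weight_bound D v"
    using assms by (auto simp: decaying_def)
  have "norm (f v - c * g v) \<le> weight_bound (C + norm c * D) v" for v
  proof -
    have "norm (f v - c * g v) \<le> norm (f v) + norm c * norm (g v)"
      by (metis norm_mult norm_triangle_ineq4)
    also have "\<dots> \<le> weight_bound C v + norm c * weight_bound D v"
      by (intro add_mono mult_left_mono C D) simp
    finally show ?thesis by (simp add: weight_bound_def algebra_simps)
  qed
  moreover have "C + norm c * D \<ge> 0" using C(1) D(1) by simp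
  ultimately show ?thesis unfolding decaying_def by blast
qed

lemma decaying_plain: "decaying plain_weight"
  using decaying_powi[of 0] by (simp add: plain_weight_def[abs_def])

lemma decaying_linear: "decaying linear_weight"
  using decaying_powi[of 1] by (simp add: linear_weight_def[abs_def])

lemma decaying_transition: "decaying transition_weight"
proof -
  have "transition_weight v = plain_weight v - q * linear_weight v" for v
    by (simp add: transition_weight_def plain_weight_def linear_weight_def powi_add algebra_simps)
  then show ?thesis
    using decaying_diff[OF decaying_plain decaying_linear, of q] by (simp add: decaying_def)
qed

definition seed_vec :: "int \<times> int \<Rightarrow> complex" where
  "seed_vec v = (if fst v < 0 \<or> snd v < 0 then 0 else seed (nat (fst v)) (nat (snd v)))"

lemma seed_vec_eq:
  "seed_vec v = qpoch (q^3) (q^3) (nat (vabs v)) * inv_qpoch2 (q^3) (q^3) v * h (vabs v + 1) * h (vabs v)"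
proof (cases "fst v < 0 \<or> snd v < 0")
  case True
  then have "inv_qpoch2 (q^3) (q^3) v = 0" by (auto simp: inv_qpoch2_def inv_qpoch_def)
  with True show ?thesis by (simp add: seed_vec_def)
next
  case False
  then have "nat (fst v) + nat (snd v) = nat (vabs v)" "int (nat (vabs v)) = vabs v"
    "int (nat (fst v)) = fst v" "int (nat (snd v)) = snd v"
    by (auto simp: vabs_def nat_add_distrib)
  with False show ?thesis by (simp add: seed_vec_def seed_def inv_qpoch2_def del: int_nat_eq)
qed

lemma admissible_seed_vec: "admissible seed_vec"
proof -
  interpret cube: nome "q ^ 3" by (rule nome_power) simp
  obtain K where K: "K \<ge> 1" "\<And>n. norm (h n) \<le> K" "\<And>n. norm (qpoch q q n) \<le> K" using h_bounded by blast
  obtain K' where K': "K' \<ge> 1" "\<And>n. norm (inv_qpoch (q^3) (q^3) n) \<le> K'" "\<And>n. norm (qpoch (q^3) (q^3) n) \<le> K'"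
    using cube.h_bounded by blast
  have "norm (seed_vec v) \<le> K' * (K' * K') * K * K" for v
    unfolding seed_vec_eq inv_qpoch2_def norm_mult
    by (intro mult_mono K K') (use K(1) K'(1) in auto)
  moreover have "0 \<le> K' * (K' * K') * K * K" using K(1) K'(1) by simp
  moreover have "seed_vec v = 0" if "fst v < 0 \<or> snd v < 0" for v using that by (simp add: seed_vec_def)
  ultimately show ?thesis unfolding admissible_def by blast
qed

section \<open>How one level acts on kernel expansions\<close>

text \<open>The coefficients \<open>c z\<close> do not depend on \<open>(r, t)\<close>. So a step,
  being a finite sum, acts on the functions \<open>G\<close> alone.\<close>

lemma bailey_step_expansion:
  assumes rep: "\<And>r t. r \<ge> 0 \<Longrightarrow> t \<ge> 0 \<Longrightarrow> ((\<lambda>z. c z * G r t z) has_sum \<beta> (r, t)) UNIV"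
    and step: "\<And>z. (\<Sum>r\<in>{0..L}. \<Sum>t\<in>{0..M}. w (r, t) * h (L - r) * h (M - t) * G r t z) = G' z"
  shows "((\<lambda>z. c z * G' z) has_sum bailey_step w \<beta> (L, M)) UNIV"
proof -
  have "((\<lambda>z. \<Sum>x\<in>{0..L} \<times> {0..M}. w x * inv_qpoch2 q q ((L, M) - x) * (c z * G (fst x) (snd x) z))
     has_sum (\<Sum>x\<in>{0..L} \<times> {0..M}. w x * inv_qpoch2 q q ((L, M) - x) * \<beta> x)) UNIV"
    by (intro has_sum_finite_sum has_sum_cmult_right) (auto intro: rep)
  moreover have "(\<Sum>x\<in>{0..L} \<times> {0..M}. w x * inv_qpoch2 q q ((L, M) - x) * (c z * G (fst x) (snd x) z)) = c z * G' z" for z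
  proof -
    have "(\<Sum>x\<in>{0..L} \<times> {0..M}. w x * inv_qpoch2 q q ((L, M) - x) * (c z * G (fst x) (snd x) z))
      = (\<Sum>r\<in>{0..L}. \<Sum>t\<in>{0..M}. c z * (w (r, t) * h (L - r) * h (M - t) * G r t z))"
      unfolding sum.cartesian_product by (rule sum.cong) (auto simp: inv_qpoch2_def mult_ac)
    then show ?thesis by (simp only: sum_distrib_left[symmetric] step)
  qed
  ultimately show ?thesis by (simp add: bailey_step_def)
qed


text \<open>The inner \<open>d\<close> steps are absorbed into \<open>\<beta>'\<close>; each
  multiplies the coefficient by its eigenvalue \<open>q powi (quad z - 1)\<close>.\<close>

lemma linear_levels:
  assumes "\<And>j. m < j \<Longrightarrow> j \<le> m + d \<Longrightarrow> w j = linear_weight"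
    and "\<And>r t. r \<ge> 0 \<Longrightarrow> t \<ge> 0 \<Longrightarrow> ((\<lambda>z. c z * alt_kernel r t (fst z) (snd z)) has_sum \<beta> (r, t)) UNIV"
  shows "\<exists>\<beta>'. bailey_chain w (m + d) \<beta> = bailey_chain w m \<beta>' \<and> (\<forall>r t. r \<ge> 0 \<longrightarrow> t \<ge> 0 \<longrightarrow>
       ((\<lambda>z. c z * q powi (int d * (quad z - 1)) * alt_kernel r t (fst z) (snd z)) has_sum \<beta>' (r, t)) UNIV)"
  using assms
proof (induction d arbitrary: \<beta> c)
  case 0
  then show ?case by (intro exI[of _ \<beta>]) simp
next
  case (Suc d)
  let ?\<beta> = "bailey_step linear_weight \<beta>"
  have w: "w (Suc (m + d)) = linear_weight" using Suc.prems(1) by simp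
  have rep: "((\<lambda>z. (c z * q powi (quad z - 1)) * alt_kernel L M (fst z) (snd z)) has_sum ?\<beta> (L, M)) UNIV"
    if "L \<ge> 0" "M \<ge> 0" for L M
  proof -
    have "((\<lambda>z. c z * (q powi (quad z - 1) * alt_kernel L M (fst z) (snd z))) has_sum ?\<beta> (L, M)) UNIV"
    proof (rule bailey_step_expansion[where G = "\<lambda>r t z. alt_kernel r t (fst z) (snd z)"])
      show "((\<lambda>z. c z * alt_kernel r t (fst z) (snd z)) has_sum \<beta> (r, t)) UNIV" if "r \<ge> 0" "t \<ge> 0" for r t
        by (rule Suc.prems(2)[OF that])
      show "(\<Sum>r\<in>{0..L}. \<Sum>t\<in>{0..M}. linear_weight (r, t) * h (L - r) * h (M - t) * alt_kernel r t (fst z) (snd z))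
          = q powi (quad z - 1) * alt_kernel L M (fst z) (snd z)" for z
        using alt_kernel_step[of L M "fst z" "snd z"] that
        by (simp add: linear_weight_def halfCform_def vabs_def)
    qed
    then show ?thesis by (simp only: mult.assoc)
  qed
  have e: "c z * q powi (quad z - 1) * q powi (int d * (quad z - 1)) = c z * q powi (int (Suc d) * (quad z - 1))" for z
  proof -
    have "(quad z - 1) + int d * (quad z - 1) = int (Suc d) * (quad z - 1)" by (simp add: distrib_right)
    then show ?thesis by (simp only: mult.assoc powi_add[symmetric])
  qed
  have "w j = linear_weight" if "m < j" "j \<le> m + d" for j using Suc.prems(1) that by simp
  from Suc.IH[of "\<lambda>z. c z * q powi (quad z - 1)" ?\<beta>, OF this rep]
  show ?case unfolding e by (simp add: w)
qed

text \<open>What \<open>1 - q powi (L + M + 1)\<close> times the alternating kernel becomes after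
  \<open>n\<close> plain steps. By \<open>quad_shift\<close> each step contributes one
  \<open>quad z + 1\<close> and one more pairing.\<close>

definition shifted_kernel :: "nat \<Rightarrow> int \<times> int \<Rightarrow> int \<Rightarrow> int \<Rightarrow> complex" where
  "shifted_kernel n z L M = q powi (int n * (quad z + 1)) * (\<Sum>\<rho>\<in>roots. root_sign \<rho> *
     q powi (int (Suc n) * pairing \<rho> (fst z) (snd z)) * kernel L M (fst z + fst \<rho>) (snd z + snd \<rho>))"

lemma shifted_kernel_0:
  assumes "L \<ge> 0" "M \<ge> 0"
  shows "shifted_kernel 0 z L M = (1 - q powi (L + M + 1)) * alt_kernel L M (fst z) (snd z)"
  unfolding alt_kernel_contract[OF assms] shifted_kernel_def sum_roots
  by (simp add: pairing_roots root_sign_def)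

lemma shifted_kernel_step:
  "(\<Sum>r\<in>{0..L}. \<Sum>t\<in>{0..M}. plain_weight (r, t) * h (L - r) * h (M - t) * shifted_kernel n z r t)
     = shifted_kernel (Suc n) z L M"
proof -
  obtain a b where z: "z = (a, b)" by (cases z)
  define E where "E \<rho> = q powi (int n * (quad z + 1)) * (root_sign \<rho> * q powi (int (Suc n) * pairing \<rho> a b))" for \<rho>
  have "(\<Sum>r\<in>{0..L}. \<Sum>t\<in>{0..M}. plain_weight (r, t) * h (L - r) * h (M - t) * shifted_kernel n z r t)
    = (\<Sum>r\<in>{0..L}. \<Sum>t\<in>{0..M}. \<Sum>\<rho>\<in>roots. E \<rho> * (q powi (r^2 - r * t + t^2) * h (L - r) * h (M - t) * kernel r t (a + fst \<rho>) (b + snd \<rho>)))"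
    unfolding shifted_kernel_def sum_distrib_left z E_def
    by (intro sum.cong refl) (simp add: plain_weight_def halfCform_def mult_ac)
  also have "\<dots> = (\<Sum>r\<in>{0..L}. \<Sum>\<rho>\<in>roots. \<Sum>t\<in>{0..M}. E \<rho> * (q powi (r^2 - r * t + t^2) * h (L - r) * h (M - t) * kernel r t (a + fst \<rho>) (b + snd \<rho>)))"
    by (rule sum.cong[OF refl], rule sum.swap)
  also have "\<dots> = (\<Sum>\<rho>\<in>roots. \<Sum>r\<in>{0..L}. \<Sum>t\<in>{0..M}. E \<rho> * (q powi (r^2 - r * t + t^2) * h (L - r) * h (M - t) * kernel r t (a + fst \<rho>) (b + snd \<rho>)))"
    by (rule sum.swap)
  also have "\<dots> = (\<Sum>\<rho>\<in>roots. E \<rho> * (q powi (quad (a + fst \<rho>, b + snd \<rho>)) * kernel L M (a + fst \<rho>) (b + snd \<rho>)))"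
    unfolding sum_distrib_left[symmetric] kernel_step by simp
  also have "\<dots> = (\<Sum>\<rho>\<in>roots. q powi (int (Suc n) * (quad z + 1)) * (root_sign \<rho> *
     q powi (int (Suc (Suc n)) * pairing \<rho> a b) * kernel L M (a + fst \<rho>) (b + snd \<rho>)))"
  proof (rule sum.cong[OF refl])
    fix \<rho> assume "\<rho> \<in> roots"
    then have "quad (a + fst \<rho>, b + snd \<rho>) = (quad z + 1) + pairing \<rho> a b"
      using quad_shift[of \<rho> a b] by (simp add: z)
    then have "int n * (quad z + 1) + int (Suc n) * pairing \<rho> a b + quad (a + fst \<rho>, b + snd \<rho>)
      = int (Suc n) * (quad z + 1) + int (Suc (Suc n)) * pairing \<rho> a b"
      by (simp add: algebra_simps)
    then have e: "q powi (int n * (quad z + 1)) * q powi (int (Suc n) * pairing \<rho> a b) * q powi quad (a + fst \<rho>, b + snd \<rho>)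
      = q powi (int (Suc n) * (quad z + 1)) * q powi (int (Suc (Suc n)) * pairing \<rho> a b)"
      unfolding powi_add[symmetric] by (rule arg_cong)
    have "E \<rho> * (q powi (quad (a + fst \<rho>, b + snd \<rho>)) * kernel L M (a + fst \<rho>) (b + snd \<rho>))
      = (q powi (int n * (quad z + 1)) * q powi (int (Suc n) * pairing \<rho> a b) * q powi quad (a + fst \<rho>, b + snd \<rho>))
        * (root_sign \<rho> * kernel L M (a + fst \<rho>) (b + snd \<rho>))"
      unfolding E_def by (simp only: mult_ac)
    then show "E \<rho> * (q powi (quad (a + fst \<rho>, b + snd \<rho>)) * kernel L M (a + fst \<rho>) (b + snd \<rho>))
      = q powi (int (Suc n) * (quad z + 1)) * (root_sign \<rho> *
     q powi (int (Suc (Suc n)) * pairing \<rho> a b) * kernel L M (a + fst \<rho>) (b + snd \<rho>))"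
      unfolding e by (simp only: mult_ac)
  qed
  finally show ?thesis unfolding shifted_kernel_def sum_distrib_left z by simp
qed

text \<open>The factor \<open>1 - q^(|r| + 1)\<close> contracts the alternating kernel, and what
  remains is a plain step.\<close>

lemma transition_step:
  "(\<Sum>r\<in>{0..L}. \<Sum>t\<in>{0..M}. transition_weight (r, t) * h (L - r) * h (M - t) * alt_kernel r t (fst z) (snd z))
     = shifted_kernel 1 z L M"
proof -
  have "(\<Sum>r\<in>{0..L}. \<Sum>t\<in>{0..M}. transition_weight (r, t) * h (L - r) * h (M - t) * alt_kernel r t (fst z) (snd z))
    = (\<Sum>r\<in>{0..L}. \<Sum>t\<in>{0..M}. plain_weight (r, t) * h (L - r) * h (M - t) * shifted_kernel 0 z r t)"
    by (intro sum.cong refl) (simp add: transition_weight_def shifted_kernel_0 vabs_def mult_ac)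
  then show ?thesis using shifted_kernel_step[of L M 0 z] by simp
qed

lemma plain_levels:
  assumes "\<And>j. 1 \<le> j \<Longrightarrow> j \<le> m \<Longrightarrow> w j = plain_weight"
    and "\<And>r t. r \<ge> 0 \<Longrightarrow> t \<ge> 0 \<Longrightarrow> ((\<lambda>z. c z * shifted_kernel n z r t) has_sum \<beta> (r, t)) UNIV"
    and "r \<ge> 0" "t \<ge> 0"
  shows "((\<lambda>z. c z * shifted_kernel (n + m) z r t) has_sum bailey_chain w m \<beta> (r, t)) UNIV"
  using assms
proof (induction m arbitrary: \<beta> n r t)
  case 0
  then show ?case by simp
next
  case (Suc m)
  have w: "w (Suc m) = plain_weight" using Suc.prems(1) by simp
  have "((\<lambda>z. c z * shifted_kernel (Suc n) z L M) has_sum bailey_step plain_weight \<beta> (L, M)) UNIV" for L M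
    by (rule bailey_step_expansion[where G = "\<lambda>r t z. shifted_kernel n z r t", OF Suc.prems(2) shifted_kernel_step])
  then have "((\<lambda>z. c z * shifted_kernel (Suc n + m) z r t) has_sum bailey_chain w m (bailey_step plain_weight \<beta>) (r, t)) UNIV"
    using Suc.prems(1,3,4) by (intro Suc.IH) auto
  then show ?case by (simp add: w)
qed

end

section \<open>The identity\<close>

context nome
begin

section \<open>The chain of the theorem and its limit\<close>

text \<open>For \<open>i = 1\<close> the transition index would be 0, outside the chain, in
  accordance with reading that factor as 1. For \<open>i = k\<close> no level is linear.\<close>

definition weights :: "nat \<Rightarrow> nat \<Rightarrow> int \<times> int \<Rightarrow> complex" where
  "weights i j = (if j \<ge> i then linear_weight else if j + 1 = i then transition_weight else plain_weight)"

lemma seed_vec_expansion: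
  assumes "r \<ge> 0" "t \<ge> 0"
  shows "((\<lambda>z. q / (3 * (omega^2 - omega)) * (omega powi (snd z - fst z) * q powi quad z) * alt_kernel r t (fst z) (snd z))
    has_sum seed_vec (r, t)) UNIV"
proof -
  have "((\<lambda>(a, b). omega powi (b - a) * q powi (a^2 + a * b + b^2) * alt_kernel r t a b)
     has_sum (3 * (omega ^ 2 - omega) / q * seed (nat r) (nat t))) UNIV"
    using seed_has_sum[of "nat r" "nat t"] assms by simp
  from has_sum_cmult_right[OF this, of "q / (3 * (omega^2 - omega))"] show ?thesis
    using q_nonzero omega_diff_nonzero assms
    by (simp add: seed_vec_def case_prod_unfold mult.assoc)
qed

theorem chain_limit:
  assumes "i \<ge> 1" "i \<le> k" "k \<ge> 1"
  defines "p \<equiv> q ^ k" and "x \<equiv> q ^ i"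
  shows "(\<lambda>N. bailey_chain (weights i) (k - 1) seed_vec (int N, int N)) \<longlonglongrightarrow>
    qpoch_inf x (p^3) ^ 2 * qpoch_inf (p^3 / x) (p^3) ^ 2 * qpoch_inf (x^2) (p^3)
      * qpoch_inf (p^3 / x^2) (p^3) * qpoch_inf (p^3) (p^3) ^ 2 / qpoch_inf q q ^ 5"
    (is "_ \<longlonglongrightarrow> ?J / _")
proof -
  interpret p: nome p unfolding p_def by (rule nome_power[OF \<open>k \<ge> 1\<close>])
  define V where "V = 3 * (omega^2 - omega)"
  have V: "V \<noteq> 0" using omega_diff_nonzero by (simp add: V_def)
  have x: "x \<noteq> 0" using q_nonzero by (simp add: x_def)
  define m d where "m = i - 1" and "d = k - i"
  have md: "k - 1 = m + d" and i: "i = Suc m" and k: "int k = int m + int d + 1"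
    using assms by (simp_all add: m_def d_def)
  define c where "c z = q / V * (omega powi (snd z - fst z) * q powi quad z) * q powi (int d * (quad z - 1))" for z
  have "\<exists>\<beta>'. bailey_chain (weights i) (m + d) seed_vec = bailey_chain (weights i) m \<beta>' \<and> (\<forall>r t. r \<ge> 0 \<longrightarrow> t \<ge> 0 \<longrightarrow>
       ((\<lambda>z. c z * alt_kernel r t (fst z) (snd z)) has_sum \<beta>' (r, t)) UNIV)"
    unfolding c_def V_def by (rule linear_levels[OF _ seed_vec_expansion]) (simp_all add: weights_def i)
  then obtain \<beta> where \<beta>: "bailey_chain (weights i) (k - 1) seed_vec = bailey_chain (weights i) m \<beta>"
    "\<And>r t. r \<ge> 0 \<Longrightarrow> t \<ge> 0 \<Longrightarrow> ((\<lambda>z. c z * alt_kernel r t (fst z) (snd z)) has_sum \<beta> (r, t)) UNIV"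
    unfolding md by blast
  define S where "S N = bailey_chain (weights i) (k - 1) seed_vec (int N, int N)" for N
  \<comment> \<open>For \<open>i = 1\<close> the alternating kernels survive to the end, with index
    \<open>N + 1\<close> and no shift; otherwise the kernels sit at points shifted by roots. Both
    forms share bound and limit.\<close>
  define \<kappa> where "\<kappa> N \<rho> a b = (if m = 0 then kernel (int N + int 1) (int N + int 1) a b
     else kernel (int N + int 0) (int N + int 0) (a + fst \<rho>) (b + snd \<rho>))" for N :: nat and \<rho> a b
  have rep: "((\<lambda>z. c z * (q powi (int m * (quad z + 1)) * (\<Sum>\<rho>\<in>roots. root_sign \<rho> *
      q powi (int i * pairing \<rho> (fst z) (snd z)) * \<kappa> N \<rho> (fst z) (snd z)))) has_sum S N) UNIV" for N
  proof (cases "m = 0")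
    case True
    have "alt_kernel (int N) (int N) (fst z) (snd z) = q powi (int m * (quad z + 1)) * (\<Sum>\<rho>\<in>roots. root_sign \<rho> *
      q powi (int i * pairing \<rho> (fst z) (snd z)) * \<kappa> N \<rho> (fst z) (snd z))" for z
      unfolding alt_kernel_def alt_eq_sum sum_distrib_right by (simp add: True i \<kappa>_def)
    moreover have "S N = \<beta> (int N, int N)" unfolding S_def \<beta>(1) by (simp add: True)
    ultimately show ?thesis using \<beta>(2)[of "int N" "int N"] by simp
  next
    case False
    then obtain n where n: "m = Suc n" by (cases m) auto
    have w: "weights i m = transition_weight" by (simp add: weights_def i)
    have "((\<lambda>z. c z * shifted_kernel 1 z L M) has_sum bailey_step transition_weight \<beta> (L, M)) UNIV" for L M
      by (rule bailey_step_expansion[where G = "\<lambda>r t z. alt_kernel r t (fst z) (snd z)", OF \<beta>(2) transition_step])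
    then have "((\<lambda>z. c z * shifted_kernel (1 + n) z (int N) (int N)) has_sum bailey_chain (weights i) n (bailey_step transition_weight \<beta>) (int N, int N)) UNIV"
      by (intro plain_levels) (simp_all add: weights_def i n)
    moreover have "shifted_kernel (1 + n) z (int N) (int N) = q powi (int m * (quad z + 1)) * (\<Sum>\<rho>\<in>roots. root_sign \<rho> *
      q powi (int i * pairing \<rho> (fst z) (snd z)) * \<kappa> N \<rho> (fst z) (snd z))" for z
      unfolding shifted_kernel_def i n \<kappa>_def by simp
    moreover have "bailey_chain (weights i) n (bailey_step transition_weight \<beta>) (int N, int N) = S N"
      unfolding S_def \<beta>(1) using w by (simp add: n)
    ultimately show ?thesis by simp
  qed
  \<comment> \<open>With \<open>Q = quad z\<close> the exponents \<open>1 + Q\<close> of the seed,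
    \<open>d * (Q - 1)\<close> and \<open>m * (Q + 1)\<close> add up to
    \<open>(2 * i - k) + k * Q\<close>. The constant \<open>C\<close> keeps the part without
    \<open>Q\<close>.\<close>
  define C where "C = q powi (2 * int i - int k) / V"
  have C: "C \<noteq> 0" using V q_nonzero by (simp add: C_def)
  have coeff: "c z * (q powi (int m * (quad z + 1)) * (\<Sum>\<rho>\<in>roots. root_sign \<rho> *
      q powi (int i * pairing \<rho> (fst z) (snd z)) * \<kappa> N \<rho> (fst z) (snd z)))
    = C * (case z of (a, b) \<Rightarrow> \<Sum>\<rho>\<in>roots. root_sign \<rho> * (omega powi (b - a) * (p powi (a^2 + a * b + b^2) * x powi pairing \<rho> a b)) * \<kappa> N \<rho> a b)" for z N
  proof -
    obtain a b where z: "z = (a, b)" by (cases z)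
    define Q where "Q = a^2 + a * b + b^2"
    have "1 + Q + int d * (Q - 1) + int m * (Q + 1) = (2 * int i - int k) + int k * Q"
      unfolding k i by (simp add: algebra_simps)
    then have "q powi (1 + Q + int d * (Q - 1) + int m * (Q + 1)) = q powi (2 * int i - int k) * q powi (int k * Q)"
      by (simp only: powi_add)
    then have e: "q * q powi Q * q powi (int d * (Q - 1)) * q powi (int m * (Q + 1)) = q powi (2 * int i - int k) * p powi Q"
      by (simp only: powi_add power_int_1_right power_int_mult power_int_of_nat p_def)
    have xp: "q powi (int i * P) = x powi P" for P
      by (simp only: power_int_mult power_int_of_nat x_def)
    have "c z * (q powi (int m * (quad z + 1)) * T) = (q * q powi Q * q powi (int d * (Q - 1)) * q powi (int m * (Q + 1))) / V * (omega powi (b - a) * T)" for T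
      by (simp add: c_def z Q_def)
    then have e1: "c z * (q powi (int m * (quad z + 1)) * T) = C * (omega powi (b - a) * (p powi Q * T))" for T
      unfolding e C_def by simp
    have e2: "omega powi (b - a) * (p powi Q * (\<Sum>\<rho>\<in>roots. root_sign \<rho> * x powi pairing \<rho> a b * \<kappa> N \<rho> a b))
      = (\<Sum>\<rho>\<in>roots. root_sign \<rho> * (omega powi (b - a) * (p powi Q * x powi pairing \<rho> a b)) * \<kappa> N \<rho> a b)"
      unfolding sum_distrib_left by (rule sum.cong) (simp_all only: mult_ac)
    have fz: "fst z = a" "snd z = b" by (simp_all add: z)
    show ?thesis unfolding e1 xp unfolding fz e2 unfolding z case_prod_conv Q_def ..
  qed
  obtain B where B: "\<And>L M a b. norm (kernel L M a b) \<le> B" using kernel_bounded by blast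
  have "(\<lambda>N. S N / C) \<longlonglongrightarrow> V * (p / x ^ 2 * ?J) * (1 / qpoch_inf q q ^ 5)"
    unfolding V_def
  proof (rule p.alternant_limit[OF x, where \<kappa> = \<kappa>])
    show "((\<lambda>(a, b). \<Sum>\<rho>\<in>roots. root_sign \<rho> * (omega powi (b - a) * (p powi (a^2 + a * b + b^2) * x powi pairing \<rho> a b)) * \<kappa> N \<rho> a b)
        has_sum S N / C) UNIV" for N
      using has_sum_cmult_right[OF rep[of N, unfolded coeff], of "1 / C"] C by simp
    show "norm (\<kappa> N \<rho> a b) \<le> B" for N \<rho> a b by (cases "m = 0") (simp_all only: \<kappa>_def B if_True if_False simp_thms)
    show "(\<lambda>N. \<kappa> N \<rho> a b) \<longlonglongrightarrow> 1 / qpoch_inf q q ^ 5" for \<rho> a b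
    proof (cases "m = 0")
      case True
      then have "\<kappa> N \<rho> a b = kernel (int N + int 1) (int N + int 1) a b" for N by (simp add: \<kappa>_def)
      then show ?thesis by (simp only: kernel_tendsto)
    next
      case False
      then have "\<kappa> N \<rho> a b = kernel (int N + int 0) (int N + int 0) (a + fst \<rho>) (b + snd \<rho>)" for N by (simp add: \<kappa>_def)
      then show ?thesis by (simp only: kernel_tendsto)
    qed
  qed
  from tendsto_mult_left[OF this, of C]
  have "(\<lambda>N. C * (S N / C)) \<longlonglongrightarrow> C * (V * (p / x ^ 2 * ?J) * (1 / qpoch_inf q q ^ 5))" .
  moreover have "C * (S N / C) = S N" for N using C by simp
  moreover have "C * (V * (p / x ^ 2 * ?J) * (1 / qpoch_inf q q ^ 5)) = (C * V * p / x ^ 2) * (?J / qpoch_inf q q ^ 5)"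
    by simp
  \<comment> \<open>The constant in the Macdonald identity is exactly undone by the normalization of
    the seed and the collected power of \<open>q\<close>.\<close>
  moreover have "C * V * p / x ^ 2 = 1"
  proof -
    have "x ^ 2 = q powi int (i * 2)" "p = q powi int k"
      by (simp_all only: x_def p_def power_mult[symmetric] powi_nat)
    moreover have "2 * int i - int k + int k = int (i * 2)" by simp
    ultimately have "q powi (2 * int i - int k) * p = x ^ 2"
      by (simp only: powi_add[symmetric])
    then show ?thesis using V x by (simp add: C_def)
  qed
  ultimately show ?thesis unfolding S_def by (simp only: mult_1_left)
qed

lemma prod_powi: "finite A \<Longrightarrow> (\<Prod>j\<in>A. q powi f j) = q powi (\<Sum>j\<in>A. f j)"
  by (induction A rule: finite_induct) (simp_all add: powi_add)

lemma summand_eq_chain_term: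
  assumes "i \<ge> 1" "i \<le> k" "k \<ge> 2"
  shows "summand q k i r = chain_term (weights i) (k - 1) r * seed_vec (r (k - 1))"
proof -
  let ?I = "{1..k - 1}"
  have wt: "weights i j v = q powi halfCform v * (if j \<ge> i then q powi vabs v else 1)
      * (if j = i - 1 then 1 - q powi (vabs v + 1) else 1)" if "j \<ge> 1" for j v
    using assms that by (auto simp: weights_def linear_weight_def transition_weight_def plain_weight_def powi_add)
  have "(\<Prod>j\<in>?I. weights i j (r j)) = (\<Prod>j\<in>?I. q powi halfCform (r j) * (if j \<ge> i then q powi vabs (r j) else 1)
      * (if j = i - 1 then 1 - q powi (vabs (r j) + 1) else 1))"
    by (rule prod.cong[OF refl], rule wt) simp
  also have "\<dots> = (\<Prod>j\<in>?I. q powi halfCform (r j))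
      * (\<Prod>j\<in>?I. if j \<ge> i then q powi vabs (r j) else 1) * (\<Prod>j\<in>?I. if j = i - 1 then 1 - q powi (vabs (r j) + 1) else 1)"
    by (simp only: prod.distrib)
  also have "(\<Prod>j\<in>?I. if j \<ge> i then q powi vabs (r j) else 1) = (\<Prod>j\<in>{i..k - 1}. q powi vabs (r j))"
    by (rule prod.mono_neutral_cong_right) (use assms in auto)
  also have "(\<Prod>j\<in>?I. if j = i - 1 then 1 - q powi (vabs (r j) + 1) else 1) = (if i = 1 then 1 else 1 - q powi (vabs (r (i - 1)) + 1))"
    using assms by (auto simp: prod.delta)
  finally have "(\<Prod>j\<in>?I. weights i j (r j)) = q powi ((\<Sum>j\<in>?I. halfCform (r j)) + (\<Sum>j=i..k-1. vabs (r j)))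
     * (if i = 1 then 1 else 1 - q powi (vabs (r (i-1)) + 1))"
    by (simp add: prod_powi powi_add)
  moreover have "k - 1 - 1 = k - 2" by simp
  ultimately show ?thesis
    unfolding summand_def chain_term_def seed_vec_eq by (simp only: mult_ac)
qed

lemma decaying_weights: "decaying (weights i j)"
  by (simp add: weights_def decaying_linear decaying_transition decaying_plain)

end

section \<open>The degenerate case \<open>q = 0\<close>\<close>

text \<open>The reciprocals force every chain to decrease within the quadrant. Off the zero chain
  the positive definite form makes the exponent positive, so the power of 0 vanishes; the zero chain
  contributes \<open>0 powi 0 = 1\<close>.\<close>

lemma summand_0_has_sum:
  assumes "k \<ge> 2" "i \<ge> 1" "i \<le> k"
  shows "(summand 0 k i has_sum 1) ({1..k - 1} \<rightarrow>\<^sub>E (UNIV :: (int \<times> int) set))"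
proof -
  have qpoch_0: "qpoch 0 p n = 1" for p n by (simp add: qpoch_def)
  have inv_0: "inv_qpoch 0 p n = (if n < 0 then 0 else 1)" for p n by (simp add: inv_qpoch_def qpoch_0)
  define z0 where "z0 = (\<lambda>j\<in>{1..k - 1}. (0, 0) :: int \<times> int)"
  have zero: "summand 0 k i r = 0" if r: "r \<in> {1..k - 1} \<rightarrow>\<^sub>E UNIV" "r \<noteq> z0" for r
  proof (rule ccontr)
    assume nz: "summand 0 k i r \<noteq> 0"
    have inv2: "inv_qpoch2 0 p v \<noteq> 0 \<longleftrightarrow> fst v \<ge> 0 \<and> snd v \<ge> 0" for p v
      by (auto simp: inv_qpoch2_def inv_0)
    have "inv_qpoch2 (0 ^ 3) (0 ^ 3) (r (k - 1)) \<noteq> 0"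
    proof
      assume *: "inv_qpoch2 (0 ^ 3) (0 ^ 3) (r (k - 1)) = 0"
      show False using nz unfolding summand_def * by (simp only: mult_zero_left mult_zero_right not_True_eq_False simp_thms)
    qed
    then have last: "fst (r (k - 1)) \<ge> 0 \<and> snd (r (k - 1)) \<ge> 0"
      by (simp add: inv2)
    have prod_nz: "(\<Prod>j=1..k - 2. inv_qpoch2 0 0 (r j - r (j + 1))) \<noteq> (0::complex)"
    proof
      assume *: "(\<Prod>j=1..k - 2. inv_qpoch2 0 0 (r j - r (j + 1))) = (0::complex)"
      show False using nz unfolding summand_def * by (simp only: mult_zero_left mult_zero_right not_True_eq_False simp_thms)
    qed
    have mono: "fst (r (j + 1)) \<le> fst (r j) \<and> snd (r (j + 1)) \<le> snd (r j)" if "j \<in> {1..k - 2}" for j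
    proof -
      have "inv_qpoch2 0 0 (r j - r (j + 1)) \<noteq> 0"
        using prod_nz that by (simp only: prod_zero_iff finite_atLeastAtMost) blast
      then show ?thesis by (simp add: inv2)
    qed
    have nonneg: "fst (r j) \<ge> 0 \<and> snd (r j) \<ge> 0" if "1 \<le> j" "j \<le> k - 1" for j
      using that(2,1)
    proof (induction rule: inc_induct)
      case base
      then show ?case using last by simp
    next
      case (step n)
      then have "n \<in> {1..k - 2}" by simp
      from mono[OF this] step show ?case by simp
    qed
    have pos: "0 \<le> halfCform v" "halfCform v = 0 \<Longrightarrow> v = (0, 0)" for v
    proof -
      have e: "2 * halfCform v = fst v ^ 2 + snd v ^ 2 + (fst v - snd v) ^ 2"
        by (simp add: halfCform_def power2_eq_square algebra_simps)
      have sq: "0 \<le> fst v ^ 2" "0 \<le> snd v ^ 2" "0 \<le> (fst v - snd v) ^ 2" by simp_all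
      show "0 \<le> halfCform v" using e sq by linarith
      assume "halfCform v = 0"
      then have "fst v ^ 2 = 0" "snd v ^ 2 = 0" using e sq by linarith+
      then show "v = (0, 0)" by (simp add: prod_eq_iff)
    qed
    have "\<exists>j\<in>{1..k - 1}. r j \<noteq> (0, 0)"
    proof (rule ccontr)
      assume *: "\<not> ?thesis"
      have "r j = z0 j" for j
        using * PiE_arb[OF r(1), of j] by (cases "j \<in> {1..k - 1}") (auto simp: z0_def)
      then show False using r(2) by auto
    qed
    then obtain j where j: "j \<in> {1..k - 1}" "r j \<noteq> (0, 0)" by blast
    have "0 < (\<Sum>j=1..k-1. halfCform (r j))"
    proof (rule sum_pos2[OF _ j(1)])
      show "0 < halfCform (r j)" using pos[of "r j"] j(2) by linarith
    qed (use pos in auto)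
    moreover have "0 \<le> (\<Sum>j=i..k-1. vabs (r j))"
      using nonneg assms by (intro sum_nonneg) (auto simp: vabs_def)
    ultimately have "(0::complex) powi ((\<Sum>j=1..k-1. halfCform (r j)) + (\<Sum>j=i..k-1. vabs (r j))) = 0"
      by (simp add: power_int_0_left)
    with nz show False by (simp add: summand_def)
  qed
  have one: "summand 0 k i z0 = 1"
  proof -
    have z0: "z0 j = (0, 0)" if "j \<in> {1..k - 1}" for j using that by (simp add: z0_def)
    have 1: "(\<Sum>j=1..k-1. halfCform (z0 j)) = 0" "(\<Sum>j=i..k-1. vabs (z0 j)) = 0"
      using assms by (auto intro!: sum.neutral simp: z0 halfCform_def vabs_def)
    have 2: "(\<Prod>j=1..k - 2. inv_qpoch2 0 0 (z0 j - z0 (j + 1))) = 1"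
      by (rule prod.neutral) (auto simp: z0 inv_qpoch2_def inv_0)
    have 3: "(if i = 1 then 1 else 1 - 0 powi (vabs (z0 (i - 1)) + 1)) = (1 :: complex)"
    proof (cases "i = 1")
      case False
      then have "i - 1 \<in> {1..k - 1}" using assms by auto
      from z0[OF this] show ?thesis by (simp add: vabs_def)
    qed simp
    have 4: "z0 (k - 1) = (0, 0)" using assms by (intro z0) simp
    show ?thesis unfolding summand_def 1 2 3 4
      by (simp add: vabs_def qpoch_0 inv_qpoch2_def inv_0)
  qed
  show ?thesis
  proof (rule has_sum_finite_neutralI[of "{z0}"])
    show "{z0} \<subseteq> {1..k - 1} \<rightarrow>\<^sub>E UNIV" by (simp add: z0_def)
  qed (use zero one in auto)
qed

theorem theorem5p8:
  fixes q :: complex and k i :: nat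
  assumes "norm q < 1" and "k \<ge> 2" and "i \<in> {1..k}"
  shows "(summand q k i has_sum
           (qpoch_inf (q^i) (q^(3*k)) * qpoch_inf (q^i) (q^(3*k)) * qpoch_inf (q^(2*i)) (q^(3*k))
            * qpoch_inf (q^(3*k-2*i)) (q^(3*k)) * qpoch_inf (q^(3*k-i)) (q^(3*k))
            * qpoch_inf (q^(3*k-i)) (q^(3*k)) * qpoch_inf (q^(3*k)) (q^(3*k))
            * qpoch_inf (q^(3*k)) (q^(3*k))
            / (qpoch_inf q q) ^ 3))
         ({1..k-1} \<rightarrow>\<^sub>E (UNIV :: (int \<times> int) set))"
proof (cases "q = 0")
  case True
  have "qpoch_inf 0 p = 1" for p by (simp add: qpoch_inf_def)
  \<comment> \<open>All exponents on the right are positive, so every product there is taken at 0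
    and equals 1.\<close>
  moreover have "3 * k - 2 * i \<noteq> 0" "3 * k - i \<noteq> 0" "i \<noteq> 0" "k \<noteq> 0" using assms by auto
  ultimately show ?thesis using summand_0_has_sum[of k i] assms by (simp add: True power_0_left)
next
  case False
  then interpret nome q using assms(1) by unfold_locales
  have i: "i \<ge> 1" "i \<le> k" and k: "k \<ge> 1" "k - 1 \<ge> 1" using assms by auto
  have P: "(q ^ k) ^ 3 = q ^ (3 * k)" "(q ^ i) ^ 2 = q ^ (2 * i)"
    by (simp_all add: mult.commute flip: power_mult)
  have D: "q ^ (3 * k) / q ^ i = q ^ (3 * k - i)" "q ^ (3 * k) / q ^ (2 * i) = q ^ (3 * k - 2 * i)"
    using i False by (simp_all add: power_diff)
  \<comment> \<open>The exponent 3 of the denominator arises as 5 from the kernel limit minus 2 from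
    removing the outermost denominator.\<close>
  have "((\<lambda>r. chain_term (weights i) (k - 1) r * seed_vec (r (k - 1))) has_sum
     (qpoch_inf (q^i) (q^(3*k)) ^ 2 * qpoch_inf (q^(3*k-i)) (q^(3*k)) ^ 2 * qpoch_inf (q^(2*i)) (q^(3*k))
      * qpoch_inf (q^(3*k-2*i)) (q^(3*k)) * qpoch_inf (q^(3*k)) (q^(3*k)) ^ 2 / qpoch_inf q q ^ 5 * qpoch_inf q q ^ 2)) ({1..k - 1} \<rightarrow>\<^sub>E UNIV)"
    using bailey_chain_has_sum[OF decaying_weights admissible_seed_vec k(2) chain_limit[OF i k(1)]] unfolding P D .
  moreover have "(\<lambda>r. chain_term (weights i) (k - 1) r * seed_vec (r (k - 1))) = summand q k i"
    using summand_eq_chain_term[OF i assms(2)] by auto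
  ultimately show ?thesis
    using qpoch_inf_nonzero by (simp add: power2_eq_square eval_nat_numeral mult_ac)
qed

end
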